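(* Let $(M,F)$ be a forward complete Finsler manifold, let $\phi:M\to\mathbb{R}$ be a $C^1$-function, let $h:[0,\infty)\to[0,\infty)$ be continuous, surjective and strictly increasing, and set $$\psi(x)=\int_0^xh(r)\,dr,\qquad \psi^*(y)=\sup_{x\ge0}[xy-\psi(x)].$$ Then for every $x_0\in M$ there exists a $C^1$-curve $\xi:[0,T)\to M$ with $\xi(0)=x_0$ solving the generalized gradient flow equation $$\frac{d}{dt}(\phi\circ\xi)(t)=-\psi\big(F(\xi'(t))\big)-\psi^*\big(F(\nabla(-\phi)|_{\xi(t)})\big)\quad\text{for }\mathscr{L}^1\text{-a.e. }t\in(0,T),$$ and the energy identity $$(\phi\circ\xi)(s)-(\phi\circ\xi)(t)=\int_s^t\psi\big(F(\xi'(r))\big)\,dr+\int_s^t\psi^*\big(F(\nabla(-\phi)|_{\xi(r)})\big)\,dr\quad\text{for all } s,t\in[0,T)$$ holds. Here $T\in(0,\infty]$ denotes the maximal existence time, which satisfies: (i) if $T<\infty$, then $\lim_{t\to T}d_F(x_0,\xi(t))=\infty$; (ii) if $\phi$ is bounded, then $T=\infty$.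
   Context: A Finsler manifold $(M,F)$ is a connected smooth manifold $M$ without boundary of dimension $n\ge 2$ with a continuous function $F:TM\to[0,\infty)$ such that (a) $F\in C^\infty(TM\setminus\{0\})$; (b) $F(x,\lambda y)=\lambda F(x,y)$ for all $\lambda\ge 0$; (c) the matrix $g_{ij}(x,y)=[\frac12F^2]_{y^iy^j}(x,y)$ is positive definite for $y\neq 0$. $F(x,-y)=F(x,y)$ is not assumed. The (generally non-symmetric) distance is $d_F(p,q)=\inf\int_0^1F(\gamma'(t))\,dt$ over piecewise smooth curves $\gamma:[0,1]\to M$ from $p$ to $q$. $(M,F)$ is forward complete if every forward Cauchy sequence (for each $\epsilon>0$ there is $N$ with $d_F(x_m,x_n)<\epsilon$ whenever $n\ge m>N$) converges in $M$. Legendre transformation: $\mathfrak{L}:TM\to T^*M$, $\mathfrak{L}(X)=g_X(X,\cdot)$ for $X\ne0$ (where $g_X(Y,Z)=g_{ij}(X)Y^iZ^j$) and $\mathfrak{L}(0)=0$. The gradient of a $C^1$-function $f$ is $\nabla f=\mathfrak{L}^{-1}(df)$; in general $\nabla(-\phi)\neq-\nabla\phi$. $\mathscr{L}^1$ is Lebesgue measure on $\mathbb{R}$. *)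

theory Defs
  imports "HOL-Analysis.Analysis"
begin

text \<open>
  Maps of class \<open>C\<^sup>k\<close> between normed spaces; only meaningful for open \<open>S\<close>.
  Continuity of all \<open>k\<close>-fold directional derivatives is, in finite dimensions, the usual notion.
\<close>

primrec nat_C_on ::
  "nat \<Rightarrow> 'a::real_normed_vector set \<Rightarrow> ('a \<Rightarrow> 'b::real_normed_vector) \<Rightarrow> bool" where
  "nat_C_on 0 S f \<longleftrightarrow> continuous_on S f"
| "nat_C_on (Suc k) S f \<longleftrightarrow>
     (\<forall>x\<in>S. f differentiable (at x)) \<and>
     (\<forall>v. nat_C_on k S (\<lambda>x. frechet_derivative f (at x) v))"

definition C_on ::
  "enat \<Rightarrow> 'a::real_normed_vector set \<Rightarrow> ('a \<Rightarrow> 'b::real_normed_vector) \<Rightarrow> bool" where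
  "C_on k S f \<longleftrightarrow> (\<forall>j. enat j \<le> k \<longrightarrow> nat_C_on j S f)"


subsection \<open>Smooth manifolds\<close>

text \<open>
  The manifold is the type \<open>'m\<close> with its topology.  A chart is a pair of an open domain and a
  coordinate map into \<open>\<real>\<^sup>n\<close>, \<open>n = CARD('n)\<close>; the values of the coordinate map outside the
  domain are irrelevant.
\<close>

type_synonym ('m, 'n) chart = "'m set \<times> ('m \<Rightarrow> real ^ 'n)"

abbreviation chart_dom :: "('m, 'n) chart \<Rightarrow> 'm set" where "chart_dom c \<equiv> fst c"
abbreviation coord :: "('m, 'n) chart \<Rightarrow> 'm \<Rightarrow> real ^ 'n" where "coord c \<equiv> snd c"
abbreviation chart_img :: "('m, 'n) chart \<Rightarrow> (real ^ 'n) set" where "chart_img c \<equiv> coord c ` chart_dom c"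

definition param :: "('m, 'n) chart \<Rightarrow> real ^ 'n \<Rightarrow> 'm" where
  "param c = inv_into (chart_dom c) (coord c)"

definition transition :: "('m, 'n) chart \<Rightarrow> ('m, 'n) chart \<Rightarrow> real ^ 'n \<Rightarrow> real ^ 'n" where
  "transition c c' = coord c' \<circ> param c"

definition smooth_atlas :: "('m::topological_space, 'n::finite) chart set \<Rightarrow> bool" where
  "smooth_atlas A \<longleftrightarrow>
     (\<forall>c\<in>A. open (chart_dom c) \<and> open (chart_img c) \<and>
            homeomorphism (chart_dom c) (chart_img c) (coord c) (param c)) \<and>
     (\<Union>c\<in>A. chart_dom c) = UNIV \<and>
     (\<forall>c\<in>A. \<forall>c'\<in>A. C_on \<infinity> (coord c ` (chart_dom c \<inter> chart_dom c')) (transition c c'))"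

text \<open>
  A tangent vector at \<open>p\<close> is the family of its coordinate vectors in all charts around \<open>p\<close>,
  subject to the usual transformation rule.  The value \<open>0\<close> at the other pairs makes
  this representation unique, and the vector space operations are pointwise.
\<close>

type_synonym ('m, 'n) tvec = "('m, 'n) chart \<Rightarrow> real ^ 'n"

definition tangent_space ::
  "('m, 'n::finite) chart set \<Rightarrow> 'm \<Rightarrow> ('m, 'n) tvec set" where
  "tangent_space A p =
     {X. (\<forall>c. \<not> (c \<in> A \<and> p \<in> chart_dom c) \<longrightarrow> X c = 0) \<and>
         (\<forall>c\<in>A. \<forall>c'\<in>A. p \<in> chart_dom c \<inter> chart_dom c' \<longrightarrow>
            X c' = frechet_derivative (transition c c') (at (coord c p)) (X c))}"

text \<open>The tangent vector at \<open>p\<close> with coordinates \<open>y\<close> in the chart \<open>c\<close>.\<close>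

definition tvec_of ::
  "('m, 'n::finite) chart set \<Rightarrow> ('m, 'n) chart \<Rightarrow> 'm \<Rightarrow> real ^ 'n \<Rightarrow> ('m, 'n) tvec" where
  "tvec_of A c p y =
     (\<lambda>c'. if c' \<in> A \<and> p \<in> chart_dom c'
           then frechet_derivative (transition c c') (at (coord c p)) y else 0)"

definition C_function ::
  "enat \<Rightarrow> ('m, 'n::finite) chart set \<Rightarrow> ('m \<Rightarrow> real) \<Rightarrow> bool" where
  "C_function k A f \<longleftrightarrow> (\<forall>c\<in>A. C_on k (chart_img c) (f \<circ> param c))"

text \<open>
  Curves of class \<open>C\<^sup>k\<close> on an interval \<open>S\<close> that need not be open: in charts they locally extend
  to \<open>C\<^sup>k\<close> maps on open sets.  In particular they are continuous on \<open>S\<close>.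
\<close>

definition C_curve ::
  "enat \<Rightarrow> ('m, 'n::finite) chart set \<Rightarrow> real set \<Rightarrow> (real \<Rightarrow> 'm) \<Rightarrow> bool" where
  "C_curve k A S \<gamma> \<longleftrightarrow>
     (\<forall>t\<in>S. \<forall>c\<in>A. \<gamma> t \<in> chart_dom c \<longrightarrow>
        (\<exists>I g. open I \<and> t \<in> I \<and> C_on k I g \<and>
               (\<forall>s\<in>I \<inter> S. \<gamma> s \<in> chart_dom c \<and> coord c (\<gamma> s) = g s)))"

definition velocity ::
  "('m, 'n::finite) chart set \<Rightarrow> real set \<Rightarrow> (real \<Rightarrow> 'm) \<Rightarrow> real \<Rightarrow> ('m, 'n) tvec" where
  "velocity A S \<gamma> t =
     (\<lambda>c. if c \<in> A \<and> \<gamma> t \<in> chart_dom c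
          then vector_derivative (coord c \<circ> \<gamma>) (at t within S) else 0)"

definition piecewise_smooth_curve ::
  "('m, 'n::finite) chart set \<Rightarrow> (real \<Rightarrow> 'm) \<Rightarrow> bool" where
  "piecewise_smooth_curve A \<gamma> \<longleftrightarrow>
     (\<exists>N (\<tau> :: nat \<Rightarrow> real). \<tau> 0 = 0 \<and> \<tau> N = 1 \<and>
        (\<forall>i<N. \<tau> i < \<tau> (Suc i) \<and> C_curve \<infinity> A {\<tau> i..\<tau> (Suc i)} \<gamma>))"


subsection \<open>Finsler manifolds\<close>

text \<open>
  A function on the tangent bundle is written \<open>F p X\<close> with \<open>X\<close> in the tangent space at \<open>p\<close>;
  its values at other arguments are irrelevant.  Its coordinate representation in the bundle
  chart induced by \<open>c\<close> is defined on \<open>chart_img c \<times> \<real>\<^sup>n\<close>.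
\<close>

definition local_rep ::
  "('m, 'n::finite) chart set \<Rightarrow> ('m \<Rightarrow> ('m, 'n) tvec \<Rightarrow> real) \<Rightarrow> ('m, 'n) chart \<Rightarrow>
   (real ^ 'n) \<times> (real ^ 'n) \<Rightarrow> real" where
  "local_rep A F c = (\<lambda>(x, y). F (param c x) (tvec_of A c (param c x) y))"

definition partial_deriv :: "'n::finite \<Rightarrow> (real ^ 'n \<Rightarrow> real) \<Rightarrow> real ^ 'n \<Rightarrow> real" where
  "partial_deriv i f y = frechet_derivative f (at y) (axis i 1)"

definition g_matrix ::
  "('m, 'n::finite) chart set \<Rightarrow> ('m \<Rightarrow> ('m, 'n) tvec \<Rightarrow> real) \<Rightarrow> ('m, 'n) chart \<Rightarrow>
   real ^ 'n \<Rightarrow> real ^ 'n \<Rightarrow> real ^ 'n ^ 'n" where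
  "g_matrix A F c x y =
     (\<chi> i j. partial_deriv j (partial_deriv i (\<lambda>z. 1/2 * (local_rep A F c (x, z))\<^sup>2)) y)"

definition positive_definite :: "real ^ 'n ^ 'n::finite \<Rightarrow> bool" where
  "positive_definite G \<longleftrightarrow> transpose G = G \<and> (\<forall>v. v \<noteq> 0 \<longrightarrow> v \<bullet> (G *v v) > 0)"

definition finsler_manifold ::
  "('m::{t2_space, second_countable_topology}, 'n::finite) chart set \<Rightarrow>
   ('m \<Rightarrow> ('m, 'n) tvec \<Rightarrow> real) \<Rightarrow> bool" where
  "finsler_manifold A F \<longleftrightarrow>
     connected (UNIV :: 'm set) \<and> CARD('n) \<ge> 2 \<and> smooth_atlas A \<and>
     (\<forall>p. \<forall>X\<in>tangent_space A p. F p X \<ge> 0) \<and>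
     (\<forall>c\<in>A. continuous_on (chart_img c \<times> UNIV) (local_rep A F c)) \<and>
     (\<forall>c\<in>A. C_on \<infinity> (chart_img c \<times> (- {0})) (local_rep A F c)) \<and>
     (\<forall>p. \<forall>X\<in>tangent_space A p. \<forall>l\<ge>0. F p (\<lambda>c. l *\<^sub>R X c) = l * F p X) \<and>
     (\<forall>c\<in>A. \<forall>x\<in>chart_img c. \<forall>y. y \<noteq> 0 \<longrightarrow> positive_definite (g_matrix A F c x y))"

definition finsler_length ::
  "('m, 'n::finite) chart set \<Rightarrow> ('m \<Rightarrow> ('m, 'n) tvec \<Rightarrow> real) \<Rightarrow> (real \<Rightarrow> 'm) \<Rightarrow> real" where
  "finsler_length A F \<gamma> = integral {0..1} (\<lambda>t. F (\<gamma> t) (velocity A {0..1} \<gamma> t))"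

definition finsler_dist ::
  "('m, 'n::finite) chart set \<Rightarrow> ('m \<Rightarrow> ('m, 'n) tvec \<Rightarrow> real) \<Rightarrow> 'm \<Rightarrow> 'm \<Rightarrow> real" where
  "finsler_dist A F p q =
     Inf (finsler_length A F ` {\<gamma>. piecewise_smooth_curve A \<gamma> \<and> \<gamma> 0 = p \<and> \<gamma> 1 = q})"

definition forward_Cauchy ::
  "('m, 'n::finite) chart set \<Rightarrow> ('m \<Rightarrow> ('m, 'n) tvec \<Rightarrow> real) \<Rightarrow> (nat \<Rightarrow> 'm) \<Rightarrow> bool" where
  "forward_Cauchy A F x \<longleftrightarrow>
     (\<forall>\<epsilon>>0. \<exists>N. \<forall>m n. n \<ge> m \<and> m > N \<longrightarrow> finsler_dist A F (x m) (x n) < \<epsilon>)"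

definition forward_complete ::
  "('m::topological_space, 'n::finite) chart set \<Rightarrow> ('m \<Rightarrow> ('m, 'n) tvec \<Rightarrow> real) \<Rightarrow> bool" where
  "forward_complete A F \<longleftrightarrow> (\<forall>x. forward_Cauchy A F x \<longrightarrow> (\<exists>l. x \<longlonglongrightarrow> l))"


subsection \<open>Legendre transformation and gradient\<close>

text \<open>
  The fundamental tensor and the differential do not depend on the chart used to express them,
  so an arbitrary chart around the point is chosen.
\<close>

definition chart_at :: "('m, 'n) chart set \<Rightarrow> 'm \<Rightarrow> ('m, 'n) chart" where
  "chart_at A p = (SOME c. c \<in> A \<and> p \<in> chart_dom c)"

definition fundamental_tensor ::
  "('m, 'n::finite) chart set \<Rightarrow> ('m \<Rightarrow> ('m, 'n) tvec \<Rightarrow> real) \<Rightarrow> 'm \<Rightarrow>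
   ('m, 'n) tvec \<Rightarrow> ('m, 'n) tvec \<Rightarrow> ('m, 'n) tvec \<Rightarrow> real" where
  "fundamental_tensor A F p X Y Z =
     (let c = chart_at A p
      in \<Sum>i\<in>UNIV. \<Sum>j\<in>UNIV. g_matrix A F c (coord c p) (X c) $ i $ j * Y c $ i * Z c $ j)"

text \<open>Covectors at \<open>p\<close> are functionals on the tangent space, made extensional by \<open>restrict\<close>.\<close>

definition legendre ::
  "('m, 'n::finite) chart set \<Rightarrow> ('m \<Rightarrow> ('m, 'n) tvec \<Rightarrow> real) \<Rightarrow> 'm \<Rightarrow>
   ('m, 'n) tvec \<Rightarrow> (('m, 'n) tvec \<Rightarrow> real)" where
  "legendre A F p X =
     restrict (\<lambda>Y. if X = (\<lambda>_. 0) then 0 else fundamental_tensor A F p X X Y) (tangent_space A p)"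

definition differential ::
  "('m, 'n::finite) chart set \<Rightarrow> ('m \<Rightarrow> real) \<Rightarrow> 'm \<Rightarrow> (('m, 'n) tvec \<Rightarrow> real)" where
  "differential A f p =
     restrict (\<lambda>Y. let c = chart_at A p
                   in frechet_derivative (f \<circ> param c) (at (coord c p)) (Y c)) (tangent_space A p)"

definition gradient ::
  "('m, 'n::finite) chart set \<Rightarrow> ('m \<Rightarrow> ('m, 'n) tvec \<Rightarrow> real) \<Rightarrow> ('m \<Rightarrow> real) \<Rightarrow> 'm \<Rightarrow>
   ('m, 'n) tvec" where
  "gradient A F f p = inv_into (tangent_space A p) (legendre A F p) (differential A f p)"


subsection \<open>Generalized gradient flow\<close>

definition psi :: "(real \<Rightarrow> real) \<Rightarrow> real \<Rightarrow> real" where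
  "psi h x = integral {0..x} h"

definition psi_star :: "(real \<Rightarrow> real) \<Rightarrow> real \<Rightarrow> real" where
  "psi_star h y = (SUP x\<in>{0..}. x * y - psi h x)"

definition time_interval :: "ereal \<Rightarrow> real set" where
  "time_interval T = {t. 0 \<le> t \<and> ereal t < T}"

abbreviation speed ::
  "('m, 'n::finite) chart set \<Rightarrow> ('m \<Rightarrow> ('m, 'n) tvec \<Rightarrow> real) \<Rightarrow> ereal \<Rightarrow> (real \<Rightarrow> 'm) \<Rightarrow>
   real \<Rightarrow> real" where
  "speed A F T \<xi> t \<equiv> F (\<xi> t) (velocity A (time_interval T) \<xi> t)"

abbreviation slope ::
  "('m, 'n::finite) chart set \<Rightarrow> ('m \<Rightarrow> ('m, 'n) tvec \<Rightarrow> real) \<Rightarrow> ('m \<Rightarrow> real) \<Rightarrow> 'm \<Rightarrow> real" where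
  "slope A F \<phi> p \<equiv> F p (gradient A F (\<lambda>q. - \<phi> q) p)"

definition gradient_flow_solution ::
  "('m, 'n::finite) chart set \<Rightarrow> ('m \<Rightarrow> ('m, 'n) tvec \<Rightarrow> real) \<Rightarrow> ('m \<Rightarrow> real) \<Rightarrow>
   (real \<Rightarrow> real) \<Rightarrow> 'm \<Rightarrow> ereal \<Rightarrow> (real \<Rightarrow> 'm) \<Rightarrow> bool" where
  "gradient_flow_solution A F \<phi> h x\<^sub>0 T \<xi> \<longleftrightarrow>
     0 < T \<and> C_curve 1 A (time_interval T) \<xi> \<and> \<xi> 0 = x\<^sub>0 \<and>
     (AE t in lborel. 0 < t \<and> ereal t < T \<longrightarrow>
        ((\<phi> \<circ> \<xi>) has_real_derivative
           - psi h (speed A F T \<xi> t) - psi_star h (slope A F \<phi> (\<xi> t))) (at t))"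

definition maximal_gradient_flow_solution ::
  "('m, 'n::finite) chart set \<Rightarrow> ('m \<Rightarrow> ('m, 'n) tvec \<Rightarrow> real) \<Rightarrow> ('m \<Rightarrow> real) \<Rightarrow>
   (real \<Rightarrow> real) \<Rightarrow> 'm \<Rightarrow> ereal \<Rightarrow> (real \<Rightarrow> 'm) \<Rightarrow> bool" where
  "maximal_gradient_flow_solution A F \<phi> h x\<^sub>0 T \<xi> \<longleftrightarrow>
     gradient_flow_solution A F \<phi> h x\<^sub>0 T \<xi> \<and>
     \<not> (\<exists>T' \<xi>'. T < T' \<and> gradient_flow_solution A F \<phi> h x\<^sub>0 T' \<xi>' \<and>
               (\<forall>t\<in>time_interval T. \<xi>' t = \<xi> t))"

definition energy_identity ::
  "('m, 'n::finite) chart set \<Rightarrow> ('m \<Rightarrow> ('m, 'n) tvec \<Rightarrow> real) \<Rightarrow> ('m \<Rightarrow> real) \<Rightarrow>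
   (real \<Rightarrow> real) \<Rightarrow> ereal \<Rightarrow> (real \<Rightarrow> 'm) \<Rightarrow> bool" where
  "energy_identity A F \<phi> h T \<xi> \<longleftrightarrow>
     (\<forall>s\<in>time_interval T. \<forall>t\<in>time_interval T.
        interval_lebesgue_integrable lborel (ereal s) (ereal t) (\<lambda>r. psi h (speed A F T \<xi> r)) \<and>
        interval_lebesgue_integrable lborel (ereal s) (ereal t)
          (\<lambda>r. psi_star h (slope A F \<phi> (\<xi> r))) \<and>
        (\<phi> \<circ> \<xi>) s - (\<phi> \<circ> \<xi>) t =
          (LBINT r=s..t. psi h (speed A F T \<xi> r)) +
          (LBINT r=s..t. psi_star h (slope A F \<phi> (\<xi> r))))"

end

theory Submission
  imports Defs "HOL-Complex_Analysis.Great_Picard"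
begin

text \<open>
  On each tangent space the Fenchel--Young inequality for \<open>\<psi>\<close> and the Cauchy--Schwarz inequality of the
  Minkowski norm give \<open>-d\<phi>(X) \<le> \<psi>(F X) + \<psi>\<^sup>*(F(\<nabla>(-\<phi>)))\<close>, with equality for exactly one \<open>X\<close>.
  This maximizer depends continuously on the base point, so the solutions of the flow equation are
  the integral curves of a continuous vector field: Peano's theorem yields local solutions and
  Zorn's lemma a maximal one.

  As in the Hopf--Rinow--Cohn-Vossen theorem, forward completeness makes all forward balls relatively
  compact.  If \<open>T < \<infinity>\<close> and the distance to the initial point does not tend to infinity, the curve therefore
  has a cluster point as \<open>t \<rightarrow> T\<close>; it converges to it, because the field is locally bounded, and can be
  continued.  If \<open>\<phi>\<close> is bounded, \<open>x \<le> \<psi>(x) + \<psi>\<^sup>*(1)\<close> bounds the distance on finite time intervals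
  by the energy.
\<close>

subsection \<open>Maps of class \<open>C\<^sup>k\<close>\<close>

text \<open>The equation prescribes only the scalar rate of \<open>\<phi>\<close> along the curve,
  and only almost everywhere. Equality in the two inequalities turns it into a vector equation at
  every time where it holds, and continuity of both sides extends this to all times; hence
  maximality among integral curves is maximality among solutions. The field is continuous but in
  general not Lipschitz, so solutions may branch and a maximal one has to be chosen. An explicit
  formula for the field runs through the inverses of \<open>h\<close> and of the Legendre map;
  describing it as a maximizer avoids having to prove either inverse continuous. The distance is not
  symmetric and is never treated as a metric: the topology is that of the charts, and forward balls
  are compared with coordinate balls through two-sided bounds of \<open>F\<close> by the Euclidean
  norm. Finally, the distance is an infimum over piecewise smooth curves while the flow is only
  \<open>C^1\<close>, so the flow is not itself a competitor; short chords that are straight in a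
  chart take its place.\<close>

lemma nat_C_on_cong:
  assumes "open S" "\<And>x. x \<in> S \<Longrightarrow> f x = g x" "nat_C_on k S f"
  shows "nat_C_on k S g"
  using assms(2,3)
proof (induction k arbitrary: f g)
  case 0
  then show ?case by (simp cong: continuous_on_cong)
next
  case (Suc k)
  have d: "(g has_derivative frechet_derivative f (at x)) (at x)" if "x \<in> S" for x
  proof -
    have "(f has_derivative frechet_derivative f (at x)) (at x)"
      using Suc.prems that by (simp add: frechet_derivative_works[symmetric])
    then show ?thesis
      using has_derivative_transform_within_open[OF _ assms(1) that] Suc.prems(1) by blast
  qed
  then have e: "frechet_derivative g (at x) = frechet_derivative f (at x)" if "x \<in> S" for x
    using that frechet_derivative_at by metis
  show ?case
  proof (simp, intro conjI ballI allI)
    show "g differentiable at x" if "x \<in> S" for x using d[OF that] by (auto simp: differentiable_def)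
    fix v show "nat_C_on k S (\<lambda>x. frechet_derivative g (at x) v)"
      by (rule Suc.IH[of "\<lambda>x. frechet_derivative f (at x) v"]) (use Suc.prems e in auto)
  qed
qed

text \<open>An affine inner map has constant derivative, so the derivative in direction
  \<open>r\<close> is again a map restricted to a line, now the derivative of \<open>f\<close> along
  \<open>r *\<^sub>R v\<close>, and the induction closes. It serves both affine reparametrization of
  curves and straight segments of one chart viewed in another.\<close>

lemma nat_C_on_affine:
  fixes f :: "'a::real_normed_vector \<Rightarrow> 'b::real_normed_vector"
  assumes "open S" "nat_C_on k S f"
  shows "nat_C_on k ((\<lambda>t. x + t *\<^sub>R v) -` S) (\<lambda>t::real. f (x + t *\<^sub>R v))"
  using assms(2)
proof (induction k arbitrary: f)
  case 0
  then show ?case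
    by (auto intro!: continuous_on_compose2[of S f] continuous_intros)
next
  case (Suc k)
  let ?T = "(\<lambda>t. x + t *\<^sub>R v) -` S"
  have opn: "open ?T"
    by (rule open_vimage[OF assms(1)]) (intro continuous_intros)
  have d: "((\<lambda>t. f (x + t *\<^sub>R v)) has_derivative
            (\<lambda>r. frechet_derivative f (at (x + t *\<^sub>R v)) (r *\<^sub>R v))) (at t)" if "t \<in> ?T" for t
  proof -
    have "(f has_derivative frechet_derivative f (at (x + t *\<^sub>R v))) (at (x + t *\<^sub>R v))"
      using Suc.prems that by (simp add: frechet_derivative_works[symmetric])
    moreover have "((\<lambda>t. x + t *\<^sub>R v) has_derivative (\<lambda>r. r *\<^sub>R v)) (at t)"
      by (auto intro!: derivative_eq_intros)
    ultimately show ?thesis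
      using diff_chain_at[of "\<lambda>t. x + t *\<^sub>R v" "\<lambda>r. r *\<^sub>R v" t f] by (simp add: o_def)
  qed
  have e: "frechet_derivative (\<lambda>t. f (x + t *\<^sub>R v)) (at t) =
      (\<lambda>r. frechet_derivative f (at (x + t *\<^sub>R v)) (r *\<^sub>R v))" if "t \<in> ?T" for t
    using d[OF that] frechet_derivative_at by metis
  show ?case
  proof (simp del: vimage_eq, intro conjI ballI allI)
    show "(\<lambda>t. f (x + t *\<^sub>R v)) differentiable at t" if "t \<in> ?T" for t
      using d[OF that] by (auto simp: differentiable_def)
    fix r
    have "nat_C_on k ?T (\<lambda>t. frechet_derivative f (at (x + t *\<^sub>R v)) (r *\<^sub>R v))"
      by (rule Suc.IH[of "\<lambda>y. frechet_derivative f (at y) (r *\<^sub>R v)"]) (use Suc.prems in auto)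
    then show "nat_C_on k ?T (\<lambda>t. frechet_derivative (\<lambda>t. f (x + t *\<^sub>R v)) (at t) r)"
      by (rule nat_C_on_cong[OF opn, rotated]) (simp add: e)
  qed
qed

lemma C_on_affine:
  fixes f :: "'a::real_normed_vector \<Rightarrow> 'b::real_normed_vector"
  assumes "open S" "C_on k S f"
  shows "C_on k ((\<lambda>t. x + t *\<^sub>R v) -` S) (\<lambda>t::real. f (x + t *\<^sub>R v))"
  using assms nat_C_on_affine unfolding C_on_def by blast

lemma C_on_imp_continuous_on: "C_on k S f \<Longrightarrow> continuous_on S f"
  unfolding C_on_def by (metis nat_C_on.simps(1) zero_enat_def zero_le)

lemma C_on_1_iff:
  "C_on 1 S f \<longleftrightarrow> continuous_on S f \<and> (\<forall>x\<in>S. f differentiable at x) \<and>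
     (\<forall>v. continuous_on S (\<lambda>x. frechet_derivative f (at x) v))"
proof -
  have "enat j \<le> 1 \<longleftrightarrow> j = 0 \<or> j = 1" for j by (auto simp: one_enat_def)
  then show ?thesis by (auto simp: C_on_def one_enat_def)
qed

lemma C_on_has_derivative:
  assumes "C_on k S f" "1 \<le> k" "x \<in> S"
  shows "(f has_derivative frechet_derivative f (at x)) (at x)"
proof -
  have "nat_C_on 1 S f" using assms by (auto simp: C_on_def one_enat_def)
  then show ?thesis using assms(3) by (simp add: frechet_derivative_works[symmetric])
qed

lemma C_on_1_vector_derivative:
  assumes "open I" "\<And>s. s \<in> I \<Longrightarrow> (g has_vector_derivative W s) (at s)" "continuous_on I W"
  shows "C_on 1 I (g :: real \<Rightarrow> 'a::real_normed_vector)"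
  unfolding C_on_1_iff
proof (intro conjI ballI allI)
  show "continuous_on I g"
    by (meson assms(2) continuous_at_imp_continuous_on has_vector_derivative_continuous)
  show "g differentiable at x" if "x \<in> I" for x
    using assms(2)[OF that] by (auto simp: has_vector_derivative_def differentiable_def)
  fix v
  have "frechet_derivative g (at x) v = v *\<^sub>R W x" if "x \<in> I" for x
    using frechet_derivative_at[OF assms(2)[OF that, unfolded has_vector_derivative_def]] by metis
  then show "continuous_on I (\<lambda>x. frechet_derivative g (at x) v)"
    using assms(3) by (simp cong: continuous_on_cong add: continuous_on_scaleR)
qed

lemma C_on_has_vector_derivative:
  assumes "C_on k I (g :: real \<Rightarrow> 'a::real_normed_vector)" "1 \<le> k" "s \<in> I"
  shows "(g has_vector_derivative frechet_derivative g (at s) 1) (at s)"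
proof -
  have d: "(g has_derivative frechet_derivative g (at s)) (at s)"
    using C_on_has_derivative assms by blast
  have "frechet_derivative g (at s) r = r *\<^sub>R frechet_derivative g (at s) 1" for r
    using linear_scale[OF has_derivative_linear[OF d], of r 1] by simp
  then have "frechet_derivative g (at s) = (\<lambda>r. r *\<^sub>R frechet_derivative g (at s) 1)" by blast
  with d show ?thesis by (simp add: has_vector_derivative_def)
qed

subsection \<open>Peano's theorem\<close>

text \<open>Mean value inequality for \<open>f x - x *\<^sub>R v\<close>. With \<open>v = 0\<close>
  it is a Lipschitz bound; with \<open>v\<close> close to the derivative it is the error of a linear
  approximation.\<close>

lemma vector_derivative_bound:
  fixes f :: "real \<Rightarrow> 'a::real_normed_vector"
  assumes "convex S" "\<And>x. x \<in> S \<Longrightarrow> (f has_vector_derivative f' x) (at x within S)"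
    "\<And>x. x \<in> S \<Longrightarrow> norm (f' x - v) \<le> B" "a \<in> S" "b \<in> S"
  shows "norm (f b - f a - (b - a) *\<^sub>R v) \<le> B * \<bar>b - a\<bar>"
proof -
  have "norm ((f b - b *\<^sub>R v) - (f a - a *\<^sub>R v)) \<le> B * norm (b - a)"
  proof (rule differentiable_bound[OF assms(1)])
    fix x assume x: "x \<in> S"
    show "((\<lambda>x. f x - x *\<^sub>R v) has_derivative (\<lambda>h. h *\<^sub>R (f' x - v))) (at x within S)"
      using assms(2)[OF x] unfolding has_vector_derivative_def
      by (auto intro!: derivative_eq_intros simp: algebra_simps)
    show "onorm (\<lambda>h. h *\<^sub>R (f' x - v)) \<le> B"
      by (rule onorm_le) (use mult_left_mono[OF assms(3)[OF x] abs_ge_zero] in \<open>simp add: mult.commute\<close>)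
  qed (use assms in auto)
  then show ?thesis by (simp add: algebra_simps)
qed

text \<open>For negative \<open>t\<close> the interval is empty and the integral is 0, so the
  formula covers the whole line; the delayed iterates below thereby carry their constant history
  without a case distinction.\<close>

lemma continuous_on_indefinite_integral:
  fixes \<phi> :: "real \<Rightarrow> 'a::banach"
  assumes "continuous_on UNIV \<phi>"
  shows "continuous_on UNIV (\<lambda>t. integral {0..t} \<phi>)"
proof -
  have "isCont (\<lambda>t. integral {0..t} \<phi>) t" for t
  proof -
    define b where "b = \<bar>t\<bar> + 1"
    have "\<phi> integrable_on {0..b}"
      by (rule integrable_continuous_real) (use assms continuous_on_subset in blast)
    then have "continuous_on {0..b} (\<lambda>t. integral {0..t} \<phi>)"
      by (rule indefinite_integral_continuous_1)
    then have "continuous_on {..<b} (\<lambda>t. integral {0..max 0 t} \<phi>)"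
      by (rule continuous_on_compose2) (auto intro!: continuous_intros simp: b_def)
    moreover have "integral {0..max 0 t} \<phi> = integral {0..t} \<phi>" for t
      by (cases "t \<ge> 0") (auto simp: max_def)
    ultimately have "continuous_on {..<b} (\<lambda>t. integral {0..t} \<phi>)" by simp
    moreover have "t \<in> {..<b}" by (auto simp: b_def)
    ultimately show ?thesis using continuous_on_eq_continuous_at[OF open_lessThan] by blast
  qed
  then show ?thesis by (simp add: continuous_at_imp_continuous_on)
qed

text \<open>Tonelli's delayed equation \<open>y' t = g (y (t - h))\<close> is solvable step by step; its solutions
  are equicontinuous and subconverge to a solution of the undelayed equation.\<close>

lemma peano_bounded:
  fixes g :: "'a::euclidean_space \<Rightarrow> 'a"
  assumes g: "continuous_on UNIV g" and B: "\<And>x. norm (g x) \<le> B"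
  obtains y where "y 0 = x0"
    "\<And>t. t \<in> {0..1} \<Longrightarrow> (y has_vector_derivative g (y t)) (at t within {0..1::real})"
proof -
  \<comment> \<open>Picard iterates of the delayed integral equation. Because of the delay, iterate
    \<open>k\<close> is already final up to time \<open>k * \<eta>\<close> (fact
    \<open>agree\<close>), so finitely many iterates solve the equation on
    \<open>{0..1}\<close>.\<close>
  define Y :: "real \<Rightarrow> nat \<Rightarrow> real \<Rightarrow> 'a" where
    "Y \<eta> = rec_nat (\<lambda>_. x0) (\<lambda>_ f t. x0 + integral {0..t} (\<lambda>s. g (f (s - \<eta>))))" for \<eta>
  have Y0: "Y \<eta> 0 = (\<lambda>_. x0)" and YS: "Y \<eta> (Suc k) = (\<lambda>t. x0 + integral {0..t} (\<lambda>s. g (Y \<eta> k (s - \<eta>))))" for \<eta> k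
    by (simp_all add: Y_def)
  have contY: "continuous_on UNIV (Y \<eta> k)" for \<eta> k
  proof (induction k)
    case 0 show ?case by (simp add: Y0)
  next
    case (Suc k)
    have "continuous_on UNIV (\<lambda>s. g (Y \<eta> k (s - \<eta>)))"
      by (intro continuous_on_compose2[OF g] continuous_on_compose2[OF Suc] continuous_intros) auto
    then show ?case unfolding YS by (intro continuous_intros continuous_on_indefinite_integral)
  qed
  have contg: "continuous_on S (\<lambda>s. g (Y \<eta> k (s - \<eta>)))" for S \<eta> k
    by (intro continuous_on_compose2[OF g] continuous_on_compose2[OF contY] continuous_intros) auto
  have agree: "t \<le> real k * \<eta> \<Longrightarrow> Y \<eta> (Suc k) t = Y \<eta> k t" if "\<eta> \<ge> 0" for \<eta> k t
  proof (induction k arbitrary: t)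
    case 0
    then show ?case by (cases "t = 0") (auto simp: YS Y0)
  next
    case (Suc k)
    have "integral {0..t} (\<lambda>s. g (Y \<eta> (Suc k) (s - \<eta>))) = integral {0..t} (\<lambda>s. g (Y \<eta> k (s - \<eta>)))"
      by (rule integral_cong) (use Suc in \<open>auto simp: algebra_simps\<close>)
    then show ?case unfolding YS[of _ "Suc k"] by (simp add: YS[of _ k])
  qed
  \<comment> \<open>With delay \<open>1 / (n + 1)\<close>, iterate \<open>n + 1\<close> is final up
    to time 1. One more iterate is taken because the derivative of an iterate involves its
    predecessor.\<close>
  define d where "d n = 1 / real (Suc n)" for n
  define y where "y n = Y (d n) (Suc (Suc n))" for n
  have dpos: "d n > 0" for n by (simp add: d_def)
  have yder: "(y n has_vector_derivative g (y n (t - d n))) (at t within {0..1})" if "t \<in> {0..1}" for n t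
  proof -
    have "Y (d n) (Suc (Suc n)) (t - d n) = Y (d n) (Suc n) (t - d n)"
    proof (rule agree)
      have "real (Suc n) * d n = 1" by (simp add: d_def)
      then show "t - d n \<le> real (Suc n) * d n" using that dpos[of n] by auto
    qed (use dpos[of n] in simp)
    moreover have "((\<lambda>t. x0 + integral {0..t} (\<lambda>s. g (Y (d n) (Suc n) (s - d n)))) has_vector_derivative
        g (Y (d n) (Suc n) (t - d n))) (at t within {0..1})"
      using integral_has_vector_derivative[OF contg that, of "d n" "Suc n"]
      by (auto intro!: derivative_eq_intros)
    ultimately show ?thesis unfolding y_def YS[of _ "Suc n"] by (simp add: YS)
  qed
  have y0: "y n t = x0" if "t \<le> 0" for n t
    using that by (cases "t = 0") (auto simp: y_def YS)
  have B0: "B \<ge> 0" using B[of 0] norm_ge_zero order_trans by blast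
  have lip: "norm (y n t - y n s) \<le> B * \<bar>t - s\<bar>" if "s \<in> {0..1}" "t \<in> {0..1}" for n s t
    using vector_derivative_bound[of "{0..1}" "y n" _ 0 B s t, OF _ yder] that B by simp
  have delay: "norm (y n (r - d n) - y n r) \<le> B * d n" if "r \<in> {0..1}" for n r
  proof (cases "r - d n \<ge> 0")
    case True
    then show ?thesis using lip[of r "r - d n" n] that dpos[of n] by (auto simp: abs_of_pos)
  next
    case False
    then have "norm (y n (r - d n) - y n r) = norm (y n 0 - y n r)" by (simp add: y0)
    also have "\<dots> \<le> B * \<bar>0 - r\<bar>" by (rule lip) (use that in auto)
    also have "\<dots> \<le> B * d n" using False B0 that by (intro mult_left_mono) auto
    finally show ?thesis .
  qed
  obtain z k where z: "continuous_on {0..1} z" "strict_mono (k :: nat \<Rightarrow> nat)"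
    and conv: "\<And>e. 0 < e \<Longrightarrow> \<exists>N. \<forall>n x. n \<ge> N \<and> x \<in> {0..1} \<longrightarrow> norm (y (k n) x - z x) < e"
  proof (rule Arzela_Ascoli[of "{0..1::real}" y "norm x0 + B"])
    show "norm (y n t) \<le> norm x0 + B" if "t \<in> {0..1}" for n t
    proof -
      have "norm (y n t - x0) \<le> B * \<bar>t\<bar>" using lip[of 0 t n] that y0[of 0] by simp
      also have "\<dots> \<le> B * 1" using that B0 by (intro mult_left_mono) auto
      finally show ?thesis using norm_triangle_sub[of "y n t" x0] by simp
    qed
    show "\<exists>d>0. \<forall>n t. t \<in> {0..1} \<and> norm (s - t) < d \<longrightarrow> norm (y n s - y n t) < e"
      if "s \<in> {0..1}" "e > 0" for s e
    proof (intro exI[of _ "e / (B + 1)"] conjI allI impI)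
      show "e / (B + 1) > 0" using that B0 by simp
      fix n t assume t: "t \<in> {0..1} \<and> norm (s - t) < e / (B + 1)"
      have "norm (y n s - y n t) \<le> B * \<bar>s - t\<bar>" using lip t that by blast
      also have "\<dots> \<le> (B + 1) * \<bar>s - t\<bar>" by (intro mult_right_mono) auto
      also have "\<dots> < e" using t B0 by (simp add: field_simps)
      finally show "norm (y n s - y n t) < e" .
    qed
  qed auto
  have lim: "(\<lambda>n. y (k n) t) \<longlonglongrightarrow> z t" if "t \<in> {0..1}" for t
    using conv that unfolding LIMSEQ_iff by blast
  have "(z has_vector_derivative g (z t)) (at t within {0..1})" if t: "t \<in> {0..1}" for t
    unfolding has_vector_derivative_def has_derivative_within_alt
  proof (intro conjI allI impI)
    show "bounded_linear (\<lambda>x. x *\<^sub>R g (z t))" by (rule bounded_linear_scaleR_left)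
    fix e :: real assume e: "e > 0"
    obtain \<delta> where \<delta>: "\<delta> > 0" "\<And>x. norm (x - z t) < \<delta> \<Longrightarrow> norm (g x - g (z t)) < e"
      using g e unfolding continuous_on_iff by (metis UNIV_I dist_norm)
    show "\<exists>d>0. \<forall>s\<in>{0..1}. norm (s - t) < d \<longrightarrow>
             norm (z s - z t - (s - t) *\<^sub>R g (z t)) \<le> e * norm (s - t)"
    \<comment> \<open>The delayed argument of \<open>g\<close> differs from \<open>z t\<close> by
      the delay error, the motion of the approximant between \<open>t\<close> and \<open>s\<close>,
      and its error at \<open>t\<close>. Each is kept below \<open>\<delta> / 4\<close>;
      \<open>B + 1\<close> guards against \<open>B = 0\<close>.\<close>
    proof (intro exI[of _ "\<delta> / (4 * (B + 1))"] conjI ballI impI)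
      show "\<delta> / (4 * (B + 1)) > 0" using \<delta> B0 by simp
      fix s assume s: "s \<in> {0..1}" "norm (s - t) < \<delta> / (4 * (B + 1))"
      have "(\<lambda>n. 1 / real (Suc (k n))) \<longlonglongrightarrow> 0"
        using LIMSEQ_subseq_LIMSEQ[OF LIMSEQ_Suc[OF lim_1_over_n] z(2)] by (simp add: o_def)
      then have "(\<lambda>n. B * d (k n)) \<longlonglongrightarrow> B * 0" unfolding d_def by (intro tendsto_intros)
      then have ev1: "\<forall>\<^sub>F n in sequentially. B * d (k n) < \<delta> / 4"
        using order_tendstoD(2)[of _ "B * 0" _ "\<delta>/4"] \<delta> by simp
      have ev2: "\<forall>\<^sub>F n in sequentially. norm (y (k n) t - z t) < \<delta> / 4"
        using tendstoD[OF lim[OF t], of "\<delta>/4"] \<delta> by (simp add: dist_norm)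
      \<comment> \<open>The bound has the same form for all late \<open>n\<close>, so it survives
        the limit and becomes the differentiability of \<open>z\<close>.\<close>
      have ev: "\<forall>\<^sub>F n in sequentially. norm (y (k n) s - y (k n) t - (s - t) *\<^sub>R g (z t)) \<le> e * \<bar>s - t\<bar>"
        using ev1 ev2
      proof eventually_elim
        case (elim n)
        let ?S = "closed_segment t s"
        have sub: "?S \<subseteq> {0..1}" using s t by (simp add: closed_segment_subset)
        show ?case
        proof (rule vector_derivative_bound[of ?S "y (k n)" "\<lambda>r. g (y (k n) (r - d (k n)))"])
          fix r assume r: "r \<in> ?S"
          then have r01: "r \<in> {0..1}" using sub by blast
          show "(y (k n) has_vector_derivative g (y (k n) (r - d (k n)))) (at r within ?S)"
            using yder[OF r01] sub has_vector_derivative_within_subset by blast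
          have "norm (y (k n) r - y (k n) t) \<le> B * \<bar>r - t\<bar>" by (rule lip[OF t r01])
          also have "\<dots> \<le> (B + 1) * \<bar>s - t\<bar>"
            using r B0 by (intro mult_mono) (auto simp: closed_segment_eq_real_ivl split: if_splits)
          also have "\<dots> < \<delta> / 4" using s(2) B0 by (simp add: field_simps)
          finally have 1: "norm (y (k n) r - y (k n) t) < \<delta> / 4" .
          have 2: "norm (y (k n) (r - d (k n)) - y (k n) r) < \<delta> / 4"
            using delay[OF r01, of "k n"] elim by linarith
          have "norm (y (k n) (r - d (k n)) - z t) =
             norm ((y (k n) (r - d (k n)) - y (k n) r) + (y (k n) r - y (k n) t) + (y (k n) t - z t))"
            by simp
          also have "\<dots> < \<delta>/4 + \<delta>/4 + \<delta>/4"
            by (intro order.strict_trans1[OF norm_triangle_ineq] add_strict_mono 1 2) (use elim in auto)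
          finally show "norm (g (y (k n) (r - d (k n))) - g (z t)) \<le> e"
            using \<delta> by (intro less_imp_le \<delta>(2)) simp
        qed auto
      qed
      have "(\<lambda>n. norm (y (k n) s - y (k n) t - (s - t) *\<^sub>R g (z t))) \<longlonglongrightarrow>
              norm (z s - z t - (s - t) *\<^sub>R g (z t))"
        by (intro tendsto_intros lim s t)
      from tendsto_upperbound[OF this ev] show
        "norm (z s - z t - (s - t) *\<^sub>R g (z t)) \<le> e * norm (s - t)" by simp
    qed
  qed
  moreover have "z 0 = x0"
    using lim[of 0] y0[of 0] LIMSEQ_unique[OF _ tendsto_const] by fastforce
  ultimately show ?thesis using that by blast
qed

text \<open>Composition with the nearest-point map of a closed ball extends the field to a bounded
  continuous one on the whole space. The time is cut so short that the solution stays in the ball,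
  where both fields agree.\<close>

lemma peano_local:
  fixes f :: "'a::euclidean_space \<Rightarrow> 'a"
  assumes "open U" "continuous_on U f" "x0 \<in> U"
  obtains \<delta> y where "\<delta> > 0" "y 0 = x0" "\<And>t. t \<in> {0..\<delta>} \<Longrightarrow> y t \<in> U"
    "\<And>t. t \<in> {0..\<delta>} \<Longrightarrow> (y has_vector_derivative f (y t)) (at t within {0..\<delta>::real})"
proof -
  obtain r where r: "r > 0" "cball x0 r \<subseteq> U"
    using assms open_contains_cball by blast
  define g where "g x = f (closest_point (cball x0 r) x)" for x
  have ne: "cball x0 r \<noteq> {}" and nin: "closest_point (cball x0 r) x \<in> cball x0 r" for x
    using r closest_point_in_set[of "cball x0 r"] by auto
  have contf: "continuous_on (cball x0 r) f" using assms r continuous_on_subset by blast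
  have "continuous_on UNIV (closest_point (cball x0 r))"
    by (rule continuous_on_closest_point) (use ne in auto)
  then have contg: "continuous_on UNIV g" unfolding g_def
    by (rule continuous_on_compose2[OF contf]) (use nin in auto)
  have "bounded (f ` cball x0 r)"
    by (intro compact_imp_bounded compact_continuous_image contf) auto
  then obtain B where B: "\<And>x. x \<in> cball x0 r \<Longrightarrow> norm (f x) \<le> B"
    unfolding bounded_iff by blast
  then have gB: "norm (g x) \<le> B" for x using nin by (simp add: g_def)
  obtain y where y: "y 0 = x0"
    "\<And>t. t \<in> {0..1} \<Longrightarrow> (y has_vector_derivative g (y t)) (at t within {0..1::real})"
    using peano_bounded[OF contg gB] by blast
  define \<delta> where "\<delta> = min 1 (r / (\<bar>B\<bar> + 1))"
  have \<delta>: "\<delta> > 0" "\<delta> \<le> 1" "\<delta> * (\<bar>B\<bar> + 1) \<le> r"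
  proof -
    show "\<delta> > 0" "\<delta> \<le> 1" using r by (auto simp: \<delta>_def)
    have "\<delta> \<le> r / (\<bar>B\<bar> + 1)" by (simp add: \<delta>_def)
    then show "\<delta> * (\<bar>B\<bar> + 1) \<le> r" by (simp add: pos_le_divide_eq)
  qed
  have yin: "y t \<in> cball x0 r" if "t \<in> {0..\<delta>}" for t
  proof -
    have "norm (y t - y 0 - (t - 0) *\<^sub>R 0) \<le> \<bar>B\<bar> * \<bar>t - 0\<bar>"
    proof (rule vector_derivative_bound[OF _ y(2)])
      show "norm (g (y x) - 0) \<le> \<bar>B\<bar>" for x using gB[of "y x"] by simp
    qed (use that \<delta> in auto)
    also have "\<dots> \<le> (\<bar>B\<bar> + 1) * \<delta>" using that by (intro mult_mono) auto
    also have "\<dots> \<le> r" using \<delta> by (simp add: mult.commute)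
    finally show ?thesis using y(1) by (simp add: dist_norm norm_minus_commute)
  qed
  show ?thesis
  proof (rule that[of \<delta> y])
    show "\<delta> > 0" "y 0 = x0" by fact+
    show "y t \<in> U" if "t \<in> {0..\<delta>}" for t using yin[OF that] r by blast
    show "(y has_vector_derivative f (y t)) (at t within {0..\<delta>})" if "t \<in> {0..\<delta>}" for t
    proof -
      have "g (y t) = f (y t)" using yin[OF that] by (simp add: g_def closest_point_self)
      moreover have "(y has_vector_derivative g (y t)) (at t within {0..1})"
        using y(2) that \<delta> by auto
      ultimately show ?thesis using has_vector_derivative_within_subset \<delta> by fastforce
    qed
  qed
qed

subsection \<open>Young functions\<close>

locale young_function =
  fixes h :: "real \<Rightarrow> real"
  assumes h_cont: "continuous_on {0..} h"
    and h_surj: "h ` {0..} = {0..}"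
    and h_mono: "strict_mono_on {0..} h"
begin

lemma h_less: "0 \<le> x \<Longrightarrow> x < y \<Longrightarrow> h x < h y"
  using h_mono by (auto simp: strict_mono_on_def)

lemma h_nonneg: "0 \<le> x \<Longrightarrow> 0 \<le> h x"
  using h_surj by auto

lemma h_preimage:
  assumes "0 \<le> s" obtains r where "0 \<le> r" "h r = s"
  using h_surj assms by (metis atLeast_iff imageE)

lemma psi_0 [simp]: "psi h 0 = 0"
  by (simp add: psi_def)

lemma psi_has_derivative:
  assumes "0 \<le> x" "x \<le> b"
  shows "(psi h has_real_derivative h x) (at x within {0..b})"
  unfolding psi_def
  by (rule integral_has_real_derivative) (use assms in \<open>auto intro: continuous_on_subset[OF h_cont]\<close>)

lemma psi_cont: "continuous_on {0..} (psi h)"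
  unfolding continuous_on_eq_continuous_within
proof
  fix x :: real assume x: "x \<in> {0..}"
  have "continuous (at x within {0..x+1}) (psi h)"
    using psi_has_derivative[of x "x+1"] x DERIV_continuous by auto
  moreover have "at x within {0..x+1} = at x within {0..}"
    by (rule at_within_nhd[of _ "{..<x+1}"]) auto
  ultimately show "continuous (at x within {0..}) (psi h)" by (simp add: continuous_within)
qed

lemma psi_mvt:
  assumes "0 \<le> x" "x < y"
  obtains \<zeta> where "x < \<zeta>" "\<zeta> < y" "psi h y - psi h x = (y - x) * h \<zeta>"
proof -
  obtain \<zeta> where "x < \<zeta>" "\<zeta> < y" "psi h y - psi h x = (\<lambda>d. d * h \<zeta>) (y - x)"
  proof (rule mvt[OF assms(2)])
    show "continuous_on {x..y} (psi h)" by (rule continuous_on_subset[OF psi_cont]) (use assms in auto)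
    fix z assume z: "x < z" "z < y"
    have "(psi h has_real_derivative h z) (at z within {0<..<y})"
      by (rule has_field_derivative_subset[OF psi_has_derivative[of z y]]) (use assms z in auto)
    then have "(psi h has_real_derivative h z) (at z)"
      using at_within_open[of z "{0<..<y}"] assms z by auto
    then show "(psi h has_derivative (\<lambda>d. d * h z)) (at z)"
      by (simp add: has_field_derivative_def mult.commute[of _ "h z"])
  qed auto
  then show ?thesis using that by auto
qed

text \<open>The derivative of \<open>x * h r - psi h x\<close> in \<open>x\<close> is
  \<open>h r - h x\<close>, which by strict monotonicity changes sign only at
  \<open>r\<close>.\<close>

lemma young_strict:
  assumes "0 \<le> r" "0 \<le> x" "x \<noteq> r"
  shows "x * h r - psi h x < r * h r - psi h r"
proof (cases "x < r")
  case True
  obtain \<zeta> where \<zeta>: "x < \<zeta>" "\<zeta> < r" "psi h r - psi h x = (r - x) * h \<zeta>"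
    using psi_mvt[OF assms(2) True] by blast
  have "(r - x) * h \<zeta> < (r - x) * h r"
    using True \<zeta> assms h_less[of \<zeta> r] by (intro mult_strict_left_mono) auto
  then show ?thesis using \<zeta> by (simp add: algebra_simps)
next
  case False
  then have "r < x" using assms by simp
  obtain \<zeta> where \<zeta>: "r < \<zeta>" "\<zeta> < x" "psi h x - psi h r = (x - r) * h \<zeta>"
    using psi_mvt[OF assms(1) \<open>r < x\<close>] by blast
  have "(x - r) * h r < (x - r) * h \<zeta>"
    using \<open>r < x\<close> \<zeta> assms h_less[of r \<zeta>] by (intro mult_strict_left_mono) auto
  then show ?thesis using \<zeta> by (simp add: algebra_simps)
qed

lemma young_weak:
  assumes "0 \<le> r" "0 \<le> x"
  shows "x * h r - psi h x \<le> r * h r - psi h r"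
  using young_strict[OF assms] by (cases "x = r") auto

text \<open>The supremum is attained at \<open>r\<close>. As \<open>h\<close> is onto, every
  nonnegative argument of \<open>psi_star\<close> is of this form, so this is the only evaluation of
  the conjugate that the proof uses.\<close>

lemma psi_star_h:
  assumes "0 \<le> r"
  shows "psi_star h (h r) = r * h r - psi h r"
  unfolding psi_star_def
proof (rule antisym)
  show "(SUP x\<in>{0..}. x * h r - psi h x) \<le> r * h r - psi h r"
    by (rule cSUP_least) (use young_weak[OF assms] in auto)
  show "r * h r - psi h r \<le> (SUP x\<in>{0..}. x * h r - psi h x)"
    by (rule cSUP_upper) (use young_weak[OF assms] assms in \<open>auto simp: bdd_above_def\<close>)
qed

lemma fenchel_young:
  assumes "0 \<le> x" "0 \<le> s"
  shows "x * s - psi h x \<le> psi_star h s"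
  using h_preimage[OF assms(2)] psi_star_h young_weak assms(1) by metis

lemma psi_star_nonneg: "0 \<le> s \<Longrightarrow> 0 \<le> psi_star h s"
  using fenchel_young[of 0 s] by simp

end

subsection \<open>Minkowski norms\<close>

text \<open>Euler's identity for a function homogeneous of degree 2: both sides are the derivative
  at \<open>t = 1\<close> along the ray through \<open>y\<close>.\<close>

lemma euler_half_square:
  fixes N :: "'a::real_normed_vector \<Rightarrow> real"
  assumes "\<And>l. 0 \<le> l \<Longrightarrow> N (l *\<^sub>R y) = l * N y" "((\<lambda>z. 1/2 * (N z)\<^sup>2) has_derivative D) (at y)"
  shows "D y = (N y)\<^sup>2"
proof -
  have "((\<lambda>t. t *\<^sub>R y) has_derivative (\<lambda>t. t *\<^sub>R y)) (at (1::real))"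
    by (auto intro!: derivative_eq_intros)
  from diff_chain_at[OF this, of "\<lambda>z. 1/2 * (N z)\<^sup>2" D] assms(2)
  have 1: "((\<lambda>t. 1/2 * (N (t *\<^sub>R y))\<^sup>2) has_derivative (\<lambda>t. D (t *\<^sub>R y))) (at (1::real))"
    by (simp add: o_def)
  have 2: "((\<lambda>t. t\<^sup>2 * (1/2 * (N y)\<^sup>2)) has_derivative (\<lambda>t. t * (N y)\<^sup>2)) (at (1::real))"
    by (auto intro!: derivative_eq_intros)
  have 3: "((\<lambda>t. 1/2 * (N (t *\<^sub>R y))\<^sup>2) has_derivative (\<lambda>t. t * (N y)\<^sup>2)) (at (1::real))"
    by (rule has_derivative_transform_within_open[OF 2, of "{0<..}"])
       (auto simp: assms(1) power_mult_distrib)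
  from fun_cong[OF has_derivative_unique[OF 1 3], of 1] show ?thesis by simp
qed

text \<open>A possibly asymmetric norm with strictly convex half square. Strict convexity is
  expressed by supporting hyperplanes; the origin is excluded as a base point because the half
  square is smooth only away from it, whereas \<open>w\<close> may be 0.\<close>

locale minkowski_norm =
  fixes N :: "'a::euclidean_space \<Rightarrow> real" and D :: "'a \<Rightarrow> 'a \<Rightarrow> real"
  assumes N_nonneg: "0 \<le> N y"
    and N_scale: "0 \<le> l \<Longrightarrow> N (l *\<^sub>R y) = l * N y"
    and N_cont: "continuous_on UNIV N"
    and N_pos: "y \<noteq> 0 \<Longrightarrow> 0 < N y"
    and E_deriv: "y \<noteq> 0 \<Longrightarrow> ((\<lambda>z. 1/2 * (N z)\<^sup>2) has_derivative D y) (at y)"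
    and E_strict: "y \<noteq> 0 \<Longrightarrow> w \<noteq> y \<Longrightarrow> 1/2 * (N y)\<^sup>2 + D y (w - y) < 1/2 * (N w)\<^sup>2"
begin

lemma N_0 [simp]: "N 0 = 0"
  using N_scale[of 0 0] by simp

lemma D_linear: "y \<noteq> 0 \<Longrightarrow> linear (D y)"
  using E_deriv has_derivative_linear by blast

lemma euler:
  assumes "y \<noteq> 0" shows "D y y = (N y)\<^sup>2"
  by (rule euler_half_square[OF N_scale E_deriv[OF assms]])

text \<open>Coordinate form of the Legendre transformation, with the same convention at 0 as in
  \<open>legendre\<close>.\<close>

definition leg :: "'a \<Rightarrow> 'a \<Rightarrow> real" where
  "leg y = (if y = 0 then (\<lambda>_. 0) else D y)"

text \<open>Direct method: \<open>y\<close> minimizes the half square minus \<open>a\<close>.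
  Compactness of the unit sphere gives coercivity, and at a nonzero minimizer the vanishing
  derivative says \<open>D y = a\<close>. If the minimizer is 0, where no derivative is assumed,
  testing with small positive multiples of a vector forces \<open>a = 0\<close>.\<close>

lemma leg_surj:
  assumes "linear a"
  obtains y where "leg y = a"
proof -
  define K :: "'a set" where "K = sphere 0 1"
  have bl: "bounded_linear a" using assms by (simp add: linear_conv_bounded_linear)
  then obtain B where B: "B \<ge> 0" "\<And>x. \<bar>a x\<bar> \<le> B * norm x"
    using bounded_linear.nonneg_bounded[of a] by (auto simp: mult.commute)
  have "K \<noteq> {}" unfolding K_def using norm_Basis[OF SOME_Basis] by (auto intro!: exI[of _ "SOME i. i \<in> Basis"] simp: sphere_def)
  then obtain u where u: "u \<in> K" "\<And>v. v \<in> K \<Longrightarrow> N u \<le> N v"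
    using continuous_attains_inf[of K N] continuous_on_subset[OF N_cont] by (auto simp: K_def)
  define m where "m = N u"
  have m: "m > 0" using u(1) N_pos[of u] norm_zero by (cases "u = 0") (auto simp: m_def K_def)
  have mN: "m * norm y \<le> N y" for y
  proof (cases "y = 0")
    case False
    have "m \<le> N ((1 / norm y) *\<^sub>R y)" using u(2) False by (auto simp: m_def K_def)
    also have "\<dots> = N y / norm y" using N_scale[of "1 / norm y" y] by simp
    finally show ?thesis using False by (simp add: field_simps)
  qed simp
  \<comment> \<open>Chosen so that \<open>1/2 * m\<^sup>2 * R \<ge> B\<close>: outside the ball of
    radius \<open>R\<close> the quadratic term outweighs \<open>a\<close>, and \<open>?f\<close> is
    at least its value 0 at the origin.\<close>
  define R where "R = 2 * B / m\<^sup>2 + 1"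
  have R: "R > 0" using B m by (simp add: R_def add_nonneg_pos)
  let ?f = "\<lambda>w. 1/2 * (N w)\<^sup>2 - a w"
  have "continuous_on (cball 0 R) ?f"
    by (intro continuous_intros continuous_on_subset[OF N_cont]
        continuous_on_subset[OF linear_continuous_on[OF bl, of UNIV]]) auto
  then obtain y where y: "y \<in> cball 0 R" "\<And>w. w \<in> cball 0 R \<Longrightarrow> ?f y \<le> ?f w"
    using continuous_attains_inf[of "cball 0 R" ?f] R by fastforce
  have glob: "?f y \<le> ?f w" for w
  proof (cases "w \<in> cball 0 R")
    case False
    then have w: "norm w > R" by simp
    have "?f y \<le> ?f 0" by (rule y(2)) (use R in simp)
    also have "\<dots> = 0" using linear_0[OF assms] by simp
    also have "0 \<le> ?f w"
    proof -
      have "a w \<le> B * norm w" using B(2)[of w] by linarith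
      also have "\<dots> \<le> (1/2 * m\<^sup>2 * R) * norm w"
      proof (rule mult_right_mono)
        have "1/2 * m\<^sup>2 * R = B + m\<^sup>2 / 2" using m by (simp add: R_def field_simps power2_eq_square)
        then show "B \<le> 1/2 * m\<^sup>2 * R" by simp
      qed simp
      also have "\<dots> \<le> (1/2 * m\<^sup>2 * norm w) * norm w"
        using w m by (intro mult_right_mono mult_left_mono) auto
      also have "\<dots> = 1/2 * (m * norm w)\<^sup>2" by (simp add: power2_eq_square)
      also have "\<dots> \<le> 1/2 * (N w)\<^sup>2"
        using mN[of w] m by (intro mult_left_mono power_mono) auto
      finally show ?thesis by simp
    qed
    finally show ?thesis .
  qed (use y in auto)
  show ?thesis
  proof (cases "y = 0")
    case True
    have le0: "a w \<le> 0" for w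
    proof (rule ccontr)
      assume "\<not> a w \<le> 0"
      then have p: "a w > 0" by simp
      \<comment> \<open>Small enough for the linear term to beat the quadratic one along
        \<open>w\<close>; adding 1 avoids a zero denominator.\<close>
      define e where "e = a w / ((N w)\<^sup>2 + 1)"
      have e: "e > 0" "e * (N w)\<^sup>2 < 2 * a w"
      proof -
        have q: "(N w)\<^sup>2 + 1 > 0" by (simp add: add_nonneg_pos)
        show "e > 0" using p q by (simp add: e_def)
        have "e * ((N w)\<^sup>2 + 1) = a w" using q by (simp add: e_def)
        then have "e * (N w)\<^sup>2 + e = a w" by (simp add: algebra_simps)
        then show "e * (N w)\<^sup>2 < 2 * a w" using \<open>e > 0\<close> p by linarith
      qed
      have "0 \<le> ?f (e *\<^sub>R w)" using glob[of "e *\<^sub>R w"] True linear_0[OF assms] by simp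
      also have "\<dots> = e * (1/2 * (e * (N w)\<^sup>2) - a w)"
        using e linear_scale[OF assms, of e w] by (simp add: N_scale power2_eq_square algebra_simps)
      also have "\<dots> < 0" using e by (intro mult_pos_neg) auto
      finally show False by simp
    qed
    have "a w = 0" for w
      using le0[of w] le0[of "-w"] linear_neg[OF assms, of w] by simp
    then have "leg 0 = a" by (auto simp: leg_def)
    then show ?thesis by (rule that)
  next
    case False
    have "(?f has_derivative (\<lambda>v. D y v - a v)) (at y)"
      by (intro has_derivative_diff E_deriv False bounded_linear.has_derivative[OF bl has_derivative_ident])
    from differential_zero_maxmin[OF UNIV_I open_UNIV this] glob
    have "(\<lambda>v. D y v - a v) = (\<lambda>v. 0)" by blast
    then have "D y v = a v" for v using fun_cong[of _ _ v] by fastforce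
    then have "leg y = a" using False by (auto simp: leg_def)
    then show ?thesis by (rule that)
  qed
qed

lemma leg_self: "leg y y = (N y)\<^sup>2"
  using euler by (cases "y = 0") (auto simp: leg_def)

lemma leg_linear: "linear (leg y)"
  using D_linear by (auto simp: leg_def linear_zero)

text \<open>Strict Cauchy-Schwarz inequality. Rescaled to the length of \<open>y\<close>, the vector
  \<open>w\<close> lies on the same level set, where strict convexity makes
  \<open>D y (w' - y)\<close> negative; Euler's identity evaluates \<open>D y y\<close>. The scaling
  factor is positive, as required by one-sided homogeneity.\<close>

lemma leg_strict:
  assumes "y \<noteq> 0" "w \<noteq> 0" "w \<noteq> (N w / N y) *\<^sub>R y"
  shows "leg y w < N y * N w"
proof -
  have p: "N y > 0" "N w > 0" using N_pos assms by auto
  define w' where "w' = (N y / N w) *\<^sub>R w"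
  have "w' \<noteq> y"
  proof
    assume "w' = y"
    then have "(N w / N y) *\<^sub>R ((N y / N w) *\<^sub>R w) = (N w / N y) *\<^sub>R y" by (simp add: w'_def)
    then have "(N w / N y) *\<^sub>R y = w" using p by simp
    with assms show False by simp
  qed
  moreover have "N w' = N y" using p by (simp add: w'_def N_scale)
  ultimately have "D y (w' - y) < 0" using E_strict[OF assms(1), of w'] by simp
  then have "D y w' < (N y)\<^sup>2"
    using euler[OF assms(1)] linear_diff[OF D_linear[OF assms(1)], of w' y] by simp
  moreover have "D y w' = (N y / N w) * D y w"
    unfolding w'_def using linear_scale[OF D_linear[OF assms(1)]] by simp
  ultimately have "N y * D y w < N y * (N y * N w)"
    using p by (simp add: field_simps power2_eq_square)
  then show ?thesis using p assms by (simp add: leg_def)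
qed

lemma leg_le: "leg y w \<le> N y * N w"
proof (cases "y = 0 \<or> w = 0")
  case True
  then show ?thesis using linear_0[OF leg_linear, of y] by (auto simp: leg_def split: if_splits)
next
  case False
  show ?thesis
  proof (cases "w = (N w / N y) *\<^sub>R y")
    case True
    have "leg y w = (N w / N y) * leg y y" by (subst True, simp add: linear_scale[OF leg_linear])
    also have "\<dots> = N y * N w" using False N_pos[of y] by (simp add: leg_self power2_eq_square)
    finally show ?thesis by simp
  qed (use leg_strict False in fastforce)
qed

end

section \<open>Duality between a Minkowski norm and a Young function\<close>

locale minkowski_young = minkowski_norm + young_function
begin

lemma dual_le: "leg y w - psi h (N w) \<le> psi_star h (N y)"
  using leg_le[of y w] fenchel_young[OF N_nonneg[of w] N_nonneg[of y]] by (simp add: mult.commute)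

text \<open>Equality requires equality in both inequalities behind \<open>dual_le\<close>:
  Fenchel-Young fixes the length of \<open>v\<close> as the \<open>r\<close> with
  \<open>h r = N y\<close>, and Cauchy-Schwarz fixes its direction as that of \<open>y\<close>. For
  \<open>y = 0\<close> there is no direction, but then \<open>r = 0\<close> and only
  \<open>v = 0\<close> remains.\<close>

lemma dual_attained_unique: "\<exists>!v. leg y v - psi h (N v) = psi_star h (N y)"
proof -
  obtain r where r: "r \<ge> 0" "h r = N y" using h_preimage[OF N_nonneg] by blast
  have ps: "psi_star h (N y) = r * N y - psi h r" using psi_star_h[OF r(1)] r by simp
  show ?thesis
  proof (cases "y = 0")
    case True
    then have "r = 0"
      using r h_less[of 0 r] h_nonneg[of 0] by force
    then have 0: "psi_star h (N y) = 0" using ps by simp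
    have "psi h x > 0" if "x > 0" for x
      using young_strict[of 0 x] that \<open>r = 0\<close> r True by simp
    then have "psi h (N v) = 0 \<longleftrightarrow> v = 0" for v
      using N_pos[of v] by (cases "v = 0") fastforce+
    then show ?thesis unfolding 0 using True by (simp add: leg_def)
  next
    case False
    have Np: "N y > 0" using N_pos False by blast
    have rp: "r > 0"
    proof (rule ccontr)
      assume "\<not> r > 0"
      then have "r = 0" using r by simp
      obtain q where "q \<ge> 0" "h q = 0" using h_preimage[of 0] by auto
      then have "h 0 = 0" using h_less[of 0 q] h_nonneg[of 0] by (cases "q = 0") auto
      then show False using \<open>r = 0\<close> r Np by simp
    qed
    show ?thesis
    proof (rule ex1I[of _ "(r / N y) *\<^sub>R y"])
      have "N ((r / N y) *\<^sub>R y) = r" using r Np by (simp add: N_scale)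
      then show "leg y ((r / N y) *\<^sub>R y) - psi h (N ((r / N y) *\<^sub>R y)) = psi_star h (N y)"
        using Np by (simp add: linear_scale[OF leg_linear] leg_self ps power2_eq_square)
      fix v assume v: "leg y v - psi h (N v) = psi_star h (N y)"
      have "N y * N v - psi h (N v) \<ge> r * N y - psi h r" using v leg_le[of y v] ps by simp
      then have Nv: "N v = r"
        using young_strict[OF r(1) N_nonneg[of v]] r(2) by (force simp: mult.commute)
      then have "v \<noteq> 0" using rp by auto
      moreover have "leg y v = N y * N v" using v ps Nv by (simp add: mult.commute)
      ultimately show "v = (r / N y) *\<^sub>R y" using leg_strict[OF False, of v] Nv by force
    qed
  qed
qed

end

section \<open>Minkowski norms from positive definite Hessians of the half square\<close>

lemma linear_axis_sum:
  fixes D :: "real ^ 'n::finite \<Rightarrow> real"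
  assumes "linear D"
  shows "D v = (\<Sum>i\<in>UNIV. v $ i * D (axis i 1))"
proof -
  have "D v = D (\<Sum>i\<in>UNIV. v $ i *s axis i 1)" by (simp add: basis_expansion)
  also have "\<dots> = (\<Sum>i\<in>UNIV. D (v $ i *\<^sub>R axis i 1))"
    by (simp add: linear_sum[OF assms] scalar_mult_eq_scaleR)
  finally show ?thesis by (simp add: linear_scale[OF assms])
qed

lemma has_derivative_along_line:
  assumes "(f has_derivative D) (at (y + t *\<^sub>R v))"
  shows "((\<lambda>s. f (y + s *\<^sub>R v)) has_real_derivative D v) (at t)"
proof -
  have "((\<lambda>s. y + s *\<^sub>R v) has_derivative (\<lambda>r. r *\<^sub>R v)) (at t)"
    by (auto intro!: derivative_eq_intros)
  from diff_chain_at[OF this assms]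
  have "((\<lambda>s. f (y + s *\<^sub>R v)) has_derivative (\<lambda>r. D (r *\<^sub>R v))) (at t)" by (simp add: o_def)
  moreover have "(\<lambda>r. D (r *\<^sub>R v)) = (*) (D v)"
    using linear_scale[OF has_derivative_linear[OF assms]] by (auto simp: mult.commute)
  ultimately show ?thesis by (simp add: has_field_derivative_def)
qed

text \<open>\<open>E\<close> and \<open>G\<close> are names for longer expressions, tied to them by
  equations that are discharged when the block is applied to a chart. Second derivatives enter
  through partial derivatives, the shape in which \<open>g_matrix\<close> is defined.\<close>

context
  fixes N :: "real ^ 'n::finite \<Rightarrow> real" and E :: "real ^ 'n \<Rightarrow> real" and G :: "real ^ 'n \<Rightarrow> real ^ 'n ^ 'n"
  assumes E_def: "E = (\<lambda>z. 1/2 * (N z)\<^sup>2)"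
    and G_def: "G = (\<lambda>y. \<chi> i j. partial_deriv j (partial_deriv i E) y)"
    and nonneg: "\<And>y. 0 \<le> N y"
    and scale: "\<And>l y. 0 \<le> l \<Longrightarrow> N (l *\<^sub>R y) = l * N y"
    and cont: "continuous_on UNIV N"
    and diff1: "\<And>y. y \<noteq> 0 \<Longrightarrow> E differentiable (at y)"
    and diff2: "\<And>y i. y \<noteq> 0 \<Longrightarrow> partial_deriv i E differentiable (at y)"
    and pd: "\<And>y. y \<noteq> 0 \<Longrightarrow> positive_definite (G y)"
begin

private abbreviation "D y \<equiv> frechet_derivative E (at y)"

private lemma E_deriv: "y \<noteq> 0 \<Longrightarrow> (E has_derivative D y) (at y)"
  using diff1 by (simp add: frechet_derivative_works[symmetric])

text \<open>Second derivative along a line as a Hessian form. Differentiability is known for the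
  partial derivatives of \<open>E\<close>, so \<open>D\<close> is first expanded in the standard
  basis; the expansion holds off the origin, hence the open set of parameters.\<close>

private lemma D_line_deriv:
  assumes "y + t *\<^sub>R v \<noteq> 0"
  shows "((\<lambda>s. D (y + s *\<^sub>R v) w) has_real_derivative w \<bullet> (G (y + t *\<^sub>R v) *v v)) (at t)"
proof -
  let ?z = "y + t *\<^sub>R v"
  have pe: "partial_deriv i E = (\<lambda>z. D z (axis i 1))" for i
    by (auto simp: partial_deriv_def)
  have p: "(partial_deriv i E has_derivative frechet_derivative (partial_deriv i E) (at ?z)) (at ?z)" for i
    using diff2[OF assms] by (simp add: frechet_derivative_works[symmetric])
  have "((\<lambda>s. partial_deriv i E (y + s *\<^sub>R v)) has_real_derivative
          (\<Sum>j\<in>UNIV. v $ j * G ?z $ i $ j)) (at t)" for i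
    using has_derivative_along_line[OF p[of i]]
    by (simp add: linear_axis_sum[OF has_derivative_linear[OF p[of i]], of v] G_def partial_deriv_def)
  then have 1: "((\<lambda>s. \<Sum>i\<in>UNIV. w $ i * D (y + s *\<^sub>R v) (axis i 1)) has_real_derivative
      (\<Sum>i\<in>UNIV. w $ i * (\<Sum>j\<in>UNIV. v $ j * G ?z $ i $ j))) (at t)"
    unfolding pe by (auto intro!: DERIV_sum DERIV_cmult)
  have 2: "(\<Sum>i\<in>UNIV. w $ i * (\<Sum>j\<in>UNIV. v $ j * G ?z $ i $ j)) = w \<bullet> (G ?z *v v)"
    by (simp add: inner_vec_def matrix_vector_mult_def mult.commute)
  have opn: "open {s. y + s *\<^sub>R v \<noteq> 0}"
    by (rule open_Collect_neq) (intro continuous_intros)+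
  have "((\<lambda>s. D (y + s *\<^sub>R v) w) has_derivative (*) (w \<bullet> (G ?z *v v))) (at t)"
  proof (rule has_derivative_transform_within_open[OF _ opn])
    show "((\<lambda>s. \<Sum>i\<in>UNIV. w $ i * D (y + s *\<^sub>R v) (axis i 1)) has_derivative (*) (w \<bullet> (G ?z *v v))) (at t)"
      using 1 unfolding 2 has_field_derivative_def .
    fix s assume "s \<in> {s. y + s *\<^sub>R v \<noteq> 0}"
    then show "(\<Sum>i\<in>UNIV. w $ i * D (y + s *\<^sub>R v) (axis i 1)) = D (y + s *\<^sub>R v) w"
      using linear_axis_sum[OF has_derivative_linear[OF E_deriv], of "y + s *\<^sub>R v" w] by simp
  qed (use assms in simp)
  then show ?thesis by (simp add: has_field_derivative_def)
qed

text \<open>Differentiate \<open>E (l *\<^sub>R z) = l\<^sup>2 * E z\<close> and cancel one factor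
  \<open>l\<close>.\<close>

private lemma D_scale:
  assumes "y \<noteq> 0" "l > 0"
  shows "D (l *\<^sub>R y) w = l * D y w"
proof -
  have "((\<lambda>z. l *\<^sub>R z) has_derivative (\<lambda>z. l *\<^sub>R z)) (at y)"
    by (auto intro!: derivative_eq_intros)
  from diff_chain_at[OF this E_deriv] assms
  have 1: "((\<lambda>z. E (l *\<^sub>R z)) has_derivative (\<lambda>w. D (l *\<^sub>R y) (l *\<^sub>R w))) (at y)"
    by (simp add: o_def)
  have "(\<lambda>z. E (l *\<^sub>R z)) = (\<lambda>z. l\<^sup>2 * E z)"
    using assms by (auto simp: E_def scale power_mult_distrib)
  moreover have "((\<lambda>z. l\<^sup>2 * E z) has_derivative (\<lambda>w. l\<^sup>2 * D y w)) (at y)"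
    by (intro derivative_intros E_deriv assms)
  ultimately have "((\<lambda>z. E (l *\<^sub>R z)) has_derivative (\<lambda>w. l\<^sup>2 * D y w)) (at y)" by simp
  from fun_cong[OF has_derivative_unique[OF 1 this], of w]
  have "D (l *\<^sub>R y) (l *\<^sub>R w) = l\<^sup>2 * D y w" .
  moreover have "D (l *\<^sub>R y) (l *\<^sub>R w) = l * D (l *\<^sub>R y) w"
    using linear_scale[OF has_derivative_linear[OF E_deriv]] assms by simp
  ultimately show ?thesis using assms by (simp add: power2_eq_square)
qed

text \<open>Euler's identity once more, now for the derivative, which is homogeneous of degree 1:
  both sides are the derivative at \<open>s = 0\<close> of \<open>D\<close> at
  \<open>(1 + s) *\<^sub>R y\<close>.\<close>

lemma half_square_deriv_eq:
  assumes "y \<noteq> 0"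
  shows "frechet_derivative E (at y) w = w \<bullet> (G y *v y)"
proof -
  have 1: "((\<lambda>s. D (y + s *\<^sub>R y) w) has_real_derivative w \<bullet> (G y *v y)) (at 0)"
    using D_line_deriv[of y 0 y w] assms by simp
  have "((\<lambda>s. (1 + s) * D y w) has_real_derivative D y w) (at 0)"
    by (auto intro!: derivative_eq_intros)
  then have "((\<lambda>s. D (y + s *\<^sub>R y) w) has_real_derivative D y w) (at 0)"
    unfolding has_field_derivative_def
  proof (rule has_derivative_transform_within_open[of _ _ _ _ "{-1<..}"])
    fix s :: real assume "s \<in> {-1<..}"
    then show "(1 + s) * D y w = D (y + s *\<^sub>R y) w"
      using D_scale[OF assms, of "1 + s" w] by (simp add: scaleR_left_distrib)
  qed auto
  with 1 show ?thesis using DERIV_unique by blast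
qed

text \<open>A zero of \<open>N\<close> would be a minimum of \<open>E\<close>, so \<open>D y\<close>
  would vanish there; but \<open>D y y\<close> is the Hessian form at \<open>y\<close>, which is
  positive.\<close>

private lemma N_pos: assumes "y \<noteq> 0" shows "N y > 0"
proof (rule ccontr)
  assume "\<not> N y > 0"
  then have "N y = 0" using nonneg[of y] by simp
  then have "\<forall>z\<in>UNIV. E y \<le> E z" by (simp add: E_def)
  with differential_zero_maxmin[OF UNIV_I open_UNIV E_deriv[OF assms]]
  have "D y = (\<lambda>v. 0)" by blast
  then have "y \<bullet> (G y *v y) = 0" using half_square_deriv_eq[OF assms, of y] by simp
  then show False using pd[OF assms] assms by (auto simp: positive_definite_def)
qed

text \<open>On a segment that misses 0, positive definiteness makes the slope of \<open>E\<close>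
  strictly increasing, and the mean value theorem yields strict convexity. A segment through 0
  leaves the region of smoothness; there \<open>v\<close> is a negative multiple of
  \<open>y\<close>, and Euler's identity gives \<open>D y v \<le> - (N y)\<^sup>2\<close>, so the
  tangent value is already negative.\<close>

lemma minkowski_normI: "minkowski_norm N (\<lambda>y. frechet_derivative E (at y))"
proof
  fix y :: "real ^ 'n" assume y: "y \<noteq> 0"
  show "((\<lambda>z. 1/2 * (N z)\<^sup>2) has_derivative frechet_derivative E (at y)) (at y)"
    using E_deriv[OF y] by (simp add: E_def)
  fix w assume w: "w \<noteq> y"
  define v where "v = w - y"
  have v: "v \<noteq> 0" using w by (simp add: v_def)
  have "E y + D y v < E w"
  proof (cases "\<exists>t\<in>{0..1}. y + t *\<^sub>R v = 0")
    case True
    then obtain t where t: "0 \<le> t" "t \<le> 1" "y + t *\<^sub>R v = 0" by auto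
    then have "t > 0" using y by (cases "t = 0") auto
    have "y = - t *\<^sub>R v" using t(3) by (simp add: add_eq_0_iff)
    then have "D y y = D y (- t *\<^sub>R v)" by (rule arg_cong)
    also have "\<dots> = - t * D y v"
      using linear_scale[OF has_derivative_linear[OF E_deriv[OF y]], of "-t" v] by simp
    finally have "D y y = - t * D y v" .
    moreover have "D y y = (N y)\<^sup>2"
      by (rule euler_half_square[of N]) (use scale E_deriv[OF y] in \<open>auto simp: E_def\<close>)
    ultimately have e: "t * D y v = - (N y)\<^sup>2" by simp
    have "D y v \<le> - (N y)\<^sup>2"
    proof (rule ccontr)
      assume "\<not> D y v \<le> - (N y)\<^sup>2"
      then have "t * D y v > t * - (N y)\<^sup>2" using \<open>t > 0\<close> by (intro mult_strict_left_mono) auto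
      moreover have "t * (N y)\<^sup>2 \<le> 1 * (N y)\<^sup>2" using t by (intro mult_right_mono) auto
      ultimately show False using e by simp
    qed
    moreover have "(N y)\<^sup>2 > 0" using N_pos[OF y] by simp
    moreover have "0 \<le> E w" "E y = 1/2 * (N y)\<^sup>2" by (simp_all add: E_def)
    ultimately show ?thesis by linarith
  next
    case False
    then have ne: "y + t *\<^sub>R v \<noteq> 0" if "t \<in> {0..1}" for t using that by blast
    have d1: "((\<lambda>s. E (y + s *\<^sub>R v)) has_real_derivative D (y + t *\<^sub>R v) v) (at t)" if "t \<in> {0..1}" for t
      by (rule has_derivative_along_line[OF E_deriv[OF ne[OF that]]])
    obtain \<zeta> where \<zeta>: "0 < \<zeta>" "\<zeta> < 1" "E (y + 1 *\<^sub>R v) - E (y + 0 *\<^sub>R v) = (1 - 0) * D (y + \<zeta> *\<^sub>R v) v"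
      using MVT2[of 0 1 "\<lambda>s. E (y + s *\<^sub>R v)" "\<lambda>t. D (y + t *\<^sub>R v) v"] d1 by auto
    have "D (y + 0 *\<^sub>R v) v < D (y + \<zeta> *\<^sub>R v) v"
    proof (rule DERIV_pos_imp_increasing[OF \<zeta>(1)])
      fix t assume "0 \<le> t" "t \<le> \<zeta>"
      then have "y + t *\<^sub>R v \<noteq> 0" using \<zeta> ne by auto
      then show "\<exists>d. ((\<lambda>s. D (y + s *\<^sub>R v) v) has_real_derivative d) (at t) \<and> d > 0"
        using D_line_deriv[of y t v v] pd v unfolding positive_definite_def by blast
    qed
    then show ?thesis using \<zeta> by (simp add: v_def)
  qed
  then show "1/2 * (N y)\<^sup>2 + frechet_derivative E (at y) (w - y) < 1/2 * (N w)\<^sup>2"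
    by (simp add: E_def v_def)
qed (use nonneg scale cont N_pos in auto)

text \<open>Identifies \<open>g_y(y, w)\<close> with the derivative of the half square.
  \<open>g_y\<close> contracts \<open>y\<close> with the first index of \<open>G y\<close>, the
  derivative formula with the second; symmetry of \<open>G y\<close> reconciles them.\<close>

lemma fundamental_form_eq:
  assumes "y \<noteq> 0"
  shows "(\<Sum>i\<in>UNIV. \<Sum>j\<in>UNIV. G y $ i $ j * y $ i * w $ j) = frechet_derivative E (at y) w"
proof -
  have "transpose (G y) = G y" using pd[OF assms] by (simp add: positive_definite_def)
  then have sym: "G y $ i $ j = G y $ j $ i" for i j
    by (metis transpose_def vec_lambda_beta)
  have "frechet_derivative E (at y) w = (\<Sum>i\<in>UNIV. \<Sum>j\<in>UNIV. w $ i * (G y $ i $ j * y $ j))"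
    by (simp add: half_square_deriv_eq[OF assms] inner_vec_def matrix_vector_mult_def sum_distrib_left)
  also have "\<dots> = (\<Sum>j\<in>UNIV. \<Sum>i\<in>UNIV. w $ i * (G y $ i $ j * y $ j))"
    by (rule sum.swap)
  also have "\<dots> = (\<Sum>i\<in>UNIV. \<Sum>j\<in>UNIV. G y $ i $ j * y $ i * w $ j)"
  proof (intro sum.cong refl)
    fix i j show "w $ j * (G y $ j $ i * y $ i) = G y $ i $ j * y $ i * w $ j"
      by (simp add: sym[of i j])
  qed
  finally show ?thesis by simp
qed

end

subsection \<open>Charts and tangent vectors\<close>

locale atlas =
  fixes A :: "('m::t2_space, 'n::finite) chart set"
  assumes smooth_atlas: "smooth_atlas A"
begin

lemma open_chart_dom: "c \<in> A \<Longrightarrow> open (chart_dom c)"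
  and open_chart_img: "c \<in> A \<Longrightarrow> open (chart_img c)"
  and chart_homeo: "c \<in> A \<Longrightarrow> homeomorphism (chart_dom c) (chart_img c) (coord c) (param c)"
  using smooth_atlas unfolding smooth_atlas_def by blast+

lemma param_coord: "c \<in> A \<Longrightarrow> p \<in> chart_dom c \<Longrightarrow> param c (coord c p) = p"
  using homeomorphism_apply1[OF chart_homeo] by blast

lemma coord_param: "c \<in> A \<Longrightarrow> x \<in> chart_img c \<Longrightarrow> coord c (param c x) = x"
  using homeomorphism_apply2[OF chart_homeo] by blast

lemma param_in: "c \<in> A \<Longrightarrow> x \<in> chart_img c \<Longrightarrow> param c x \<in> chart_dom c"
  by (auto simp: param_coord)

lemma continuous_coord: "c \<in> A \<Longrightarrow> continuous_on (chart_dom c) (coord c)"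
  using homeomorphism_cont1[OF chart_homeo] .

lemma continuous_param: "c \<in> A \<Longrightarrow> continuous_on (chart_img c) (param c)"
  using homeomorphism_cont2[OF chart_homeo] .

lemma chart_exists: obtains c where "c \<in> A" "p \<in> chart_dom c"
proof -
  have "p \<in> (\<Union>c\<in>A. chart_dom c)" using smooth_atlas by (simp add: smooth_atlas_def)
  then show ?thesis using that by blast
qed

lemma chart_at: "chart_at A p \<in> A" "p \<in> chart_dom (chart_at A p)"
proof -
  have "\<exists>c. c \<in> A \<and> p \<in> chart_dom c" using chart_exists by metis
  then have "chart_at A p \<in> A \<and> p \<in> chart_dom (chart_at A p)"
    unfolding chart_at_def by (rule someI_ex)
  then show "chart_at A p \<in> A" "p \<in> chart_dom (chart_at A p)" by auto
qed

lemma transition_coord: "c \<in> A \<Longrightarrow> p \<in> chart_dom c \<Longrightarrow> transition c c' (coord c p) = coord c' p"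
  by (simp add: transition_def param_coord)

lemma open_param_image:
  assumes "c \<in> A" "open U" "U \<subseteq> chart_img c"
  shows "open (param c ` U)"
proof -
  have "param c ` U = chart_dom c \<inter> coord c -` U"
  proof (intro equalityI subsetI)
    fix p assume "p \<in> param c ` U"
    then obtain x where "x \<in> U" "p = param c x" by blast
    moreover then have "x \<in> chart_img c" using assms by blast
    ultimately show "p \<in> chart_dom c \<inter> coord c -` U"
      using param_in[OF assms(1)] coord_param[OF assms(1)] by simp
  next
    fix p assume "p \<in> chart_dom c \<inter> coord c -` U"
    then show "p \<in> param c ` U" using param_coord[OF assms(1), of p] by (intro image_eqI[of _ _ "coord c p"]) auto
  qed
  moreover have "open (chart_dom c \<inter> coord c -` U)"
    using continuous_open_preimage continuous_coord open_chart_dom assms by blast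
  ultimately show ?thesis by simp
qed

lemma open_overlap:
  assumes "c \<in> A" "c' \<in> A"
  shows "open (coord c ` (chart_dom c \<inter> chart_dom c'))"
proof -
  have "coord c ` (chart_dom c \<inter> chart_dom c') = chart_img c \<inter> param c -` chart_dom c'"
    using param_coord[OF assms(1)] by (auto simp: image_iff)
  moreover have "open (chart_img c \<inter> param c -` chart_dom c')"
    using continuous_open_preimage continuous_param open_chart_img open_chart_dom assms by blast
  ultimately show ?thesis by simp
qed

lemma transition_smooth:
  "c \<in> A \<Longrightarrow> c' \<in> A \<Longrightarrow> C_on \<infinity> (coord c ` (chart_dom c \<inter> chart_dom c')) (transition c c')"
  using smooth_atlas unfolding smooth_atlas_def by blast

abbreviation transD where
  "transD c c' p \<equiv> frechet_derivative (transition c c') (at (coord c p))"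

lemma transition_deriv:
  assumes "c \<in> A" "c' \<in> A" "p \<in> chart_dom c" "p \<in> chart_dom c'"
  shows "(transition c c' has_derivative transD c c' p) (at (coord c p))"
  by (rule C_on_has_derivative[OF transition_smooth]) (use assms in auto)

lemma transD_linear:
  assumes "c \<in> A" "c' \<in> A" "p \<in> chart_dom c" "p \<in> chart_dom c'"
  shows "linear (transD c c' p)"
  using has_derivative_linear[OF transition_deriv[OF assms]] .

text \<open>Cocycle rule from the chain rule; it makes \<open>tvec_of\<close> obey the
  transformation law of tangent vectors.\<close>

lemma transD_comp:
  assumes "c \<in> A" "c' \<in> A" "c'' \<in> A" "p \<in> chart_dom c" "p \<in> chart_dom c'" "p \<in> chart_dom c''"
  shows "transD c' c'' p (transD c c' p y) = transD c c'' p y"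
proof -
  have "(transition c' c'' has_derivative transD c' c'' p) (at (transition c c' (coord c p)))"
    using transition_deriv[of c' c'' p] assms by (simp add: transition_coord)
  from diff_chain_at[OF transition_deriv this] assms
  have 1: "(transition c' c'' \<circ> transition c c' has_derivative transD c' c'' p \<circ> transD c c' p) (at (coord c p))"
    by blast
  have "(transition c c'' has_derivative transD c' c'' p \<circ> transD c c' p) (at (coord c p))"
  proof (rule has_derivative_transform_within_open[OF 1 open_overlap[OF assms(1,2)]])
    fix x assume "x \<in> coord c ` (chart_dom c \<inter> chart_dom c')"
    then show "(transition c' c'' \<circ> transition c c') x = transition c c'' x"
      using assms by (auto simp: transition_coord)
  qed (use assms in auto)
  from fun_cong[OF has_derivative_unique[OF this transition_deriv[OF assms(1,3,4,6)]], of y]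
  show ?thesis by simp
qed

lemma transD_self:
  assumes "c \<in> A" "p \<in> chart_dom c"
  shows "transD c c p y = y"
proof -
  have "((\<lambda>x. x) has_derivative (\<lambda>x. x)) (at (coord c p))" by (rule has_derivative_ident)
  then have "(transition c c has_derivative (\<lambda>x. x)) (at (coord c p))"
    by (rule has_derivative_transform_within_open[OF _ open_chart_img[OF assms(1)]])
       (use assms in \<open>auto simp: transition_coord\<close>)
  from fun_cong[OF has_derivative_unique[OF this transition_deriv[OF assms(1,1,2,2)]], of y]
  show ?thesis by simp
qed

lemma tvec_of_self: "c \<in> A \<Longrightarrow> p \<in> chart_dom c \<Longrightarrow> tvec_of A c p y c = y"
  by (simp add: tvec_of_def transD_self)

lemma tvec_of_in:
  assumes "c \<in> A" "p \<in> chart_dom c"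
  shows "tvec_of A c p y \<in> tangent_space A p"
  unfolding tangent_space_def
proof (intro CollectI conjI allI ballI impI)
  fix c' assume "\<not> (c' \<in> A \<and> p \<in> chart_dom c')"
  then show "tvec_of A c p y c' = 0" by (simp only: tvec_of_def if_False)
next
  fix c' c'' assume "c' \<in> A" "c'' \<in> A" "p \<in> chart_dom c' \<inter> chart_dom c''"
  then show "tvec_of A c p y c'' = transD c' c'' p (tvec_of A c p y c')"
    using transD_comp[OF assms(1) _ _ assms(2), of c' c'' y] by (simp add: tvec_of_def)
qed

lemma tangent_change:
  assumes "X \<in> tangent_space A p" "c \<in> A" "c' \<in> A" "p \<in> chart_dom c" "p \<in> chart_dom c'"
  shows "X c' = transD c c' p (X c)"
  using assms unfolding tangent_space_def by blast

lemma tvec_of_tangent: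
  assumes "X \<in> tangent_space A p" "c \<in> A" "p \<in> chart_dom c"
  shows "tvec_of A c p (X c) = X"
proof
  fix c' show "tvec_of A c p (X c) c' = X c'"
  proof (cases "c' \<in> A \<and> p \<in> chart_dom c'")
    case True
    then show ?thesis using tangent_change[OF assms(1,2) _ assms(3), of c'] by (simp add: tvec_of_def)
  next
    case False
    then have "X c' = 0" using assms(1) unfolding tangent_space_def by blast
    then show ?thesis using False by (simp only: tvec_of_def if_False)
  qed
qed

lemma tangent_eqI:
  assumes "X \<in> tangent_space A p" "Y \<in> tangent_space A p" "c \<in> A" "p \<in> chart_dom c" "X c = Y c"
  shows "X = Y"
proof -
  have "X = tvec_of A c p (X c)" using tvec_of_tangent[OF assms(1,3,4)] by (rule sym)
  also have "\<dots> = tvec_of A c p (Y c)" by (simp only: assms(5))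
  also have "\<dots> = Y" by (rule tvec_of_tangent[OF assms(2,3,4)])
  finally show ?thesis .
qed

lemma tvec_of_scale:
  assumes "c \<in> A" "p \<in> chart_dom c"
  shows "tvec_of A c p (l *\<^sub>R y) = (\<lambda>c'. l *\<^sub>R tvec_of A c p y c')"
proof
  fix c' show "tvec_of A c p (l *\<^sub>R y) c' = l *\<^sub>R tvec_of A c p y c'"
    using linear_scale[OF transD_linear[OF assms(1) _ assms(2)], of c' l y]
    by (cases "c' \<in> A \<and> p \<in> chart_dom c'") (auto simp: tvec_of_def)
qed

text \<open>\<open>coord c\<close> is arbitrary outside \<open>chart_dom c\<close>, so
  differentiability of \<open>coord c \<circ> \<gamma>\<close> does not keep the curve in the chart.
  Continuity of \<open>\<gamma>\<close> is therefore a separate assumption; it provides the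
  neighbourhood of \<open>t\<close> on which the transition formula holds.\<close>

lemma curve_deriv_change:
  assumes "c \<in> A" "c' \<in> A" "\<gamma> t \<in> chart_dom c" "\<gamma> t \<in> chart_dom c'"
    and d: "((coord c \<circ> \<gamma>) has_vector_derivative w) (at t within S)"
    and ct: "continuous (at t within S) \<gamma>" "t \<in> S"
  shows "((coord c' \<circ> \<gamma>) has_vector_derivative transD c c' (\<gamma> t) w) (at t within S)"
proof -
  have 1: "(transition c c' \<circ> (coord c \<circ> \<gamma>) has_derivative transD c c' (\<gamma> t) \<circ> (\<lambda>h. h *\<^sub>R w)) (at t within S)"
  proof (rule diff_chain_within[OF d[unfolded has_vector_derivative_def]])
    show "(transition c c' has_derivative transD c c' (\<gamma> t)) (at ((coord c \<circ> \<gamma>) t) within (coord c \<circ> \<gamma>) ` S)"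
      unfolding comp_def by (rule has_derivative_at_withinI[OF transition_deriv[OF assms(1-4)]])
  qed
  have ev: "\<forall>\<^sub>F s in at t within S. (transition c c' \<circ> (coord c \<circ> \<gamma>)) s = (coord c' \<circ> \<gamma>) s"
  proof -
    have "\<forall>\<^sub>F s in at t within S. \<gamma> s \<in> chart_dom c"
      by (rule topological_tendstoD[OF ct(1)[unfolded continuous_within] open_chart_dom[OF assms(1)] assms(3)])
    then show ?thesis by eventually_elim (simp add: transition_coord assms(1))
  qed
  have "(coord c' \<circ> \<gamma> has_derivative transD c c' (\<gamma> t) \<circ> (\<lambda>h. h *\<^sub>R w)) (at t within S)"
    by (rule has_derivative_transform_eventually[OF 1 ev]) (simp_all add: transition_coord assms ct)
  moreover have "transD c c' (\<gamma> t) \<circ> (\<lambda>h. h *\<^sub>R w) = (\<lambda>h. h *\<^sub>R transD c c' (\<gamma> t) w)"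
    using linear_scale[OF transD_linear[OF assms(1-4)]] by auto
  ultimately show ?thesis by (simp add: has_vector_derivative_def)
qed

end

subsection \<open>Finsler metrics in charts\<close>

lemma frechet_derivative_eqI: "(f has_derivative D) (at x) \<Longrightarrow> frechet_derivative f (at x) = D"
  using frechet_derivative_at by metis

locale finsler =
  fixes A :: "('m::{t2_space, second_countable_topology}, 'n::finite) chart set"
    and F :: "'m \<Rightarrow> ('m, 'n) tvec \<Rightarrow> real"
  assumes finsler: "finsler_manifold A F"

sublocale finsler \<subseteq> atlas A
  by unfold_locales (use finsler in \<open>simp add: finsler_manifold_def\<close>)

context finsler
begin

abbreviation "loc c x y \<equiv> local_rep A F c (x, y)"
text \<open>Away from 0 this is \<open>g_y(y, .)\<close> in coordinates, by the second part of
  \<open>loc_minkowski\<close>.\<close>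

definition "locD c x y = frechet_derivative (\<lambda>z. 1/2 * (loc c x z)\<^sup>2) (at y)"

lemma F_nonneg: "X \<in> tangent_space A p \<Longrightarrow> 0 \<le> F p X"
  using finsler unfolding finsler_manifold_def by blast

lemma F_eq_loc:
  assumes "c \<in> A" "p \<in> chart_dom c" "X \<in> tangent_space A p"
  shows "F p X = loc c (coord c p) (X c)"
  using assms by (simp add: local_rep_def param_coord tvec_of_tangent)

lemma F_tvec_of: "c \<in> A \<Longrightarrow> p \<in> chart_dom c \<Longrightarrow> F p (tvec_of A c p y) = loc c (coord c p) y"
  by (simp add: local_rep_def param_coord)

lemma loc_cont: "c \<in> A \<Longrightarrow> continuous_on (chart_img c \<times> UNIV) (local_rep A F c)"
  using finsler unfolding finsler_manifold_def by blast

lemma loc_nonneg: "c \<in> A \<Longrightarrow> x \<in> chart_img c \<Longrightarrow> 0 \<le> loc c x y"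
  by (simp add: local_rep_def F_nonneg tvec_of_in param_in)

lemma loc_scale: 
  assumes "c \<in> A" "x \<in> chart_img c" "0 \<le> l"
  shows "loc c x (l *\<^sub>R y) = l * loc c x y"
proof -
  have p: "param c x \<in> chart_dom c" using param_in assms by blast
  have "F (param c x) (\<lambda>c'. l *\<^sub>R tvec_of A c (param c x) y c') = l * F (param c x) (tvec_of A c (param c x) y)"
    using finsler tvec_of_in[OF assms(1) p] assms(3) unfolding finsler_manifold_def by blast
  then show ?thesis by (simp add: local_rep_def tvec_of_scale[OF assms(1) p])
qed

text \<open>Smoothness of \<open>F\<close> is given jointly in base point and vector; composing with
  the inclusion of a fibre yields the fibrewise derivatives from which \<open>g_matrix\<close> is
  built.\<close>

lemma loc_minkowski:
  assumes c: "c \<in> A" and x: "x \<in> chart_img c"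
  shows "minkowski_norm (loc c x) (locD c x)"
    and "y \<noteq> 0 \<Longrightarrow> (\<Sum>i\<in>UNIV. \<Sum>j\<in>UNIV. g_matrix A F c x y $ i $ j * y $ i * w $ j) = locD c x y w"
proof -
  let ?l = "local_rep A F c" and ?O = "chart_img c \<times> (- {0::real^'n})"
  let ?E = "\<lambda>z. 1/2 * (loc c x z)\<^sup>2"
  have "C_on \<infinity> ?O ?l" using finsler c unfolding finsler_manifold_def by blast
  then have "nat_C_on (Suc (Suc 0)) ?O ?l" by (simp add: C_on_def)
  then have d1: "\<And>q. q \<in> ?O \<Longrightarrow> ?l differentiable (at q)"
    and d2: "\<And>q v. q \<in> ?O \<Longrightarrow> (\<lambda>q. frechet_derivative ?l (at q) v) differentiable (at q)"
    unfolding nat_C_on.simps by blast+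
  have O: "(x, y) \<in> ?O" if "y \<noteq> 0" for y using x that by blast
  have pair: "((\<lambda>z. (x, z)) has_derivative (\<lambda>v. (0, v))) (at (y::real^'n))" for y
    by (auto intro!: derivative_eq_intros)
  have N: "(loc c x has_derivative (\<lambda>v. frechet_derivative ?l (at (x, y)) (0, v))) (at y)" if "y \<noteq> 0" for y
    using diff_chain_at[OF pair, of ?l] d1[OF O[OF that]]
    by (simp add: o_def frechet_derivative_works)
  have E: "(?E has_derivative (\<lambda>v. loc c x y * frechet_derivative ?l (at (x, y)) (0, v))) (at y)" if "y \<noteq> 0" for y
    using N[OF that] by (auto intro!: derivative_eq_intros simp: power2_eq_square)
  have fE: "locD c x y v = loc c x y * frechet_derivative ?l (at (x, y)) (0, v)" if "y \<noteq> 0" for y v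
    by (simp only: locD_def frechet_derivative_eqI[OF E[OF that]])
  \<comment> \<open>Off the origin a partial derivative of the half square is \<open>loc\<close>
    times a directional derivative of \<open>local_rep\<close>, a product of two differentiable
    functions.\<close>
  have D2: "partial_deriv i ?E differentiable (at y)" if y: "y \<noteq> 0" for i y
  proof -
    have "(\<lambda>z. frechet_derivative ?l (at (x, z)) (0, axis i 1)) differentiable (at y)"
      using d2[OF O[OF y], of "(0, axis i 1)"] diff_chain_at[OF pair]
      unfolding differentiable_def o_def by blast
    moreover have "loc c x differentiable (at y)" using N[OF y] unfolding differentiable_def by blast
    ultimately have "(\<lambda>z. loc c x z * frechet_derivative ?l (at (x, z)) (0, axis i 1)) differentiable (at y)"
      by (rule differentiable_mult[rotated])
    then obtain D' where D': "((\<lambda>z. loc c x z * frechet_derivative ?l (at (x, z)) (0, axis i 1)) has_derivative D') (at y)"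
      unfolding differentiable_def by blast
    have "(partial_deriv i ?E has_derivative D') (at y)"
      by (rule has_derivative_transform_within_open[OF D', of "- {0}"])
         (use y fE in \<open>auto simp: partial_deriv_def locD_def\<close>)
    then show ?thesis unfolding differentiable_def by blast
  qed
  have cont: "continuous_on UNIV (loc c x)"
    by (rule continuous_on_compose2[OF loc_cont[OF c]]) (use x in \<open>auto intro!: continuous_intros\<close>)
  have E1: "?E differentiable (at y)" if "y \<noteq> 0" for y
    using E[OF that] unfolding differentiable_def by blast
  have pd: "positive_definite (g_matrix A F c x y)" if "y \<noteq> 0" for y
    using finsler c x that unfolding finsler_manifold_def by blast
  have g: "g_matrix A F c x = (\<lambda>y. \<chi> i j. partial_deriv j (partial_deriv i ?E) y)"
    by (simp add: g_matrix_def fun_eq_iff)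
  have lD: "locD c x = (\<lambda>y. frechet_derivative ?E (at y))" by (simp only: locD_def fun_eq_iff simp_thms)
  show "minkowski_norm (loc c x) (locD c x)" unfolding lD
    by (rule minkowski_normI[OF refl g loc_nonneg[OF c x] loc_scale[OF c x] cont E1 D2 pd])
  show "y \<noteq> 0 \<Longrightarrow> (\<Sum>i\<in>UNIV. \<Sum>j\<in>UNIV. g_matrix A F c x y $ i $ j * y $ i * w $ j) = locD c x y w"
    unfolding lD by (rule fundamental_form_eq[OF refl g loc_nonneg[OF c x] loc_scale[OF c x] cont E1 D2 pd])
qed

lemma loc_pos: "c \<in> A \<Longrightarrow> x \<in> chart_img c \<Longrightarrow> y \<noteq> 0 \<Longrightarrow> 0 < loc c x y"
  using minkowski_norm.N_pos[OF loc_minkowski(1)] by blast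

lemma loc_0: "c \<in> A \<Longrightarrow> x \<in> chart_img c \<Longrightarrow> loc c x 0 = 0"
  using loc_scale[of c x 0 0] by simp

text \<open>\<open>local_rep\<close> is continuous and positive on the compact product of
  \<open>K\<close> with the unit sphere; its extreme values there are the constants, and homogeneity
  extends the bounds to all vectors.\<close>

lemma loc_bounds:
  assumes c: "c \<in> A" and K: "compact K" "K \<subseteq> chart_img c"
  obtains m M where "m > 0" "M > 0"
    "\<And>x y. x \<in> K \<Longrightarrow> m * norm y \<le> loc c x y" "\<And>x y. x \<in> K \<Longrightarrow> loc c x y \<le> M * norm y"
proof (cases "K = {}")
  case True
  then show ?thesis using that[of 1 1] by simp
next
  case False
  let ?S = "K \<times> sphere (0::real^'n) 1"
  have "axis undefined 1 \<in> sphere (0::real^'n) 1" by (simp add: norm_axis_1)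
  then have ne: "?S \<noteq> {}" using False by blast
  have comp: "compact ?S" using K by (intro compact_Times) auto
  have cont: "continuous_on ?S (local_rep A F c)"
    by (rule continuous_on_subset[OF loc_cont[OF c]]) (use K in blast)
  obtain q where q: "q \<in> ?S" "\<And>r. r \<in> ?S \<Longrightarrow> local_rep A F c q \<le> local_rep A F c r"
    using continuous_attains_inf[OF comp ne cont] by blast
  obtain Q where Q: "Q \<in> ?S" "\<And>r. r \<in> ?S \<Longrightarrow> local_rep A F c r \<le> local_rep A F c Q"
    using continuous_attains_sup[OF comp ne cont] by blast
  define m where "m = local_rep A F c q"
  define M where "M = local_rep A F c Q"
  have pos: "local_rep A F c r > 0" if "r \<in> ?S" for r
  proof -
    have "fst r \<in> chart_img c" "snd r \<noteq> 0" using that K by auto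
    then show ?thesis using loc_pos[OF c, of "fst r" "snd r"] by simp
  qed
  have b: "m * norm y \<le> loc c x y \<and> loc c x y \<le> M * norm y" if x: "x \<in> K" for x y
  proof (cases "y = 0")
    case True
    have "x \<in> chart_img c" using x K by blast
    then show ?thesis using True loc_0[OF c, of x] by simp
  next
    case False
    have s: "(x, (1 / norm y) *\<^sub>R y) \<in> ?S" using x False by simp
    have xi: "x \<in> chart_img c" using x K by blast
    have e: "loc c x y = norm y * loc c x ((1 / norm y) *\<^sub>R y)"
      using loc_scale[OF c xi, of "norm y" "(1 / norm y) *\<^sub>R y"] False by simp
    show ?thesis unfolding e m_def M_def
      using q(2)[OF s] Q(2)[OF s] by (auto simp: mult.commute intro!: mult_left_mono)
  qed
  show ?thesis by (rule that[of m M]) (use b pos q Q in \<open>auto simp: m_def M_def\<close>)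
qed

end

subsection \<open>The descent field\<close>

locale gradient_flow = finsler A F + young_function h
  for A :: "('m::{t2_space, second_countable_topology}, 'n::finite) chart set"
    and F :: "'m \<Rightarrow> ('m, 'n) tvec \<Rightarrow> real" and h :: "real \<Rightarrow> real" +
  fixes \<phi> :: "'m \<Rightarrow> real"
  assumes phi_C1: "C_function 1 A \<phi>"
begin

text \<open>Coordinates of the differential of \<open>- \<phi>\<close>, the covector whose Legendre
  preimage is the gradient in the flow equation.\<close>

definition ddir :: "('m, 'n) chart \<Rightarrow> real ^ 'n \<Rightarrow> real ^ 'n \<Rightarrow> real" where
  "ddir c x v = - frechet_derivative (\<phi> \<circ> param c) (at x) v"

lemma phi_C1_chart: "c \<in> A \<Longrightarrow> C_on 1 (chart_img c) (\<phi> \<circ> param c)"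
  using phi_C1 unfolding C_function_def by blast

lemma phi_deriv:
  assumes "c \<in> A" "x \<in> chart_img c"
  shows "((\<phi> \<circ> param c) has_derivative (\<lambda>v. - ddir c x v)) (at x)"
  using C_on_has_derivative[OF phi_C1_chart[OF assms(1)] _ assms(2)] by (simp add: ddir_def)

lemma ddir_linear:
  assumes "c \<in> A" "x \<in> chart_img c" shows "linear (ddir c x)"
proof -
  have "linear (\<lambda>v. - (- ddir c x v))"
    by (rule linear_compose_neg[OF has_derivative_linear[OF phi_deriv[OF assms]]])
  then show ?thesis by simp
qed

text \<open>\<open>C_on\<close> provides continuity for each fixed direction; linearity over a
  finite basis makes it joint.\<close>

lemma ddir_cont:
  assumes "c \<in> A"
  shows "continuous_on (chart_img c \<times> UNIV) (\<lambda>q. ddir c (fst q) (snd q))"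
proof -
  have 1: "continuous_on (chart_img c) (\<lambda>x. ddir c x v)" for v
    using phi_C1_chart[OF assms] unfolding C_on_1_iff ddir_def by (intro continuous_intros) blast
  have "continuous_on (chart_img c \<times> UNIV) (\<lambda>q. \<Sum>i\<in>UNIV. snd q $ i * ddir c (fst q) (axis i 1))"
    by (intro continuous_intros continuous_on_compose2[OF 1]) auto
  then show ?thesis
  proof (rule continuous_on_eq)
    fix q assume "q \<in> chart_img c \<times> (UNIV :: (real^'n) set)"
    then have "fst q \<in> chart_img c" by auto
    from linear_axis_sum[OF ddir_linear[OF assms this], of "snd q"]
    show "(\<Sum>i\<in>UNIV. snd q $ i * ddir c (fst q) (axis i 1)) = ddir c (fst q) (snd q)" by simp
  qed
qed

lemma ddir_change:
  assumes "c \<in> A" "c' \<in> A" "p \<in> chart_dom c" "p \<in> chart_dom c'"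
  shows "ddir c (coord c p) w = ddir c' (coord c' p) (transD c c' p w)"
proof -
  have "((\<phi> \<circ> param c') has_derivative (\<lambda>v. - ddir c' (coord c' p) v)) (at (transition c c' (coord c p)))"
    unfolding transition_coord[OF assms(1,3)] using phi_deriv[OF assms(2)] assms(4) by blast
  from diff_chain_at[OF transition_deriv[OF assms] this]
  have 1: "((\<phi> \<circ> param c') \<circ> transition c c' has_derivative
      (\<lambda>v. - ddir c' (coord c' p) v) \<circ> transD c c' p) (at (coord c p))" .
  have "((\<phi> \<circ> param c) has_derivative (\<lambda>v. - ddir c' (coord c' p) v) \<circ> transD c c' p) (at (coord c p))"
  proof (rule has_derivative_transform_within_open[OF 1 open_overlap[OF assms(1,2)]])
    fix x assume "x \<in> coord c ` (chart_dom c \<inter> chart_dom c')"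
    then obtain q where "q \<in> chart_dom c" "q \<in> chart_dom c'" "x = coord c q" by blast
    then show "(\<phi> \<circ> param c' \<circ> transition c c') x = (\<phi> \<circ> param c) x"
      by (simp add: transition_coord[OF assms(1)] param_coord assms)
  qed (use assms in blast)
  from fun_cong[OF has_derivative_unique[OF this phi_deriv[OF assms(1)]], of w] assms(3)
  show ?thesis by simp
qed

text \<open>Pairing of a tangent vector with the differential of \<open>- \<phi>\<close>. The chart
  is an arbitrary choice, removed by \<open>desc_eq\<close>.\<close>

definition desc :: "'m \<Rightarrow> ('m, 'n) tvec \<Rightarrow> real" where
  "desc p X = ddir (chart_at A p) (coord (chart_at A p) p) (X (chart_at A p))"

lemma desc_eq:
  assumes "c \<in> A" "p \<in> chart_dom c" "X \<in> tangent_space A p"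
  shows "desc p X = ddir c (coord c p) (X c)"
  unfolding desc_def
  using ddir_change[OF assms(1) chart_at(1) assms(2) chart_at(2), of "X c"]
    tangent_change[OF assms(3,1) chart_at(1) assms(2) chart_at(2)] by simp

text \<open>\<open>gradient\<close> is an \<open>inv_into\<close>, hence meaningful only once the
  differential is known to be in the range of \<open>legendre\<close>, which \<open>leg_surj\<close>
  supplies. Whichever preimage is selected, its coordinates are sent by \<open>leg\<close> to
  \<open>ddir c x\<close>, and this is what the conclusion records.\<close>

lemma slope_leg:
  assumes "c = chart_at A p" "x = coord c p"
  obtains y where "minkowski_norm.leg (locD c x) y = ddir c x" "slope A F \<phi> p = loc c x y"
proof -
  have c: "c \<in> A" "p \<in> chart_dom c" using chart_at assms by auto
  then have x: "x \<in> chart_img c" using assms(2) by blast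
  interpret minkowski_norm "loc c x" "locD c x" by (rule loc_minkowski[OF c(1) x])
  have legX: "legendre A F p X Y = leg (X c) (Y c)" if "X \<in> tangent_space A p" "Y \<in> tangent_space A p" for X Y
  proof (cases "X c = 0")
    case True
    have "X = (\<lambda>_. 0)"
    proof (rule tangent_eqI[OF that(1) _ c])
      show "(\<lambda>_. 0) \<in> tangent_space A p" unfolding tangent_space_def
        using linear_0[OF transD_linear] by auto
    qed (use True in simp)
    then show ?thesis using True that by (simp add: legendre_def leg_def)
  next
    case False
    then have "X \<noteq> (\<lambda>_. 0)" by auto
    then show ?thesis
      using loc_minkowski(2)[OF c(1) x False, of "Y c"] that False
      by (simp add: legendre_def leg_def fundamental_tensor_def Let_def flip: assms)
  qed
  have neg: "frechet_derivative ((\<lambda>q. - \<phi> q) \<circ> param c) (at x) v = ddir c x v" for v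
  proof -
    have "((\<lambda>q. - \<phi> q) \<circ> param c has_derivative (\<lambda>v. ddir c x v)) (at x)"
      using has_derivative_minus[OF phi_deriv[OF c(1) x]] by (simp add: o_def)
    from frechet_derivative_eqI[OF this] show ?thesis by simp
  qed
  have dif: "differential A (\<lambda>q. - \<phi> q) p Y = ddir c x (Y c)" if "Y \<in> tangent_space A p" for Y
    using that neg by (simp add: differential_def Let_def flip: assms)
  have eq_iff: "legendre A F p X = differential A (\<lambda>q. - \<phi> q) p \<longleftrightarrow> leg (X c) = ddir c x"
    if X: "X \<in> tangent_space A p" for X
  proof
    assume *: "legendre A F p X = differential A (\<lambda>q. - \<phi> q) p"
    show "leg (X c) = ddir c x"
    proof
      fix v
      have t: "tvec_of A c p v \<in> tangent_space A p" by (rule tvec_of_in[OF c])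
      show "leg (X c) v = ddir c x v"
        using legX[OF X t] dif[OF t] * by (simp add: tvec_of_self[OF c])
    qed
  next
    assume *: "leg (X c) = ddir c x"
    show "legendre A F p X = differential A (\<lambda>q. - \<phi> q) p"
    proof
      fix Y show "legendre A F p X Y = differential A (\<lambda>q. - \<phi> q) p Y"
      proof (cases "Y \<in> tangent_space A p")
        case True then show ?thesis using legX[OF X] dif * by simp
      next
        case False then show ?thesis by (simp add: legendre_def differential_def)
      qed
    qed
  qed
  obtain y0 where y0: "leg y0 = ddir c x" using leg_surj[OF ddir_linear[OF c(1) x]] by blast
  let ?X = "gradient A F (\<lambda>q. - \<phi> q) p"
  have im: "differential A (\<lambda>q. - \<phi> q) p \<in> legendre A F p ` tangent_space A p"
    using eq_iff[OF tvec_of_in[OF c, of y0]] y0 tvec_of_in[OF c, of y0]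
    by (auto simp: tvec_of_self[OF c] intro!: image_eqI)
  have X: "?X \<in> tangent_space A p" unfolding gradient_def by (rule inv_into_into[OF im])
  have "legendre A F p ?X = differential A (\<lambda>q. - \<phi> q) p"
    unfolding gradient_def by (rule f_inv_into_f[OF im])
  then have "leg (?X c) = ddir c x" using eq_iff[OF X] by blast
  moreover have "slope A F \<phi> p = loc c x (?X c)" using F_eq_loc[OF c X] assms by simp
  ultimately show ?thesis by (rule that)
qed

text \<open>In the chart the covector is \<open>leg y\<close> with \<open>F\<close>-length of
  \<open>y\<close> equal to the slope, so the duality of \<open>minkowski_young\<close> transfers to
  the tangent space.\<close>

lemma dual_tangent:
  shows "X \<in> tangent_space A p \<Longrightarrow> desc p X - psi h (F p X) \<le> psi_star h (slope A F \<phi> p)"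
    and "\<exists>!X. X \<in> tangent_space A p \<and> desc p X - psi h (F p X) = psi_star h (slope A F \<phi> p)"
    and "0 \<le> slope A F \<phi> p"
proof -
  define c where "c = chart_at A p"
  define x where "x = coord c p"
  have c: "c \<in> A" "p \<in> chart_dom c" using chart_at c_def by auto
  then have x: "x \<in> chart_img c" using x_def by blast
  interpret minkowski_norm "loc c x" "locD c x" by (rule loc_minkowski[OF c(1) x])
  interpret minkowski_young "loc c x" "locD c x" h ..
  obtain y where y: "leg y = ddir c x" "slope A F \<phi> p = loc c x y"
    using slope_leg[OF c_def x_def] by blast
  have val: "desc p X - psi h (F p X) = leg y (X c) - psi h (loc c x (X c))" if "X \<in> tangent_space A p" for X
    using desc_eq[OF c that] F_eq_loc[OF c that] y(1) by (simp add: x_def)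
  show "X \<in> tangent_space A p \<Longrightarrow> desc p X - psi h (F p X) \<le> psi_star h (slope A F \<phi> p)"
    using dual_le[of y "X c"] by (simp add: val y(2))
  obtain v where v: "leg y v - psi h (loc c x v) = psi_star h (loc c x y)"
    and vu: "\<And>w. leg y w - psi h (loc c x w) = psi_star h (loc c x y) \<Longrightarrow> w = v"
    using dual_attained_unique[of y] by blast
  show "\<exists>!X. X \<in> tangent_space A p \<and> desc p X - psi h (F p X) = psi_star h (slope A F \<phi> p)"
  proof (rule ex1I[of _ "tvec_of A c p v"])
    show "tvec_of A c p v \<in> tangent_space A p \<and>
      desc p (tvec_of A c p v) - psi h (F p (tvec_of A c p v)) = psi_star h (slope A F \<phi> p)"
      using val[OF tvec_of_in[OF c]] v y(2) by (simp add: tvec_of_self[OF c] tvec_of_in[OF c])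
    fix X assume X: "X \<in> tangent_space A p \<and> desc p X - psi h (F p X) = psi_star h (slope A F \<phi> p)"
    then have "leg y (X c) - psi h (loc c x (X c)) = psi_star h (loc c x y)"
      using val[of X] y(2) by simp
    then have "X c = v" by (rule vu)
    then show "X = tvec_of A c p v"
      using tangent_eqI[OF _ tvec_of_in[OF c] c, of X v] X by (simp add: tvec_of_self[OF c])
  qed
  show "0 \<le> slope A F \<phi> p" using y(2) N_nonneg by simp
qed

text \<open>It is the gradient of \<open>- \<phi>\<close> rescaled to the length \<open>r\<close>
  for which \<open>h r\<close> is the slope, and 0 where the slope is 0. The implicit form is kept
  because later steps use only the characterizing equation.\<close>

definition descent_field :: "'m \<Rightarrow> ('m, 'n) tvec" where
  "descent_field p = (THE X. X \<in> tangent_space A p \<and> desc p X - psi h (F p X) = psi_star h (slope A F \<phi> p))"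

lemma descent_field: "descent_field p \<in> tangent_space A p"
    "desc p (descent_field p) - psi h (F p (descent_field p)) = psi_star h (slope A F \<phi> p)"
  using theI'[OF dual_tangent(2), of p] by (simp_all add: descent_field_def)

lemma field_unique:
  "X \<in> tangent_space A p \<Longrightarrow> desc p X - psi h (F p X) = psi_star h (slope A F \<phi> p) \<Longrightarrow> X = descent_field p"
  using dual_tangent(2)[of p] descent_field by blast

text \<open>Superlinear growth of \<open>psi\<close> beats the linear growth of the covector. With
  \<open>N\<close> the Finsler length of the field, the equality case gives
  \<open>psi h N \<le> (C / m) * N\<close>; Fenchel-Young at \<open>k = C / m + 1\<close>, one above
  this rate, leaves exactly \<open>N \<le> psi_star h k\<close>.\<close>

lemma field_bounded:
  assumes c: "c \<in> A" and K: "compact K" "K \<subseteq> chart_img c"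
  obtains R where "\<And>x. x \<in> K \<Longrightarrow> norm (descent_field (param c x) c) \<le> R"
proof -
  obtain m M where mM: "m > 0" "M > 0" "\<And>x y. x \<in> K \<Longrightarrow> m * norm y \<le> loc c x y"
      "\<And>x y. x \<in> K \<Longrightarrow> loc c x y \<le> M * norm y"
    using loc_bounds[OF assms] by blast
  have "compact ((\<lambda>q. ddir c (fst q) (snd q)) ` (K \<times> sphere 0 1))"
    by (intro compact_continuous_image compact_Times K continuous_on_subset[OF ddir_cont[OF c]])
       (use K in auto)
  from compact_imp_bounded[OF this] obtain B
    where B': "\<forall>y\<in>(\<lambda>q. ddir c (fst q) (snd q)) ` (K \<times> sphere 0 1). norm y \<le> B"
    unfolding bounded_iff by blast
  have B: "\<bar>ddir c x v\<bar> \<le> B" if "x \<in> K" "norm v = 1" for x v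
  proof -
    have "ddir c (fst (x, v)) (snd (x, v)) \<in> (\<lambda>q. ddir c (fst q) (snd q)) ` (K \<times> sphere 0 1)"
      by (rule imageI) (use that in simp)
    with B' show ?thesis by fastforce
  qed
  define C where "C = \<bar>B\<bar>"
  have C: "ddir c x v \<le> C * norm v" if "x \<in> K" for x v
  proof (cases "v = 0")
    case True
    have "x \<in> chart_img c" using that K by blast
    then show ?thesis using linear_0[OF ddir_linear[OF c]] True by simp
  next
    case False
    have xi: "x \<in> chart_img c" using that K by blast
    have "ddir c x v = norm v * ddir c x ((1 / norm v) *\<^sub>R v)"
      using linear_scale[OF ddir_linear[OF c xi], of "1 / norm v" v] False by simp
    also have "\<dots> \<le> norm v * C"
      using B[OF that, of "(1 / norm v) *\<^sub>R v"] False by (intro mult_left_mono) (auto simp: C_def)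
    finally show ?thesis by (simp add: mult.commute)
  qed
  define k where "k = C / m + 1"
  have k: "k \<ge> 1" using mM by (simp add: k_def C_def)
  define R where "R = psi_star h k / m"
  show ?thesis
  proof (rule that[of R])
    fix x assume x: "x \<in> K"
    then have xi: "x \<in> chart_img c" using K by blast
    define p where "p = param c x"
    have p: "p \<in> chart_dom c" "coord c p = x" using param_in coord_param c xi p_def by auto
    define v where "v = descent_field p c"
    have F: "F p (descent_field p) = loc c x v" "desc p (descent_field p) = ddir c x v"
      using F_eq_loc[OF c p(1) descent_field(1)] desc_eq[OF c p(1) descent_field(1)] p(2) by (simp_all add: v_def)
    have n: "0 \<le> loc c x v" using loc_nonneg[OF c xi] .
    have "psi h (loc c x v) \<le> ddir c x v"
      using descent_field(2)[of p] psi_star_nonneg[OF dual_tangent(3)[of p]] F by simp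
    also have "\<dots> \<le> C * norm v" by (rule C[OF x])
    also have "\<dots> = (C / m) * (m * norm v)" using mM by simp
    also have "\<dots> \<le> (C / m) * loc c x v" using mM x by (intro mult_left_mono) (auto simp: C_def)
    finally have "psi h (loc c x v) \<le> (C / m) * loc c x v" .
    moreover have "loc c x v * k - psi h (loc c x v) \<le> psi_star h k"
      by (rule fenchel_young) (use n k in auto)
    ultimately have "loc c x v \<le> psi_star h k" by (simp add: k_def algebra_simps)
    then have "m * norm v \<le> psi_star h k" using mM(3)[OF x, of v] by simp
    then show "norm (descent_field (param c x) c) \<le> R"
      using mM by (simp add: R_def v_def p_def field_simps)
  qed
qed

text \<open>In a chart the field is the unique maximizer of a jointly continuous function; being locally
  bounded, it is continuous because its graph is closed.\<close>

lemma field_cont_chart: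
  assumes c: "c \<in> A"
  shows "continuous_on (chart_img c) (\<lambda>x. descent_field (param c x) c)"
proof -
  define \<Phi> where "\<Phi> q = ddir c (fst q) (snd q) - psi h (local_rep A F c q)" for q
  have contP: "continuous_on (chart_img c \<times> UNIV) \<Phi>" unfolding \<Phi>_def
    by (intro continuous_intros ddir_cont[OF c] continuous_on_compose2[OF psi_cont loc_cont[OF c]])
       (use loc_nonneg[OF c] in auto)
  have P: "\<Phi> (x, w) = desc (param c x) (tvec_of A c (param c x) w) - psi h (F (param c x) (tvec_of A c (param c x) w))"
    if "x \<in> chart_img c" for x w
    using desc_eq[OF c param_in[OF c that] tvec_of_in[OF c param_in[OF c that]], of w]
      F_tvec_of[OF c param_in[OF c that], of w] coord_param[OF c that] tvec_of_self[OF c param_in[OF c that], of w]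
    by (simp add: \<Phi>_def)
  have max: "(\<forall>u. \<Phi> (x, u) \<le> \<Phi> (x, w)) \<longleftrightarrow> w = descent_field (param c x) c" if x: "x \<in> chart_img c" for x w
  proof -
    let ?p = "param c x"
    have p: "?p \<in> chart_dom c" by (rule param_in[OF c x])
    have fV: "\<Phi> (x, descent_field ?p c) = psi_star h (slope A F \<phi> ?p)"
      using P[OF x, of "descent_field ?p c"] descent_field[of ?p] tvec_of_tangent[OF descent_field(1) c p] by simp
    have le: "\<Phi> (x, u) \<le> psi_star h (slope A F \<phi> ?p)" for u
      using P[OF x, of u] dual_tangent(1)[OF tvec_of_in[OF c p, of u]] by simp
    show ?thesis
    proof
      assume "\<forall>u. \<Phi> (x, u) \<le> \<Phi> (x, w)"
      then have "\<Phi> (x, w) = psi_star h (slope A F \<phi> ?p)" using le fV by (metis antisym)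
      then have "tvec_of A c ?p w = descent_field ?p"
        using P[OF x, of w] by (intro field_unique tvec_of_in c p) simp
      then show "w = descent_field ?p c" using tvec_of_self[OF c p, of w] by simp
    qed (use le fV in simp)
  qed
  have "isCont (\<lambda>x. descent_field (param c x) c) x" if x: "x \<in> chart_img c" for x
  proof -
    obtain r where r: "r > 0" "cball x r \<subseteq> chart_img c"
      using open_chart_img[OF c] x open_contains_cball by blast
    obtain R where R: "\<And>z. z \<in> cball x r \<Longrightarrow> norm (descent_field (param c z) c) \<le> R"
      using field_bounded[OF c compact_cball r(2)] by blast
    have "continuous_on (cball x r) (\<lambda>x. descent_field (param c x) c)"
    proof (rule continuous_from_closed_graph[of "cball 0 R"])
      show "(\<lambda>x. descent_field (param c x) c) \<in> cball x r \<rightarrow> cball 0 R" using R by auto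
      \<comment> \<open>Being a maximizer is an intersection of closed conditions, one for each
        competitor \<open>u\<close>. The compact target \<open>cball 0 R\<close> is what lets a
        closed graph imply continuity.\<close>
      have "(\<lambda>x. (x, descent_field (param c x) c)) ` cball x r =
          (cball x r \<times> cball 0 R) \<inter> (\<Inter>u. {q \<in> cball x r \<times> cball 0 R. \<Phi> (fst q, u) \<le> \<Phi> q})" (is "?L = ?R")
      proof (intro equalityI subsetI)
        fix q assume "q \<in> ?L"
        then obtain z where z: "z \<in> cball x r" "q = (z, descent_field (param c z) c)" by blast
        then have "z \<in> chart_img c" using r by blast
        then show "q \<in> ?R" using max[of z "descent_field (param c z) c"] z R by auto
      next
        fix q assume q: "q \<in> ?R"
        then have "fst q \<in> cball x r" by auto
        moreover have "snd q = descent_field (param c (fst q)) c"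
          using max[of "fst q" "snd q"] q r(2) by auto
        ultimately show "q \<in> ?L" by (intro image_eqI[of _ _ "fst q"]) (auto simp: prod_eq_iff)
      qed
      moreover have "closed {q \<in> cball x r \<times> cball 0 R. \<Phi> (fst q, u) \<le> \<Phi> q}" for u
      proof -
        have sub: "cball x r \<times> cball 0 R \<subseteq> chart_img c \<times> UNIV" using r by blast
        have "continuous_on (cball x r \<times> cball 0 R) (\<lambda>q. \<Phi> q - \<Phi> (fst q, u))"
          by (intro continuous_intros continuous_on_subset[OF contP sub] continuous_on_compose2[OF contP])
             (use r in auto)
        then have "closed ((cball x r \<times> cball 0 R) \<inter> (\<lambda>q. \<Phi> q - \<Phi> (fst q, u)) -` {0..})"
          by (rule continuous_closed_preimage) (auto intro: closed_Times)
        moreover have "(cball x r \<times> cball 0 R) \<inter> (\<lambda>q. \<Phi> q - \<Phi> (fst q, u)) -` {0..} =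
          {q \<in> cball x r \<times> cball 0 R. \<Phi> (fst q, u) \<le> \<Phi> q}" by auto
        ultimately show ?thesis by simp
      qed
      ultimately show "closed ?L" by (simp add: closed_INT closed_Int closed_Times)
    qed auto
    then show ?thesis using r continuous_on_interior[of "cball x r" _ x] by (simp add: interior_cball)
  qed
  then show ?thesis by (simp add: continuous_at_imp_continuous_on)
qed

lemma field_cont:
  assumes c: "c \<in> A"
  shows "continuous_on (chart_dom c) (\<lambda>p. descent_field p c)"
proof -
  have "continuous_on (chart_dom c) (\<lambda>p. descent_field (param c (coord c p)) c)"
    by (rule continuous_on_compose2[OF field_cont_chart[OF c] continuous_coord[OF c]]) auto
  then show ?thesis by (rule continuous_on_eq) (simp add: param_coord[OF c])
qed

end

subsection \<open>Curves\<close>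

context atlas
begin

lemma C_curve_subset: "C_curve k A S \<gamma> \<Longrightarrow> T \<subseteq> S \<Longrightarrow> C_curve k A T \<gamma>"
  unfolding C_curve_def
proof (intro ballI impI)
  fix t c assume g: "\<forall>t\<in>S. \<forall>c\<in>A. \<gamma> t \<in> chart_dom c \<longrightarrow> (\<exists>I g. open I \<and> t \<in> I \<and> C_on k I g \<and>
      (\<forall>s\<in>I \<inter> S. \<gamma> s \<in> chart_dom c \<and> coord c (\<gamma> s) = g s))"
    and T: "T \<subseteq> S" and t: "t \<in> T" "c \<in> A" "\<gamma> t \<in> chart_dom c"
  from T t(1) have "t \<in> S" by blast
  from g[rule_format, OF this t(2,3)] obtain I g' where "open I" "t \<in> I" "C_on k I g'"
    "\<forall>s\<in>I \<inter> S. \<gamma> s \<in> chart_dom c \<and> coord c (\<gamma> s) = g' s" by blast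
  with T show "\<exists>I g. open I \<and> t \<in> I \<and> C_on k I g \<and>
      (\<forall>s\<in>I \<inter> T. \<gamma> s \<in> chart_dom c \<and> coord c (\<gamma> s) = g s)" by blast
qed

lemma C_curve_cong:
  assumes "C_curve k A S \<gamma>" "\<And>t. t \<in> S \<Longrightarrow> \<gamma> t = \<gamma>' t"
  shows "C_curve k A S \<gamma>'"
  unfolding C_curve_def
proof (intro ballI impI)
  fix t c assume t: "t \<in> S" "c \<in> A" "\<gamma>' t \<in> chart_dom c"
  then obtain I g where "open I" "t \<in> I" "C_on k I g"
      "\<forall>s\<in>I \<inter> S. \<gamma> s \<in> chart_dom c \<and> coord c (\<gamma> s) = g s"
    using assms unfolding C_curve_def by metis
  then show "\<exists>I g. open I \<and> t \<in> I \<and> C_on k I g \<and>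
       (\<forall>s\<in>I \<inter> S. \<gamma>' s \<in> chart_dom c \<and> coord c (\<gamma>' s) = g s)"
    using assms(2) by (intro exI[of _ I] exI[of _ g]) simp
qed

lemma C_curve_affine:
  assumes "C_curve k A S \<gamma>" "\<And>t. t \<in> T \<Longrightarrow> b + t * a \<in> S"
  shows "C_curve k A T (\<lambda>t. \<gamma> (b + t * a))"
  unfolding C_curve_def
proof (intro ballI impI)
  fix t c assume t: "t \<in> T" "c \<in> A" "\<gamma> (b + t * a) \<in> chart_dom c"
  then obtain I g where I: "open I" "b + t * a \<in> I" "C_on k I g"
      "\<forall>s\<in>I \<inter> S. \<gamma> s \<in> chart_dom c \<and> coord c (\<gamma> s) = g s"
    using assms unfolding C_curve_def by meson
  show "\<exists>I g. open I \<and> t \<in> I \<and> C_on k I g \<and>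
       (\<forall>s\<in>I \<inter> T. \<gamma> (b + s * a) \<in> chart_dom c \<and> coord c (\<gamma> (b + s * a)) = g s)"
  proof (intro exI conjI ballI)
    show "C_on k ((\<lambda>t. b + t *\<^sub>R a) -` I) (\<lambda>t. g (b + t *\<^sub>R a))"
      by (rule C_on_affine[OF I(1,3)])
    show "open ((\<lambda>t. b + t *\<^sub>R a) -` I)"
      by (rule open_vimage[OF I(1)]) (intro continuous_intros)
    show "t \<in> (\<lambda>t. b + t *\<^sub>R a) -` I" using I by simp
    fix s assume "s \<in> (\<lambda>t. b + t *\<^sub>R a) -` I \<inter> T"
    then have "b + s * a \<in> I \<inter> S" using assms(2) by simp
    then show "\<gamma> (b + s * a) \<in> chart_dom c" "coord c (\<gamma> (b + s * a)) = g (b + s *\<^sub>R a)"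
      using I(4) by auto
  qed
qed

lemma C_curve_local:
  assumes "C_curve k A S \<gamma>" "t \<in> S" "c \<in> A" "\<gamma> t \<in> chart_dom c"
  obtains I g where "open I" "t \<in> I" "C_on k I g"
    "\<And>s. s \<in> I \<Longrightarrow> s \<in> S \<Longrightarrow> \<gamma> s \<in> chart_dom c" "\<And>s. s \<in> I \<Longrightarrow> s \<in> S \<Longrightarrow> coord c (\<gamma> s) = g s"
proof -
  obtain I g where I: "open I" "t \<in> I" "C_on k I g"
      "\<forall>s\<in>I \<inter> S. \<gamma> s \<in> chart_dom c \<and> coord c (\<gamma> s) = g s"
    using assms unfolding C_curve_def by meson
  show ?thesis by (rule that[of I g]) (use I in blast)+
qed

lemma C_curve_continuous:
  assumes "C_curve k A S \<gamma>"
  shows "continuous_on S \<gamma>"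
  unfolding continuous_on_eq_continuous_within
proof
  fix t assume t: "t \<in> S"
  obtain c where c: "c \<in> A" "\<gamma> t \<in> chart_dom c" using chart_exists by blast
  obtain I g where I: "open I" "t \<in> I" "C_on k I g"
    "\<And>s. s \<in> I \<Longrightarrow> s \<in> S \<Longrightarrow> \<gamma> s \<in> chart_dom c" "\<And>s. s \<in> I \<Longrightarrow> s \<in> S \<Longrightarrow> coord c (\<gamma> s) = g s"
    using C_curve_local[OF assms t c] by metis
  have "continuous_on (I \<inter> S) (\<lambda>s. param c (g s))"
  proof (rule continuous_on_compose2[OF continuous_param[OF c(1)]])
    show "continuous_on (I \<inter> S) g"
      using C_on_imp_continuous_on[OF I(3)] continuous_on_subset by blast
    show "g ` (I \<inter> S) \<subseteq> chart_img c" using I by force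
  qed
  then have "continuous_on (I \<inter> S) \<gamma>"
    by (rule continuous_on_eq) (use I(4) I(5)[symmetric] in \<open>simp add: param_coord[OF c(1)]\<close>)
  then have "continuous (at t within I \<inter> S) \<gamma>"
    using t I(2) continuous_on_eq_continuous_within by blast
  moreover have "at t within I \<inter> S = at t within S"
    by (rule at_within_nhd[OF I(2,1)]) blast
  ultimately show "continuous (at t within S) \<gamma>" by (simp add: continuous_within)
qed

lemma velocity_eq_tvec_of:
  assumes c: "c \<in> A" "\<gamma> t \<in> chart_dom c" and ct: "continuous (at t within S) \<gamma>" "t \<in> S" "at t within S \<noteq> bot"
    and d: "((coord c \<circ> \<gamma>) has_vector_derivative w) (at t within S)"
  shows "velocity A S \<gamma> t = tvec_of A c (\<gamma> t) w"
proof
  fix c'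
  show "velocity A S \<gamma> t c' = tvec_of A c (\<gamma> t) w c'"
  proof (cases "c' \<in> A \<and> \<gamma> t \<in> chart_dom c'")
    case True
    then have "((coord c' \<circ> \<gamma>) has_vector_derivative transD c c' (\<gamma> t) w) (at t within S)"
      using curve_deriv_change[OF c(1) _ c(2) _ d ct(1,2)] by blast
    from vector_derivative_within[OF ct(3) this] True show ?thesis
      by (simp add: velocity_def tvec_of_def)
  next
    case False then show ?thesis by (simp only: velocity_def tvec_of_def if_False)
  qed
qed

text \<open>The derivative of a local extension restricts to the derivative within \<open>S\<close>
  and is continuous, also at end points of \<open>S\<close>. Condition \<open>nt\<close> excludes
  isolated points, at which \<open>vector_derivative\<close> is undetermined.\<close>

lemma C_curve_velocity:
  assumes g: "C_curve k A S \<gamma>" and k: "1 \<le> k" and t: "t \<in> S" and c: "c \<in> A" "\<gamma> t \<in> chart_dom c"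
    and nt: "\<And>s. s \<in> S \<Longrightarrow> at s within S \<noteq> bot"
  obtains I w where "open I" "t \<in> I" "continuous_on (I \<inter> S) w"
    "\<And>s. s \<in> I \<Longrightarrow> s \<in> S \<Longrightarrow> \<gamma> s \<in> chart_dom c"
    "\<And>s. s \<in> I \<Longrightarrow> s \<in> S \<Longrightarrow> ((coord c \<circ> \<gamma>) has_vector_derivative w s) (at s within S)"
    "\<And>s. s \<in> I \<Longrightarrow> s \<in> S \<Longrightarrow> velocity A S \<gamma> s = tvec_of A c (\<gamma> s) (w s)"
proof -
  obtain I g where I: "open I" "t \<in> I" "C_on k I g"
    "\<And>s. s \<in> I \<Longrightarrow> s \<in> S \<Longrightarrow> \<gamma> s \<in> chart_dom c" "\<And>s. s \<in> I \<Longrightarrow> s \<in> S \<Longrightarrow> coord c (\<gamma> s) = g s"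
    using C_curve_local[OF g t c] by metis
  let ?w = "\<lambda>s. frechet_derivative g (at s) 1"
  have d: "((coord c \<circ> \<gamma>) has_vector_derivative ?w s) (at s within S)" if s: "s \<in> I" "s \<in> S" for s
  proof -
    have gd: "(g has_vector_derivative ?w s) (at s within S)"
      using C_on_has_vector_derivative[OF I(3) k s(1)] has_vector_derivative_at_within by blast
    show ?thesis
      unfolding has_vector_derivative_def
      by (rule has_derivative_transform_eventually[OF gd[unfolded has_vector_derivative_def]])
         (use s I in \<open>auto simp: eventually_at_topological\<close>)
  qed
  have k1: "C_on 1 I g" using I(3) k unfolding C_on_def by (meson order_trans)
  show ?thesis
  proof (rule that[OF I(1,2), of ?w])
    show "continuous_on (I \<inter> S) ?w"
      using k1 continuous_on_subset unfolding C_on_1_iff by blast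
    show "velocity A S \<gamma> s = tvec_of A c (\<gamma> s) (?w s)" if "s \<in> I" "s \<in> S" for s
      using velocity_eq_tvec_of[OF c(1) I(4)[OF that] _ that(2) nt[OF that(2)] d[OF that]]
        C_curve_continuous[OF g] that(2) continuous_on_eq_continuous_within by blast
  qed (use I d in auto)
qed

text \<open>\<open>piecewise_smooth_curve\<close> is tied to \<open>{0..1}\<close> and to an
  explicit subdivision. The inductive form on arbitrary intervals turns splitting, joining and
  reparametrizing into inductions over the pieces.\<close>

inductive pw_smooth :: "(real \<Rightarrow> 'm) \<Rightarrow> real \<Rightarrow> real \<Rightarrow> bool" for \<gamma> where
  base: "a < b \<Longrightarrow> C_curve \<infinity> A {a..b} \<gamma> \<Longrightarrow> pw_smooth \<gamma> a b"
| step: "pw_smooth \<gamma> a b \<Longrightarrow> b < c \<Longrightarrow> C_curve \<infinity> A {b..c} \<gamma> \<Longrightarrow> pw_smooth \<gamma> a c"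

lemma pw_smooth_less: "pw_smooth \<gamma> a b \<Longrightarrow> a < b"
  by (induction rule: pw_smooth.induct) auto

lemma piecewise_smooth_curve_iff: "piecewise_smooth_curve A \<gamma> \<longleftrightarrow> pw_smooth \<gamma> 0 1"
proof
  assume "piecewise_smooth_curve A \<gamma>"
  then obtain N and \<tau> :: "nat \<Rightarrow> real" where \<tau>: "\<tau> 0 = 0" "\<tau> N = 1"
    "\<And>i. i < N \<Longrightarrow> \<tau> i < \<tau> (Suc i)" "\<And>i. i < N \<Longrightarrow> C_curve \<infinity> A {\<tau> i..\<tau> (Suc i)} \<gamma>"
    unfolding piecewise_smooth_curve_def by blast
  have "i < N \<Longrightarrow> pw_smooth \<gamma> 0 (\<tau> (Suc i))" for i
  proof (induction i)
    case 0
    then show ?case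
      using pw_smooth.base[of "\<tau> 0" "\<tau> (Suc 0)" \<gamma>] \<tau>(3)[OF 0] \<tau>(4)[OF 0] \<tau>(1) by simp
  next
    case (Suc i)
    then show ?case using pw_smooth.step \<tau>(3,4) by simp
  qed
  from this[of "N - 1"] \<tau>(1,2) show "pw_smooth \<gamma> 0 1" by (cases N) auto
next
  have "pw_smooth \<gamma> a b \<Longrightarrow> \<exists>N (\<tau> :: nat \<Rightarrow> real). \<tau> 0 = a \<and> \<tau> N = b \<and>
        (\<forall>i<N. \<tau> i < \<tau> (Suc i) \<and> C_curve \<infinity> A {\<tau> i..\<tau> (Suc i)} \<gamma>)" for a b
  proof (induction rule: pw_smooth.induct)
    case (base a b)
    then show ?case by (intro exI[of _ 1] exI[of _ "\<lambda>i. if i = 0 then a else b"]) simp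
  next
    case (step a b c)
    then obtain N and \<tau> :: "nat \<Rightarrow> real" where \<tau>: "\<tau> 0 = a" "\<tau> N = b"
      "\<forall>i<N. \<tau> i < \<tau> (Suc i) \<and> C_curve \<infinity> A {\<tau> i..\<tau> (Suc i)} \<gamma>" by blast
    show ?case
      by (intro exI[of _ "Suc N"] exI[of _ "\<tau>(Suc N := c)"]) (use \<tau> step in \<open>auto simp: less_Suc_eq\<close>)
  qed
  then show "pw_smooth \<gamma> 0 1 \<Longrightarrow> piecewise_smooth_curve A \<gamma>"
    unfolding piecewise_smooth_curve_def by blast
qed

lemma pw_smooth_split:
  "pw_smooth \<gamma> a c \<Longrightarrow> a < t \<Longrightarrow> t < c \<Longrightarrow> pw_smooth \<gamma> a t \<and> pw_smooth \<gamma> t c"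
proof (induction rule: pw_smooth.induct)
  case (base a b)
  show ?case
    by (intro conjI pw_smooth.base C_curve_subset[OF base(2)]) (use base in auto)
next
  case (step a b c)
  consider "t < b" | "t = b" | "b < t" by linarith
  then show ?case
  proof cases
    case 1
    then show ?thesis using step pw_smooth.step by blast
  next
    case 2
    then show ?thesis using step pw_smooth.base by blast
  next
    case 3
    have "C_curve \<infinity> A {b..t} \<gamma>" "C_curve \<infinity> A {t..c} \<gamma>"
      using C_curve_subset[OF step(3)] 3 step by auto
    then show ?thesis using 3 step pw_smooth.step pw_smooth.base by blast
  qed
qed

lemma pw_smooth_join: "pw_smooth \<gamma> b c \<Longrightarrow> pw_smooth \<gamma> a b \<Longrightarrow> pw_smooth \<gamma> a c"
proof (induction rule: pw_smooth.induct)
  case (base b c)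
  then show ?case using pw_smooth.step by blast
next
  case (step b c d)
  show ?case by (rule pw_smooth.step[OF step(4)[OF step(5)] step(2,3)])
qed

lemma pw_smooth_cong:
  "pw_smooth \<gamma> a b \<Longrightarrow> (\<And>t. t \<in> {a..b} \<Longrightarrow> \<gamma> t = \<gamma>' t) \<Longrightarrow> pw_smooth \<gamma>' a b"
proof (induction rule: pw_smooth.induct)
  case (base a b)
  then show ?case by (intro pw_smooth.base C_curve_cong[OF base(2)]) auto
next
  case (step a b c)
  have "a < b" using step pw_smooth_less by blast
  then have "pw_smooth \<gamma>' a b" "C_curve \<infinity> A {b..c} \<gamma>'"
    using step C_curve_cong[OF step(3), of \<gamma>'] by auto
  then show ?case using step(2) pw_smooth.step by blast
qed

lemma pw_smooth_continuous: "pw_smooth \<gamma> a b \<Longrightarrow> continuous_on {a..b} \<gamma>"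
proof (induction rule: pw_smooth.induct)
  case (base a b)
  then show ?case using C_curve_continuous by blast
next
  case (step a b c)
  have "{a..c} = {a..b} \<union> {b..c}" using step pw_smooth_less by force
  then show ?case
    using continuous_on_closed_Un[OF _ _ step(4) C_curve_continuous[OF step(3)]] by simp
qed

lemma pw_smooth_affine:
  assumes m: "m > 0"
  shows "pw_smooth \<gamma> a b \<Longrightarrow> pw_smooth (\<lambda>t. \<gamma> (\<beta> + t * m)) ((a - \<beta>) / m) ((b - \<beta>) / m)"
proof (induction rule: pw_smooth.induct)
  case (base a b)
  show ?case
    by (intro pw_smooth.base C_curve_affine[OF base(2)])
       (use base m in \<open>auto simp: field_simps divide_strict_right_mono\<close>)
next
  case (step a b c)
  show ?case
    by (rule pw_smooth.step[OF step(4)], use step m in \<open>simp add: divide_strict_right_mono\<close>)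
       (rule C_curve_affine[OF step(3)], use m in \<open>auto simp: field_simps\<close>)
qed

text \<open>Consider the first exit time. Up to then the curve stays in the chart ball, so
  \<open>travel\<close> applies and confines it to a compact subset of the open ball; closedness of
  that subset carries this over to the exit time itself. \<open>travel\<close> may presuppose that
  the curve has not yet left, because only there does the chart control it. Used for short curves
  and for integral curves alike.\<close>

lemma no_exit:
  fixes \<gamma> :: "real \<Rightarrow> 'm"
  assumes c: "c \<in> A" and sub: "cball x r \<subseteq> chart_img c"
    and cont: "continuous_on {a..b} \<gamma>" and start: "\<gamma> a \<in> param c ` ball x (r/2)"
    and travel: "\<And>t. t \<in> {a..b} \<Longrightarrow> (\<And>s. s \<in> {a..t} \<Longrightarrow> \<gamma> s \<in> param c ` ball x r) \<Longrightarrow>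
         norm (coord c (\<gamma> t) - coord c (\<gamma> a)) \<le> r / 2"
    and t: "t \<in> {a..b}"
  shows "\<gamma> t \<in> param c ` ball x r"
proof (rule ccontr)
  assume nin: "\<gamma> t \<notin> param c ` ball x r"
  define W where "W = param c ` ball x r"
  have bsub: "ball x r \<subseteq> chart_img c" using sub ball_subset_cball by blast
  have oW: "open W" unfolding W_def by (rule open_param_image[OF c open_ball bsub])
  define B where "B = {a..b} \<inter> \<gamma> -` (- W)"
  have "closed B" unfolding B_def
    by (rule continuous_closed_preimage[OF cont]) (use oW in auto)
  moreover have "B = {a..b} \<inter> B" by (auto simp: B_def)
  ultimately have "compact B" using compact_Int_closed[of "{a..b}" B] by simp
  moreover have "t \<in> B" unfolding B_def W_def using t nin by blast
  ultimately obtain t0 where t0: "t0 \<in> B" "\<And>s. s \<in> B \<Longrightarrow> t0 \<le> s"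
    using compact_attains_inf[of B] by (metis empty_iff)
  obtain u where u: "u \<in> ball x (r/2)" "\<gamma> a = param c u" using start by blast
  have "r > 0"
  proof -
    have "0 \<le> dist x u" "dist x u < r / 2" using u(1) by auto
    then show ?thesis by linarith
  qed
  have ux: "u \<in> ball x r" using u(1) \<open>r > 0\<close> by auto
  have cu: "coord c (\<gamma> a) = u" using u(2) coord_param[OF c, of u] ux bsub by (simp add: subset_iff)
  \<comment> \<open>\<open>u\<close> is less than \<open>r/2\<close> from \<open>x\<close>, so this
    closed ball still lies in the open ball of radius \<open>r\<close>; its image is compact, hence
    closed in the Hausdorff space.\<close>
  define K where "K = param c ` cball u (r/2)"
  have Ksub: "cball u (r/2) \<subseteq> ball x r"
  proof
    fix z assume "z \<in> cball u (r/2)"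
    then show "z \<in> ball x r" using u(1) dist_triangle[of x z u] by auto
  qed
  have "compact K" unfolding K_def
    by (rule compact_continuous_image[OF continuous_on_subset[OF continuous_param[OF c]]])
       (use Ksub bsub in auto)
  then have "closed K" by (rule compact_imp_closed)
  have aW: "\<gamma> a \<in> W" using u ux unfolding W_def by blast
  have t0ab: "t0 \<in> {a..b}" "\<gamma> t0 \<notin> W" using t0(1) unfolding B_def by blast+
  then have "a < t0" using aW by (metis atLeastAtMost_iff order_le_less)
  have before: "\<gamma> s \<in> W" if "s \<in> {a..<t0}" for s
  proof (rule ccontr)
    assume "\<gamma> s \<notin> W"
    moreover have "s \<in> {a..b}" using that t0ab by auto
    ultimately have "s \<in> B" unfolding B_def by blast
    from t0(2)[OF this] that show False by simp
  qed
  have inK: "\<gamma> s \<in> K" if s: "s \<in> {a..<t0}" for s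
  proof -
    have "norm (coord c (\<gamma> s) - coord c (\<gamma> a)) \<le> r / 2"
    proof (rule travel)
      show "s \<in> {a..b}" using s t0ab by auto
      show "\<gamma> q \<in> param c ` ball x r" if "q \<in> {a..s}" for q
        using before[of q] that s unfolding W_def by auto
    qed
    then have "coord c (\<gamma> s) \<in> cball u (r/2)" by (simp add: cu dist_norm norm_minus_commute)
    moreover
    have "\<gamma> s \<in> chart_dom c"
    proof -
      obtain z where "z \<in> ball x r" "\<gamma> s = param c z" using before[OF s] unfolding W_def by blast
      then show ?thesis using param_in[OF c, of z] bsub by (simp add: subset_iff)
    qed
    then have "\<gamma> s = param c (coord c (\<gamma> s))" by (simp add: param_coord[OF c])
    ultimately show ?thesis unfolding K_def by (rule image_eqI[rotated])
  qed
  have "closed ({a..t0} \<inter> \<gamma> -` K)"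
    by (rule continuous_closed_preimage[OF continuous_on_subset[OF cont]]) (use t0ab \<open>closed K\<close> in auto)
  moreover have "{a..<t0} \<subseteq> {a..t0} \<inter> \<gamma> -` K" using inK by (simp add: subset_iff)
  ultimately have "closure {a..<t0} \<subseteq> {a..t0} \<inter> \<gamma> -` K" by (rule closure_minimal[rotated])
  moreover have "t0 \<in> closure {a..<t0}" using \<open>a < t0\<close> by simp
  ultimately have "\<gamma> t0 \<in> K" by blast
  then have "\<gamma> t0 \<in> W" using Ksub unfolding K_def W_def by blast
  with t0ab show False by blast
qed

end

subsection \<open>The Finsler distance\<close>

context finsler
begin

text \<open>The velocity is two-sided, so the integrand does not mention the parameter interval and
  lengths of adjacent pieces simply add. At the finitely many break points its value is
  uncontrolled, which no integral notices.\<close>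

definition curve_speed :: "(real \<Rightarrow> 'm) \<Rightarrow> real \<Rightarrow> real" where
  "curve_speed \<gamma> t = F (\<gamma> t) (velocity A UNIV \<gamma> t)"

definition arc_length :: "(real \<Rightarrow> 'm) \<Rightarrow> real \<Rightarrow> real \<Rightarrow> real" where
  "arc_length \<gamma> a b = integral {a..b} (curve_speed \<gamma>)"

lemma velocity_interior:
  assumes "t \<in> interior S" shows "velocity A S \<gamma> t = velocity A UNIV \<gamma> t"
  by (simp only: velocity_def at_within_interior[OF assms])

lemma at_within_Icc_neq_bot: "a < b \<Longrightarrow> t \<in> {a..b} \<Longrightarrow> at t within {a..b::real} \<noteq> bot"
  using islimpt_Icc trivial_limit_within by blast

text \<open>With one-sided derivatives at the ends the speed is continuous on the closed piece;
  \<open>curve_speed\<close> differs from it at most at the two end points.\<close>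

lemma smooth_piece:
  assumes ab: "a < b" and g: "C_curve k A {a..b} \<gamma>" and k: "1 \<le> k"
  shows "continuous_on {a..b} (\<lambda>t. F (\<gamma> t) (velocity A {a..b} \<gamma> t))"
    and "t \<in> {a..b} \<Longrightarrow> 0 \<le> F (\<gamma> t) (velocity A {a..b} \<gamma> t)"
    and "curve_speed \<gamma> integrable_on {a..b}"
    and "arc_length \<gamma> a b = integral {a..b} (\<lambda>t. F (\<gamma> t) (velocity A {a..b} \<gamma> t))"
proof -
  let ?\<sigma> = "\<lambda>t. F (\<gamma> t) (velocity A {a..b} \<gamma> t)"
  have loc1: "0 \<le> ?\<sigma> t \<and> continuous (at t within {a..b}) ?\<sigma>" if t: "t \<in> {a..b}" for t
  proof -
    obtain c where c: "c \<in> A" "\<gamma> t \<in> chart_dom c" using chart_exists by blast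
    obtain I w where I: "open I" "t \<in> I" "continuous_on (I \<inter> {a..b}) w"
      "\<And>s. s \<in> I \<Longrightarrow> s \<in> {a..b} \<Longrightarrow> \<gamma> s \<in> chart_dom c"
      "\<And>s. s \<in> I \<Longrightarrow> s \<in> {a..b} \<Longrightarrow> velocity A {a..b} \<gamma> s = tvec_of A c (\<gamma> s) (w s)"
      using C_curve_velocity[OF g k t c at_within_Icc_neq_bot[OF ab]] by metis
    have e: "?\<sigma> s = loc c (coord c (\<gamma> s)) (w s)" if "s \<in> I \<inter> {a..b}" for s
      using I(4,5)[of s] that F_tvec_of[OF c(1)] by simp
    have sub: "I \<inter> {a..b} \<subseteq> {a..b}" by blast
    have "continuous_on (I \<inter> {a..b}) (\<lambda>s. coord c (\<gamma> s))"
      by (rule continuous_on_compose2[OF continuous_coord[OF c(1)]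
            continuous_on_subset[OF C_curve_continuous[OF g] sub]]) (use I(4) in auto)
    then have "continuous_on (I \<inter> {a..b}) (\<lambda>s. loc c (coord c (\<gamma> s)) (w s))"
      by (intro continuous_on_compose2[OF loc_cont[OF c(1)]] continuous_intros I(3)) (use I(4) in auto)
    then have "continuous_on (I \<inter> {a..b}) ?\<sigma>"
      by (rule continuous_on_eq) (simp add: e)
    then have "continuous (at t within I \<inter> {a..b}) ?\<sigma>"
      using t I(2) continuous_on_eq_continuous_within by blast
    moreover have "at t within I \<inter> {a..b} = at t within {a..b}"
      by (rule at_within_nhd[OF I(2,1)]) blast
    moreover have "0 \<le> ?\<sigma> t" using e[of t] t I(2) c loc_nonneg[OF c(1)] by simp
    ultimately show ?thesis by (simp add: continuous_within)
  qed
  show cont: "continuous_on {a..b} ?\<sigma>"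
    using loc1 continuous_on_eq_continuous_within by blast
  show "t \<in> {a..b} \<Longrightarrow> 0 \<le> ?\<sigma> t" using loc1 by blast
  have int: "?\<sigma> integrable_on {a..b}" by (rule integrable_continuous_real[OF cont])
  have eq: "curve_speed \<gamma> t = ?\<sigma> t" if "t \<in> {a..b} - {a, b}" for t
  proof -
    have "t \<in> interior {a..b}" using that by auto
    from velocity_interior[OF this, of \<gamma>] show ?thesis by (simp add: curve_speed_def)
  qed
  show "curve_speed \<gamma> integrable_on {a..b}"
    by (rule integrable_spike_finite[OF _ _ int, of "{a, b}"]) (use eq in auto)
  show "arc_length \<gamma> a b = integral {a..b} ?\<sigma>"
    unfolding arc_length_def by (rule integral_spike[of "{a, b}"]) (use eq in auto)
qed

lemma curve_speed_integrable: "pw_smooth \<gamma> a b \<Longrightarrow> curve_speed \<gamma> integrable_on {a..b}"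
proof (induction rule: pw_smooth.induct)
  case (base a b)
  then show ?case using smooth_piece(3) by simp
next
  case (step a b c)
  have "curve_speed \<gamma> integrable_on {b..c}" using step smooth_piece(3) by simp
  with step pw_smooth_less[OF step(1)] show ?case
    using Henstock_Kurzweil_Integration.integrable_combine[where c = b and f = "curve_speed \<gamma>" and a = a and b = c]
    by linarith
qed

lemma arc_length_combine:
  assumes "pw_smooth \<gamma> a b" "pw_smooth \<gamma> b c"
  shows "arc_length \<gamma> a c = arc_length \<gamma> a b + arc_length \<gamma> b c"
  unfolding arc_length_def
  using Henstock_Kurzweil_Integration.integral_combine[where c = b and f = "curve_speed \<gamma>" and a = a and b = c]
    curve_speed_integrable[OF pw_smooth_join[OF assms(2,1)]]
    pw_smooth_less[OF assms(1)] pw_smooth_less[OF assms(2)] by linarith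

lemma arc_length_nonneg: "pw_smooth \<gamma> a b \<Longrightarrow> 0 \<le> arc_length \<gamma> a b"
proof (induction rule: pw_smooth.induct)
  case (base a b)
  then show ?case
    using smooth_piece(4)[of a b \<infinity> \<gamma>] smooth_piece(2)[of a b \<infinity> \<gamma>] integral_nonneg[OF integrable_continuous_real[OF smooth_piece(1)[of a b \<infinity> \<gamma>]]]
    by simp
next
  case (step a b c)
  have p: "pw_smooth \<gamma> b c" using step pw_smooth.base by blast
  have "0 \<le> arc_length \<gamma> b c"
    using smooth_piece(4)[of b c \<infinity> \<gamma>] smooth_piece(2)[of b c \<infinity> \<gamma>] integral_nonneg[OF integrable_continuous_real[OF smooth_piece(1)[of b c \<infinity> \<gamma>]]] step
    by simp
  then show ?case using arc_length_combine[OF step(1) p] step by simp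
qed

lemma finsler_length_eq: "finsler_length A F \<gamma> = arc_length \<gamma> 0 1"
  unfolding finsler_length_def arc_length_def
proof (rule integral_spike[of "{0, 1}"])
  fix t :: real assume "t \<in> {0..1} - {0, 1}"
  then have "t \<in> interior {0..1}" by auto
  from velocity_interior[OF this, of \<gamma>]
  show "curve_speed \<gamma> t = F (\<gamma> t) (velocity A {0..1} \<gamma> t)" by (simp add: curve_speed_def)
qed simp

text \<open>Two-sided velocities see points outside \<open>{a..b}\<close>, so they are compared only
  in the open interval.\<close>

lemma arc_length_cong:
  assumes "\<And>t. t \<in> {a..b} \<Longrightarrow> \<gamma> t = \<gamma>' t"
  shows "arc_length \<gamma> a b = arc_length \<gamma>' a b"
  unfolding arc_length_def
proof (rule integral_spike[of "{a, b}"])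
  fix t assume t: "t \<in> {a..b} - {a, b}"
  then have ev: "\<forall>\<^sub>F s in nhds t. s \<in> UNIV \<longrightarrow> (coord c \<circ> \<gamma>') s = (coord c \<circ> \<gamma>) s" for c :: "('m,'n) chart"
    unfolding eventually_nhds
    by (intro exI[of _ "{a<..<b}"]) (use assms in auto)
  have "vector_derivative (coord c \<circ> \<gamma>') (at t) = vector_derivative (coord c \<circ> \<gamma>) (at t)" for c :: "('m,'n) chart"
    by (rule vector_derivative_cong_eq[OF ev]) auto
  moreover have "\<gamma> t = \<gamma>' t" using assms t by auto
  ultimately show "curve_speed \<gamma>' t = curve_speed \<gamma> t"
    by (simp only: curve_speed_def velocity_def)
qed simp

lemma smooth_piece_velocity:
  assumes g: "C_curve k A {a..b} \<gamma>" "1 \<le> k" and t: "t \<in> {a<..<b}" and c: "c \<in> A" "\<gamma> t \<in> chart_dom c"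
  obtains w where "((coord c \<circ> \<gamma>) has_vector_derivative w) (at t)" "continuous (at t) \<gamma>"
    "velocity A UNIV \<gamma> t = tvec_of A c (\<gamma> t) w"
proof -
  have ab: "a < b" and tt: "t \<in> {a..b}" and int: "t \<in> interior {a..b}" using t by auto
  obtain I w where I: "t \<in> I"
    "\<And>s. s \<in> I \<Longrightarrow> s \<in> {a..b} \<Longrightarrow> ((coord c \<circ> \<gamma>) has_vector_derivative w s) (at s within {a..b})"
    "\<And>s. s \<in> I \<Longrightarrow> s \<in> {a..b} \<Longrightarrow> velocity A {a..b} \<gamma> s = tvec_of A c (\<gamma> s) (w s)"
    using C_curve_velocity[OF g tt c at_within_Icc_neq_bot[OF ab]] by metis
  have e: "at t within {a..b} = at t" by (rule at_within_interior[OF int])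
  show ?thesis
  proof (rule that[of "w t"])
    show "((coord c \<circ> \<gamma>) has_vector_derivative w t) (at t)" using I(2)[OF I(1) tt] e by simp
    show "continuous (at t) \<gamma>"
      using C_curve_continuous[OF g(1)] tt e unfolding continuous_on_eq_continuous_within by metis
    show "velocity A UNIV \<gamma> t = tvec_of A c (\<gamma> t) (w t)"
      using I(3)[OF I(1) tt] velocity_interior[OF int] by simp
  qed
qed

text \<open>Substitution contributes \<open>1 / m\<close> and homogeneity of \<open>F\<close>
  contributes \<open>m\<close>. The sign of \<open>m\<close> matters: \<open>F\<close> is
  homogeneous only for nonnegative factors.\<close>

lemma arc_length_affine_piece:
  assumes m: "m > 0" and ab: "a < b" and g: "C_curve \<infinity> A {a..b} \<gamma>"
  shows "arc_length (\<lambda>t. \<gamma> (\<beta> + t * m)) ((a - \<beta>) / m) ((b - \<beta>) / m) = arc_length \<gamma> a b"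
proof -
  let ?\<gamma> = "\<lambda>t. \<gamma> (\<beta> + t * m)" and ?a = "(a - \<beta>) / m" and ?b = "(b - \<beta>) / m"
  have sp: "curve_speed ?\<gamma> t = m * curve_speed \<gamma> (\<beta> + t * m)" if t: "t \<in> {?a..?b} - {?a, ?b}" for t
  proof -
    have "?a < t" "t < ?b" using t by auto
    then have s: "\<beta> + t * m \<in> {a<..<b}" using m by (simp add: field_simps)
    obtain c where c: "c \<in> A" "\<gamma> (\<beta> + t * m) \<in> chart_dom c" using chart_exists by blast
    obtain w where w: "((coord c \<circ> \<gamma>) has_vector_derivative w) (at (\<beta> + t * m))"
      "continuous (at (\<beta> + t * m)) \<gamma>" "velocity A UNIV \<gamma> (\<beta> + t * m) = tvec_of A c (\<gamma> (\<beta> + t * m)) w"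
      by (rule smooth_piece_velocity[OF g _ s c]) auto
    have "((\<lambda>t. \<beta> + t * m) has_real_derivative m) (at t)" by (auto intro!: derivative_eq_intros)
    from vector_diff_chain_at[OF this[unfolded has_real_derivative_iff_has_vector_derivative] w(1)]
    have d: "((coord c \<circ> ?\<gamma>) has_vector_derivative m *\<^sub>R w) (at t)" by (simp add: o_def)
    have ct: "continuous (at t) ?\<gamma>"
      using isCont_o2[of t "\<lambda>t. \<beta> + t * m" \<gamma>] w(2) by (simp add: continuous_intros)
    have "velocity A UNIV ?\<gamma> t = tvec_of A c (?\<gamma> t) (m *\<^sub>R w)"
      by (rule velocity_eq_tvec_of[of c ?\<gamma> t UNIV "m *\<^sub>R w"]) (use c ct d in auto)
    then show ?thesis
      using F_tvec_of[OF c] loc_scale[OF c(1), of "coord c (\<gamma> (\<beta> + t * m))" m w] c(2) m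
      by (simp add: curve_speed_def w(3))
  qed
  have "(curve_speed \<gamma> has_integral arc_length \<gamma> a b) (cbox a b)"
    unfolding arc_length_def using smooth_piece(3)[OF ab g] by (simp add: has_integral_integral)
  from has_integral_affinity'[OF this m, of \<beta>]
  have "((\<lambda>t. curve_speed \<gamma> (\<beta> + t * m)) has_integral arc_length \<gamma> a b / m) {?a..?b}"
    by (simp add: mult.commute add.commute divide_inverse)
  from has_integral_mult_right[OF this, of m]
  have "((\<lambda>t. m * curve_speed \<gamma> (\<beta> + t * m)) has_integral arc_length \<gamma> a b) {?a..?b}" using m by simp
  then have "(curve_speed ?\<gamma> has_integral arc_length \<gamma> a b) {?a..?b}"
    by (rule has_integral_spike_finite[rotated 2, of _ _ _ "{?a, ?b}"]) (use sp in auto)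
  then show ?thesis unfolding arc_length_def by (rule integral_unique)
qed

lemma arc_length_affine:
  assumes m: "m > 0"
  shows "pw_smooth \<gamma> a b \<Longrightarrow>
    arc_length (\<lambda>t. \<gamma> (\<beta> + t * m)) ((a - \<beta>) / m) ((b - \<beta>) / m) = arc_length \<gamma> a b"
proof (induction rule: pw_smooth.induct)
  case (base a b)
  then show ?case by (rule arc_length_affine_piece[OF m])
next
  case (step a b c)
  have p: "pw_smooth \<gamma> b c" by (rule pw_smooth.base[OF step(2,3)])
  show ?case
    using arc_length_combine[OF step(1) p]
      arc_length_combine[OF pw_smooth_affine[OF m step(1)] pw_smooth_affine[OF m p], of \<beta>]
      step(4) arc_length_affine_piece[OF m step(2,3)] by simp
qed

text \<open>Any parameter interval is allowed, so concatenation adds lengths directly;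
  \<open>joined_reparam\<close> returns to a prescribed interval.\<close>

definition joined :: "'m \<Rightarrow> 'm \<Rightarrow> real \<Rightarrow> bool" where
  "joined p q l \<longleftrightarrow> (\<exists>\<gamma> a b. pw_smooth \<gamma> a b \<and> \<gamma> a = p \<and> \<gamma> b = q \<and> arc_length \<gamma> a b = l)"

lemma joinedI: "pw_smooth \<gamma> a b \<Longrightarrow> \<gamma> a = p \<Longrightarrow> \<gamma> b = q \<Longrightarrow> arc_length \<gamma> a b = l \<Longrightarrow> joined p q l"
  unfolding joined_def by blast

lemma joined_nonneg: "joined p q l \<Longrightarrow> 0 \<le> l"
  using arc_length_nonneg unfolding joined_def by blast

lemma joined_reparam:
  assumes "joined p q l" "a' < b'"
  obtains \<gamma> where "pw_smooth \<gamma> a' b'" "\<gamma> a' = p" "\<gamma> b' = q" "arc_length \<gamma> a' b' = l"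
proof -
  obtain \<gamma> a b where g: "pw_smooth \<gamma> a b" "\<gamma> a = p" "\<gamma> b = q" "arc_length \<gamma> a b = l"
    using assms unfolding joined_def by blast
  have ab: "a < b" by (rule pw_smooth_less[OF g(1)])
  define m where "m = (b - a) / (b' - a')"
  define \<beta> where "\<beta> = a - a' * m"
  have m: "m > 0" using ab assms by (simp add: m_def)
  have mb: "m * (b' - a') = b - a" using assms by (simp add: m_def)
  have e: "(a - \<beta>) / m = a'" using m by (simp add: \<beta>_def)
  have "b - \<beta> = b' * m" using mb by (simp add: \<beta>_def algebra_simps)
  then have e': "(b - \<beta>) / m = b'" using m by simp
  show ?thesis
  proof (rule that)
    show "pw_smooth (\<lambda>t. \<gamma> (\<beta> + t * m)) a' b'" using pw_smooth_affine[OF m g(1), of \<beta>] e e' by simp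
    show "arc_length (\<lambda>t. \<gamma> (\<beta> + t * m)) a' b' = l"
      using arc_length_affine[OF m g(1), of \<beta>] e e' g(4) by simp
    show "\<gamma> (\<beta> + a' * m) = p" using g(2) by (simp add: \<beta>_def)
    show "\<gamma> (\<beta> + b' * m) = q" using g(3) \<open>b - \<beta> = b' * m\<close> by (simp flip: \<open>b - \<beta> = b' * m\<close>)
  qed
qed

lemma joined_trans:
  assumes "joined p q l" "joined q r l'"
  shows "joined p r (l + l')"
proof -
  obtain \<gamma>1 where 1: "pw_smooth \<gamma>1 0 1" "\<gamma>1 0 = p" "\<gamma>1 1 = q" "arc_length \<gamma>1 0 1 = l"
    using joined_reparam[OF assms(1) zero_less_one] by metis
  obtain \<gamma>2 where 2: "pw_smooth \<gamma>2 1 2" "\<gamma>2 1 = q" "\<gamma>2 2 = r" "arc_length \<gamma>2 1 2 = l'"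
    using joined_reparam[OF assms(2), of 1 2] by (metis one_less_numeral_iff semiring_norm(76))
  define \<gamma> where "\<gamma> t = (if t \<le> 1 then \<gamma>1 t else \<gamma>2 t)" for t :: real
  have e1: "\<gamma>1 t = \<gamma> t" if "t \<in> {0..1}" for t using that by (simp add: \<gamma>_def)
  have e2: "\<gamma>2 t = \<gamma> t" if "t \<in> {1..2}" for t using that 1(3) 2(2) by (cases "t = 1") (simp_all add: \<gamma>_def)
  have p1: "pw_smooth \<gamma> 0 1" by (rule pw_smooth_cong[OF 1(1) e1])
  have p2: "pw_smooth \<gamma> 1 2" by (rule pw_smooth_cong[OF 2(1) e2])
  show ?thesis
  proof (rule joinedI[OF pw_smooth_join[OF p2 p1]])
    show "arc_length \<gamma> 0 2 = l + l'"
      using arc_length_combine[OF p1 p2] arc_length_cong[OF e1] arc_length_cong[OF e2] 1(4) 2(4) by simp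
  qed (use 1 2 in \<open>auto simp: \<gamma>_def\<close>)
qed

text \<open>The curve is the straight segment in the chart. Its coordinate velocity is the constant
  \<open>v - u\<close>, so \<open>B\<close> bounds its speed; in other charts it is smooth as a
  transition map restricted to a line.\<close>

lemma joined_segment:
  assumes c: "c \<in> A" and sub: "closed_segment u v \<subseteq> chart_img c"
    and B: "\<And>w. w \<in> closed_segment u v \<Longrightarrow> loc c w (v - u) \<le> B"
  obtains l where "l \<le> B" "joined (param c u) (param c v) l"
proof -
  define f where "f t = u + t *\<^sub>R (v - u)" for t :: real
  define \<gamma> where "\<gamma> t = param c (f t)" for t
  have fs: "f t \<in> closed_segment u v" if "t \<in> {0..1}" for t
    using that unfolding closed_segment_def f_def by (auto intro!: exI[of _ t] simp: algebra_simps)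
  have fi: "f t \<in> chart_img c" if "t \<in> {0..1}" for t using fs[OF that] sub by blast
  have smooth: "C_curve \<infinity> A {0..1} \<gamma>"
    unfolding C_curve_def
  proof (intro ballI impI)
    fix t c' assume t: "t \<in> {0..1}" "c' \<in> A" "\<gamma> t \<in> chart_dom c'"
    let ?S = "coord c ` (chart_dom c \<inter> chart_dom c')"
    let ?I = "(\<lambda>t. u + t *\<^sub>R (v - u)) -` ?S"
    show "\<exists>I g. open I \<and> t \<in> I \<and> C_on \<infinity> I g \<and>
       (\<forall>s\<in>I \<inter> {0..1}. \<gamma> s \<in> chart_dom c' \<and> coord c' (\<gamma> s) = g s)"
    proof (intro exI conjI ballI)
      show "open ?I"
        by (rule open_vimage[OF open_overlap[OF c t(2)]]) (intro continuous_intros)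
      show "C_on \<infinity> ?I (\<lambda>t. transition c c' (u + t *\<^sub>R (v - u)))"
        by (rule C_on_affine[OF open_overlap[OF c t(2)] transition_smooth[OF c t(2)]])
      have "f t = coord c (\<gamma> t)" "\<gamma> t \<in> chart_dom c"
        using coord_param[OF c fi[OF t(1)]] param_in[OF c fi[OF t(1)]] by (simp_all add: \<gamma>_def)
      then have "f t \<in> ?S" using t(3) by blast
      then show "t \<in> ?I" by (simp add: f_def)
      fix s assume s: "s \<in> ?I \<inter> {0..1}"
      then obtain q where q: "f s = coord c q" "q \<in> chart_dom c" "q \<in> chart_dom c'"
        unfolding f_def by blast
      have gq: "\<gamma> s = q" using q param_coord[OF c, of q] by (simp add: \<gamma>_def)
      then show "\<gamma> s \<in> chart_dom c'" using q by simp
      show "coord c' (\<gamma> s) = transition c c' (u + s *\<^sub>R (v - u))"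
        using transition_coord[OF c q(2), of c'] q(1) gq by (simp add: f_def)
    qed
  qed
  have sp: "curve_speed \<gamma> t \<le> B" if t: "t \<in> {0<..<1}" for t
  proof -
    have tt: "t \<in> {0..1}" using t by auto
    have cd: "\<gamma> t \<in> chart_dom c" "coord c (\<gamma> t) = f t"
      using coord_param[OF c fi[OF tt]] param_in[OF c fi[OF tt]] by (simp_all add: \<gamma>_def)
    have "continuous_on {0<..<1} \<gamma>"
      by (rule continuous_on_subset[OF C_curve_continuous[OF smooth]]) auto
    then have ct: "continuous (at t) \<gamma>"
      using t by (simp add: continuous_on_eq_continuous_at)
    have "(f has_vector_derivative (v - u)) (at t)"
      unfolding f_def has_vector_derivative_def by (auto intro!: derivative_eq_intros)
    then have d: "((coord c \<circ> \<gamma>) has_vector_derivative (v - u)) (at t)"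
      unfolding has_vector_derivative_def
    proof (rule has_derivative_transform_within_open[of _ _ _ _ "{0<..<1}"])
      fix s :: real assume "s \<in> {0<..<1}"
      then have "s \<in> {0..1}" by auto
      from coord_param[OF c fi[OF this]] show "f s = (coord c \<circ> \<gamma>) s" by (simp add: \<gamma>_def)
    qed (use t in auto)
    have "velocity A UNIV \<gamma> t = tvec_of A c (\<gamma> t) (v - u)"
      by (rule velocity_eq_tvec_of[OF c cd(1) ct _ _ d]) auto
    then have "curve_speed \<gamma> t = loc c (f t) (v - u)"
      using F_tvec_of[OF c cd(1)] cd(2) by (simp add: curve_speed_def)
    then show ?thesis using B[OF fs[OF tt]] by simp
  qed
  have pw: "pw_smooth \<gamma> 0 1" by (rule pw_smooth.base[OF zero_less_one smooth])
  \<comment> \<open>At 0 and 1 the two-sided derivative depends on values outside the segment, so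
    the bound is imposed there by changing two values.\<close>
  let ?s = "\<lambda>t. if t \<in> {0, 1} then B else curve_speed \<gamma> t"
  have "arc_length \<gamma> 0 1 = integral {0..1} ?s"
    unfolding arc_length_def by (rule integral_spike[of "{0, 1}"]) auto
  also have "\<dots> \<le> integral {0..1::real} (\<lambda>_. B)"
  proof (rule Henstock_Kurzweil_Integration.integral_le)
    show "?s integrable_on {0..1}"
      by (rule integrable_spike_finite[OF _ _ curve_speed_integrable[OF pw], of "{0, 1}"]) auto
    show "?s t \<le> B" if "t \<in> {0..1}" for t using sp[of t] that by auto
  qed auto
  also have "\<dots> = B" by simp
  finally have le: "arc_length \<gamma> 0 1 \<le> B" .
  have "joined (param c u) (param c v) (arc_length \<gamma> 0 1)"
    by (rule joinedI[OF pw]) (simp_all add: \<gamma>_def f_def)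
  with le show ?thesis by (rule that)
qed

lemma joined_locally:
  assumes e: "e > 0"
  obtains U where "open U" "p \<in> U" "\<And>u v. u \<in> U \<Longrightarrow> v \<in> U \<Longrightarrow> \<exists>l<e. joined u v l"
proof -
  obtain c where c: "c \<in> A" "p \<in> chart_dom c" using chart_exists by blast
  define x where "x = coord c p"
  have "x \<in> chart_img c" using c x_def by blast
  then obtain r where r: "r > 0" "cball x r \<subseteq> chart_img c"
    using open_chart_img[OF c(1)] open_contains_cball by blast
  obtain m M where M: "M > 0" "\<And>z y. z \<in> cball x r \<Longrightarrow> loc c z y \<le> M * norm y"
    using loc_bounds[OF c(1) compact_cball r(2)] by metis
  \<comment> \<open>Two points of the ball of radius \<open>s\<close> are at most
    \<open>2 * s\<close> apart, so the chart segment between them has length at most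
    \<open>2 * M * s \<le> e / 2\<close>.\<close>
  define s where "s = min r (e / (4 * M))"
  have s: "s > 0" "s \<le> r" using r e M by (auto simp: s_def)
  have sM: "M * s \<le> e / 4"
  proof -
    have "M * s \<le> M * (e / (4 * M))" using M by (intro mult_left_mono) (auto simp: s_def)
    then show ?thesis using M by simp
  qed
  have sub: "ball x s \<subseteq> cball x r" using s by auto
  show ?thesis
  proof (rule that[of "param c ` ball x s"])
    show "open (param c ` ball x s)" by (rule open_param_image[OF c(1) open_ball]) (use sub r in blast)
    show "p \<in> param c ` ball x s"
      using s param_coord[OF c] by (intro image_eqI[of _ _ x]) (auto simp: x_def)
    fix u v assume "u \<in> param c ` ball x s" "v \<in> param c ` ball x s"
    then obtain a b where ab: "a \<in> ball x s" "b \<in> ball x s" "u = param c a" "v = param c b" by blast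
    have seg: "closed_segment a b \<subseteq> ball x s" using ab by (intro closed_segment_subset) auto
    have n: "norm (b - a) \<le> 2 * s"
      using ab(1,2) dist_triangle2[of a b x] by (simp add: dist_norm dist_commute norm_minus_commute)
    obtain l where l: "l \<le> M * norm (b - a)" "joined u v l" unfolding ab(3,4)
    proof (rule joined_segment[OF c(1), of a b "M * norm (b - a)"])
      show "closed_segment a b \<subseteq> chart_img c" using seg sub r by blast
      show "loc c w (b - a) \<le> M * norm (b - a)" if "w \<in> closed_segment a b" for w
        using M(2)[of w "b - a"] that seg sub by blast
    qed
    have "M * norm (b - a) \<le> M * (2 * s)" using n M by (intro mult_left_mono) auto
    then have "l < e" using l(1) sM e by simp
    with l(2) show "\<exists>l<e. joined u v l" by blast
  qed
qed

text \<open>The set of points reachable from \<open>p\<close> is open and closed in a connected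
  space. Since \<open>joined\<close> is oriented, the neighbourhoods used are joined in both
  directions: one serves openness of the set, the other openness of its complement.\<close>

lemma joined_exists: "\<exists>l. joined p q l"
proof -
  define S where "S = {q. \<exists>l. joined p q l}"
  have nb: "\<exists>U. open U \<and> z \<in> U \<and> (\<forall>u\<in>U. \<forall>v\<in>U. \<exists>l. joined u v l)" for z
    by (rule joined_locally[of 1 z]) (auto, metis)
  have "open S" unfolding open_subopen[of S]
  proof
    fix z assume z: "z \<in> S"
    obtain U where U: "open U" "z \<in> U" "\<forall>u\<in>U. \<forall>v\<in>U. \<exists>l. joined u v l" using nb by blast
    have "U \<subseteq> S" using z U joined_trans unfolding S_def by blast
    then show "\<exists>T. open T \<and> z \<in> T \<and> T \<subseteq> S" using U by blast
  qed
  moreover have "open (- S)" unfolding open_subopen[of "- S"]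
  proof
    fix z assume z: "z \<in> - S"
    obtain U where U: "open U" "z \<in> U" "\<forall>u\<in>U. \<forall>v\<in>U. \<exists>l. joined u v l" using nb by blast
    have "U \<subseteq> - S" using z U joined_trans unfolding S_def by blast
    then show "\<exists>T. open T \<and> z \<in> T \<and> T \<subseteq> - S" using U by blast
  qed
  moreover have "p \<in> S"
  proof -
    obtain U where U: "open U" "p \<in> U" "\<forall>u\<in>U. \<forall>v\<in>U. \<exists>l. joined u v l" using nb by blast
    then show ?thesis unfolding S_def by blast
  qed
  moreover have "connected (UNIV :: 'm set)" using finsler by (simp add: finsler_manifold_def)
  ultimately have "S = UNIV" using connectedD[of UNIV S "- S"] by auto
  then show ?thesis unfolding S_def by blast
qed

abbreviation "d \<equiv> finsler_dist A F"

lemma dist_eq_Inf: "d p q = Inf {l. joined p q l}"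
proof -
  have "finsler_length A F ` {\<gamma>. piecewise_smooth_curve A \<gamma> \<and> \<gamma> 0 = p \<and> \<gamma> 1 = q} = {l. joined p q l}"
  proof (intro equalityI subsetI)
    fix l assume "l \<in> {l. joined p q l}"
    then obtain \<gamma> where "pw_smooth \<gamma> 0 1" "\<gamma> 0 = p" "\<gamma> 1 = q" "arc_length \<gamma> 0 1 = l"
      using joined_reparam[OF _ zero_less_one] by blast
    then show "l \<in> finsler_length A F ` {\<gamma>. piecewise_smooth_curve A \<gamma> \<and> \<gamma> 0 = p \<and> \<gamma> 1 = q}"
      by (intro image_eqI[of _ _ \<gamma>]) (simp_all add: finsler_length_eq piecewise_smooth_curve_iff)
  next
    fix l assume "l \<in> finsler_length A F ` {\<gamma>. piecewise_smooth_curve A \<gamma> \<and> \<gamma> 0 = p \<and> \<gamma> 1 = q}"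
    then show "l \<in> {l. joined p q l}"
      unfolding joined_def by (force simp: finsler_length_eq piecewise_smooth_curve_iff)
  qed
  then show ?thesis by (simp add: finsler_dist_def)
qed

lemma joined_bdd: "bdd_below {l. joined p q l}"
  using joined_nonneg by (intro bdd_belowI[of _ 0]) simp

lemma dist_le: "joined p q l \<Longrightarrow> d p q \<le> l"
  unfolding dist_eq_Inf by (rule cInf_lower[OF _ joined_bdd]) simp

lemma dist_less: "d p q < e \<Longrightarrow> \<exists>l<e. joined p q l"
  unfolding dist_eq_Inf using cInf_less_iff[OF _ joined_bdd[of p q], of e] joined_exists by auto

lemma dist_nonneg: "0 \<le> d p q"
  unfolding dist_eq_Inf by (rule cInf_greatest) (use joined_exists joined_nonneg in auto)

lemma dist_triangle_ineq: "d p r \<le> d p q + d q r"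
proof (rule field_le_epsilon)
  fix e :: real assume e: "e > 0"
  obtain l where l: "l < d p q + e/2" "joined p q l" using dist_less[of p q "d p q + e/2"] e by auto
  obtain l' where l': "l' < d q r + e/2" "joined q r l'" using dist_less[of q r "d q r + e/2"] e by auto
  show "d p r \<le> d p q + d q r + e"
    using dist_le[OF joined_trans[OF l(2) l'(2)]] l(1) l'(1) by simp
qed

lemma dist_locally_small:
  assumes "e > 0"
  obtains U where "open U" "p \<in> U" "\<And>u v. u \<in> U \<Longrightarrow> v \<in> U \<Longrightarrow> d u v < e"
proof -
  obtain U where U: "open U" "p \<in> U" "\<And>u v. u \<in> U \<Longrightarrow> v \<in> U \<Longrightarrow> \<exists>l<e. joined u v l"
    using joined_locally[OF assms, of p] by metis
  have "d u v < e" if uv: "u \<in> U" "v \<in> U" for u v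
  proof -
    obtain l where "l < e" "joined u v l" using U(3)[OF uv] by blast
    then show ?thesis using dist_le by fastforce
  qed
  then show ?thesis using that[OF U(1,2)] by blast
qed

lemma dist_self: "d p p = 0"
proof (rule antisym[OF _ dist_nonneg])
  show "d p p \<le> 0"
  proof (rule field_le_epsilon)
    fix e :: real assume "e > 0"
    then obtain U where "open U" "p \<in> U" "\<And>u v. u \<in> U \<Longrightarrow> v \<in> U \<Longrightarrow> d u v < e"
      using dist_locally_small by metis
    then show "d p p \<le> 0 + e" by fastforce
  qed
qed

text \<open>An intermediate point on an almost shortest curve: the length of the initial part is
  continuous in its end time and takes every value between 0 and \<open>l\<close>.\<close>

lemma dist_split:
  assumes lt: "d p r < a + b" and ab: "a > 0" "b > 0"
  obtains q where "d p q < a" "d q r < b"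
proof -
  obtain l where l: "l < a + b" "joined p r l" using dist_less[OF lt] by blast
  consider "l < a" | "l < b" | "a \<le> l" "b \<le> l" by linarith
  then show ?thesis
  proof cases
    case 1
    then show ?thesis using that[of r] dist_le[OF l(2)] dist_self ab by simp
  next
    case 2
    then show ?thesis using that[of p] dist_le[OF l(2)] dist_self ab by simp
  next
    case 3
    obtain \<gamma> where g: "pw_smooth \<gamma> 0 1" "\<gamma> 0 = p" "\<gamma> 1 = r" "arc_length \<gamma> 0 1 = l"
      using joined_reparam[OF l(2) zero_less_one] by metis
    \<comment> \<open>Midpoint of \<open>l - b\<close> and \<open>a\<close>, so that the initial
      part is shorter than \<open>a\<close> and the rest shorter than \<open>b\<close>.\<close>
    define s where "s = (a + (l - b)) / 2"
    have s: "0 < s" "s < l" "s < a" "l - b < s" using 3 l ab by (auto simp: s_def)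
    have ends: "arc_length \<gamma> 0 0 = 0" "arc_length \<gamma> 0 1 = l" using g by (auto simp: arc_length_def)
    have cont: "continuous_on {0..1} (arc_length \<gamma> 0)"
      unfolding arc_length_def by (rule indefinite_integral_continuous_1[OF curve_speed_integrable[OF g(1)]])
    obtain t where t: "0 \<le> t" "t \<le> 1" "arc_length \<gamma> 0 t = s"
      using IVT'[of "arc_length \<gamma> 0" 0 s 1] ends s cont by auto
    have t01: "0 < t" "t < 1" using t ends s by (auto simp: order_le_less)
    have sp: "pw_smooth \<gamma> 0 t" "pw_smooth \<gamma> t 1" using pw_smooth_split[OF g(1) t01] by auto
    have len: "arc_length \<gamma> t 1 = l - s" using arc_length_combine[OF sp] t(3) ends by simp
    have "d p (\<gamma> t) \<le> s" by (rule dist_le, rule joinedI[OF sp(1)]) (use g t in auto)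
    moreover have "d (\<gamma> t) r \<le> l - s" by (rule dist_le, rule joinedI[OF sp(2)]) (use g len in auto)
    ultimately show ?thesis using that[of "\<gamma> t"] s by simp
  qed
qed

text \<open>The coordinate velocity is at most the speed divided by \<open>m\<close>, and it
  integrates to the displacement. Together with \<open>joined_segment\<close> this compares Finsler
  length with the chart norm from both sides.\<close>

lemma coord_displacement_piece:
  assumes c: "c \<in> A" and K: "K \<subseteq> chart_img c" and m: "m > 0" "\<And>x y. x \<in> K \<Longrightarrow> m * norm y \<le> loc c x y"
    and base: "a < b" "C_curve \<infinity> A {a..b} \<gamma>" "\<And>t. t \<in> {a..b} \<Longrightarrow> \<gamma> t \<in> param c ` K"
  shows "m * norm (coord c (\<gamma> b) - coord c (\<gamma> a)) \<le> arc_length \<gamma> a b"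
proof -
  have inK: "coord c (\<gamma> t) \<in> K" "\<gamma> t \<in> chart_dom c" if t: "t \<in> {a..b}" for t
  proof -
    obtain x where "x \<in> K" "\<gamma> t = param c x" using base(3)[OF t] by blast
    then show "coord c (\<gamma> t) \<in> K" "\<gamma> t \<in> chart_dom c"
      using coord_param[OF c, of x] param_in[OF c, of x] K by auto
  qed
  have one: "1 \<le> (\<infinity> :: enat)" by simp
  have "\<exists>w. ((coord c \<circ> \<gamma>) has_vector_derivative w) (at t within {a..b}) \<and>
      F (\<gamma> t) (velocity A {a..b} \<gamma> t) = loc c (coord c (\<gamma> t)) w" if t: "t \<in> {a..b}" for t
  proof -
    obtain I w where "t \<in> I"
      "\<And>s. s \<in> I \<Longrightarrow> s \<in> {a..b} \<Longrightarrow> ((coord c \<circ> \<gamma>) has_vector_derivative w s) (at s within {a..b})"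
      "\<And>s. s \<in> I \<Longrightarrow> s \<in> {a..b} \<Longrightarrow> velocity A {a..b} \<gamma> s = tvec_of A c (\<gamma> s) (w s)"
      using C_curve_velocity[OF base(2) one t c inK(2)[OF t] at_within_Icc_neq_bot[OF base(1)]] by metis
    then show ?thesis using t F_tvec_of[OF c inK(2)[OF t], of "w t"] by (intro exI[of _ "w t"]) simp
  qed
  then obtain w where w: "\<And>t. t \<in> {a..b} \<Longrightarrow> ((coord c \<circ> \<gamma>) has_vector_derivative w t) (at t within {a..b})"
      "\<And>t. t \<in> {a..b} \<Longrightarrow> F (\<gamma> t) (velocity A {a..b} \<gamma> t) = loc c (coord c (\<gamma> t)) (w t)"
    by metis
  let ?\<sigma> = "\<lambda>t. F (\<gamma> t) (velocity A {a..b} \<gamma> t)"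
  have hi: "(w has_integral (coord c \<circ> \<gamma>) b - (coord c \<circ> \<gamma>) a) {a..b}"
    by (rule fundamental_theorem_of_calculus[OF less_imp_le[OF base(1)] w(1)])
  have \<sigma>: "?\<sigma> integrable_on {a..b}"
    by (rule integrable_continuous_real[OF smooth_piece(1)[OF base(1,2)]]) simp
  have "norm (integral {a..b} w) \<le> integral {a..b} (\<lambda>t. ?\<sigma> t / m)"
  proof (rule integral_norm_bound_integral)
    show "w integrable_on {a..b}" using hi by blast
    show "(\<lambda>t. ?\<sigma> t / m) integrable_on {a..b}" using integrable_on_divide[OF \<sigma>] .
    fix t assume t: "t \<in> {a..b}"
    show "norm (w t) \<le> ?\<sigma> t / m"
      using m(2)[OF inK(1)[OF t], of "w t"] w(2)[OF t] m(1) by (simp add: field_simps)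
  qed
  also have "\<dots> = arc_length \<gamma> a b / m"
    using smooth_piece(4)[OF base(1,2)] by simp
  finally show ?thesis using integral_unique[OF hi] m(1) by (simp add: field_simps)
qed

lemma coord_displacement:
  assumes c: "c \<in> A" and K: "K \<subseteq> chart_img c" and m: "m > 0" "\<And>x y. x \<in> K \<Longrightarrow> m * norm y \<le> loc c x y"
  shows "pw_smooth \<gamma> a b \<Longrightarrow> (\<And>t. t \<in> {a..b} \<Longrightarrow> \<gamma> t \<in> param c ` K) \<Longrightarrow>
    m * norm (coord c (\<gamma> b) - coord c (\<gamma> a)) \<le> arc_length \<gamma> a b"
proof (induction rule: pw_smooth.induct)
  case (base a b)
  show ?case by (rule coord_displacement_piece[OF c K m base(1,2)]) (use base(3) in auto)
next
  case (step a b e)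
  have ab: "a < b" by (rule pw_smooth_less[OF step(1)])
  have p: "pw_smooth \<gamma> b e" by (rule pw_smooth.base[OF step(2,3)])
  have 1: "m * norm (coord c (\<gamma> b) - coord c (\<gamma> a)) \<le> arc_length \<gamma> a b"
    using step(4,5) step(2) by simp
  have 2: "m * norm (coord c (\<gamma> e) - coord c (\<gamma> b)) \<le> arc_length \<gamma> b e"
  proof (rule coord_displacement_piece[OF c K m(1) _ step(2,3)])
    show "\<gamma> t \<in> param c ` K" if "t \<in> {b..e}" for t by (rule step(5)) (use ab that in auto)
  qed (rule m(2))
  have "norm (coord c (\<gamma> e) - coord c (\<gamma> a)) \<le>
      norm (coord c (\<gamma> e) - coord c (\<gamma> b)) + norm (coord c (\<gamma> b) - coord c (\<gamma> a))"
    using norm_triangle_ineq[of "coord c (\<gamma> e) - coord c (\<gamma> b)" "coord c (\<gamma> b) - coord c (\<gamma> a)"] by simp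
  then have "m * norm (coord c (\<gamma> e) - coord c (\<gamma> a)) \<le>
      m * (norm (coord c (\<gamma> e) - coord c (\<gamma> b)) + norm (coord c (\<gamma> b) - coord c (\<gamma> a)))"
    using m(1) by (intro mult_left_mono) auto
  then show ?case using 1 2 arc_length_combine[OF step(1) p] by (simp add: distrib_left)
qed

end

subsection \<open>Forward balls are relatively compact\<close>

context finsler
begin

text \<open>Stated through a compact superset, which makes it monotone in the radius and lets
  finitely many compact sets be united.\<close>

definition rel_compact_ball :: "'m \<Rightarrow> real \<Rightarrow> bool" where
  "rel_compact_ball p r \<longleftrightarrow> (\<exists>K. compact K \<and> {z. d p z < r} \<subseteq> K)"

lemma rel_compact_ball_mono: "rel_compact_ball p r \<Longrightarrow> s \<le> r \<Longrightarrow> rel_compact_ball p s"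
  unfolding rel_compact_ball_def by (force simp: subset_iff)

text \<open>A curve from \<open>u\<close> shorter than \<open>m * (R/2)\<close> moves its
  coordinates by at most \<open>R/2\<close> as long as it stays in the chart ball, so by
  \<open>no_exit\<close> it never leaves. The radius is uniform near \<open>z\<close>: in the
  completeness argument the centres only converge to \<open>z\<close>.\<close>

lemma rel_compact_ball_local:
  obtains U r where "open U" "z \<in> U" "r > 0" "\<And>u. u \<in> U \<Longrightarrow> rel_compact_ball u r"
proof -
  obtain c where c: "c \<in> A" "z \<in> chart_dom c" using chart_exists by blast
  define x where "x = coord c z"
  have "x \<in> chart_img c" using c x_def by blast
  then obtain R where R: "R > 0" "cball x R \<subseteq> chart_img c"
    using open_chart_img[OF c(1)] open_contains_cball by blast
  obtain m where m: "m > 0" "\<And>w y. w \<in> cball x R \<Longrightarrow> m * norm y \<le> loc c w y"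
  proof (rule loc_bounds[OF c(1) compact_cball R(2)])
    fix m M assume "m > 0" "\<And>w y. w \<in> cball x R \<Longrightarrow> m * norm y \<le> loc c w y"
    then show thesis by (rule that)
  qed
  have bs: "ball x R \<subseteq> chart_img c" "ball x (R/2) \<subseteq> chart_img c"
    using R by (auto simp: subset_iff)
  have m': "\<And>w y. w \<in> ball x R \<Longrightarrow> m * norm y \<le> loc c w y" using m(2) by simp
  show ?thesis
  proof (rule that[of "param c ` ball x (R/2)" "m * (R/2)"])
    show "open (param c ` ball x (R/2))" by (rule open_param_image[OF c(1) open_ball bs(2)])
    show "z \<in> param c ` ball x (R/2)"
      using R param_coord[OF c] by (intro image_eqI[of _ _ x]) (auto simp: x_def)
    show "m * (R/2) > 0" using m R by simp
    fix u assume u: "u \<in> param c ` ball x (R/2)"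
    have "q \<in> param c ` cball x R" if dq: "d u q < m * (R/2)" for q
    proof -
      obtain l where l: "l < m * (R/2)" "joined u q l" using dist_less[OF dq] by blast
      obtain \<gamma> where g: "pw_smooth \<gamma> 0 1" "\<gamma> 0 = u" "\<gamma> 1 = q" "arc_length \<gamma> 0 1 = l"
        using joined_reparam[OF l(2) zero_less_one] by metis
      have "\<gamma> 1 \<in> param c ` ball x R"
      proof (rule no_exit[OF c(1) R(2) pw_smooth_continuous[OF g(1)]])
        show "\<gamma> 0 \<in> param c ` ball x (R/2)" using u g by simp
        fix t :: real assume t: "t \<in> {0..1}" and stay: "\<And>s. s \<in> {0..t} \<Longrightarrow> \<gamma> s \<in> param c ` ball x R"
        show "norm (coord c (\<gamma> t) - coord c (\<gamma> 0)) \<le> R / 2"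
        proof (cases "t = 0")
          case False
          then have t0: "t > 0" using t by simp
          have pt: "pw_smooth \<gamma> 0 t \<and> arc_length \<gamma> 0 t \<le> l"
          proof (cases "t = 1")
            case True then show ?thesis using g by simp
          next
            case False
            then have sp: "pw_smooth \<gamma> 0 t" "pw_smooth \<gamma> t 1"
              using pw_smooth_split[OF g(1) t0] t by auto
            then show ?thesis using arc_length_combine[OF sp] arc_length_nonneg[OF sp(2)] g(4) by simp
          qed
          have "m * norm (coord c (\<gamma> t) - coord c (\<gamma> 0)) \<le> arc_length \<gamma> 0 t"
          proof (rule coord_displacement[where K = "ball x R" and \<gamma> = \<gamma> and a = 0 and b = t, OF c(1) bs(1) m(1)])
            show "pw_smooth \<gamma> 0 t" using pt by blast
            show "\<gamma> s \<in> param c ` ball x R" if "s \<in> {0..t}" for s by (rule stay[OF that])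
          qed (rule m')
          then have "m * norm (coord c (\<gamma> t) - coord c (\<gamma> 0)) \<le> m * (R/2)" using pt l by linarith
          then show ?thesis using m(1) by simp
        qed (use R in simp)
      qed auto
      then show ?thesis using g(3) ball_subset_cball by blast
    qed
    moreover have "compact (param c ` cball x R)"
      by (rule compact_continuous_image[OF continuous_on_subset[OF continuous_param[OF c(1)] R(2)]]) simp
    ultimately show "rel_compact_ball u (m * (R/2))" unfolding rel_compact_ball_def by blast
  qed
qed

text \<open>If the ball of radius \<open>a\<close> is relatively compact but the ball of radius \<open>a + r/4\<close> is not, then
  by covering the former with finitely many small sets one of the balls of radius \<open>r/2\<close> around
  its points is not relatively compact.\<close>

lemma rel_compact_ball_halve:
  assumes "\<not> rel_compact_ball p r" "r > 0"
  shows "\<exists>q. d p q \<le> r \<and> \<not> rel_compact_ball q (r / 2)"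
proof (rule ccontr)
  assume "\<nexists>q. d p q \<le> r \<and> \<not> rel_compact_ball q (r / 2)"
  then have all: "\<And>q. d p q \<le> r \<Longrightarrow> rel_compact_ball q (r / 2)" by blast
  define e where "e = r / 4"
  have e: "e > 0" "r = 4 * e" using assms by (simp_all add: e_def)
  have step: "rel_compact_ball p (a + e)" if a: "a > 0" "a \<le> r" "rel_compact_ball p a" for a
  proof -
    obtain K where K: "compact K" "{z. d p z < a} \<subseteq> K" using a(3) unfolding rel_compact_ball_def by blast
    define C where "C = {U. open U \<and> (\<forall>u\<in>U. \<forall>v\<in>U. d u v < e)}"
    have "K \<subseteq> \<Union>C"
    proof
      fix x assume "x \<in> K"
      obtain U where "open U" "x \<in> U" "\<And>u v. u \<in> U \<Longrightarrow> v \<in> U \<Longrightarrow> d u v < e"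
        using dist_locally_small[OF e(1), of x] by metis
      then show "x \<in> \<Union>C" unfolding C_def by blast
    qed
    moreover have "\<And>U. U \<in> C \<Longrightarrow> open U" by (simp add: C_def)
    ultimately obtain D where D: "D \<subseteq> C" "finite D" "K \<subseteq> \<Union>D"
      using compactE[OF K(1)] by metis
    \<comment> \<open>Only cover sets that meet the ball are kept, because compactness is assumed
      just for balls around centres within distance \<open>r\<close> of \<open>p\<close>.\<close>
    define D' where "D' = {U \<in> D. \<exists>q\<in>U. d p q < a}"
    have "\<exists>L. compact L \<and> (\<forall>z. (\<exists>x\<in>U. d x z < e) \<longrightarrow> z \<in> L)" if U: "U \<in> D'" for U
    proof -
      obtain q where q: "q \<in> U" "d p q < a" using U unfolding D'_def by blast
      obtain L where L: "compact L" "{z. d q z < r/2} \<subseteq> L"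
        using all[of q] q a unfolding rel_compact_ball_def by force
      have "z \<in> L" if "x \<in> U" "d x z < e" for x z
      proof -
        have "d q x < e" using U q(1) that(1) D(1) unfolding D'_def C_def by blast
        then have "d q z < r / 2" using dist_triangle_ineq[of q z x] that(2) e by simp
        then show ?thesis using L by blast
      qed
      then show ?thesis using L(1) by blast
    qed
    then obtain L where L: "\<And>U. U \<in> D' \<Longrightarrow> compact (L U)"
        "\<And>U z x. U \<in> D' \<Longrightarrow> x \<in> U \<Longrightarrow> d x z < e \<Longrightarrow> z \<in> L U"
      by metis
    have "compact (\<Union>U\<in>D'. L U)" by (rule compact_UN) (use L D in \<open>auto simp: D'_def\<close>)
    moreover have "{z. d p z < a + e} \<subseteq> (\<Union>U\<in>D'. L U)"
    proof
      fix z assume "z \<in> {z. d p z < a + e}"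
      then have "d p z < a + e" by simp
      then obtain x where x: "d p x < a" "d x z < e" using dist_split a(1) e(1) by metis
      then obtain U where "U \<in> D" "x \<in> U" using K D by blast
      then have "U \<in> D'" using x unfolding D'_def by blast
      then show "z \<in> (\<Union>U\<in>D'. L U)" using L(2)[OF _ \<open>x \<in> U\<close> x(2)] by blast
    qed
    ultimately show ?thesis unfolding rel_compact_ball_def by blast
  qed
  \<comment> \<open>The centre \<open>p\<close> itself provides the initial radius
    \<open>r / 2 = 2 * e\<close>; two steps of size \<open>e\<close> reach \<open>r\<close>.\<close>
  have "rel_compact_ball p (2 * e)" using all[of p] dist_self[of p] e by simp
  then have "rel_compact_ball p (2 * e + e)" by (rule step[rotated 2]) (use e in auto)
  then have "rel_compact_ball p (2 * e + e + e)" by (rule step[rotated 2]) (use e in auto)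
  then show False using assms e by simp
qed

text \<open>Repeated halving yields centres \<open>x n\<close> whose balls of radius
  \<open>r / 2 ^ n\<close> are not relatively compact, with consecutive distances at most
  \<open>r / 2 ^ n\<close>. The geometric steps make the sequence forward Cauchy, and near its limit
  small balls are relatively compact.\<close>

theorem forward_complete_rel_compact_ball:
  assumes complete: "forward_complete A F"
  shows "rel_compact_ball p r"
proof (rule ccontr)
  assume n: "\<not> rel_compact_ball p r"
  have r: "r > 0"
  proof (rule ccontr)
    assume "\<not> r > 0"
    then have "{z. d p z < r} = {}" using dist_nonneg[of p] by (auto simp: not_less intro: order_trans)
    then show False using n unfolding rel_compact_ball_def by (metis compact_empty order_refl)
  qed
  have "\<exists>x. \<forall>n. \<not> rel_compact_ball (x n) (r / 2 ^ n) \<and> d (x n) (x (Suc n)) \<le> r / 2 ^ n"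
  proof (rule dependent_nat_choice)
    show "\<exists>x. \<not> rel_compact_ball x (r / 2 ^ 0)" using n by auto
    fix x n assume "\<not> rel_compact_ball x (r / 2 ^ n)"
    from rel_compact_ball_halve[OF this] r
    show "\<exists>y. \<not> rel_compact_ball y (r / 2 ^ Suc n) \<and> d x y \<le> r / 2 ^ n"
      by (auto simp: mult.commute)
  qed
  then obtain x where x: "\<And>n. \<not> rel_compact_ball (x n) (r / 2 ^ n)"
    "\<And>n. d (x n) (x (Suc n)) \<le> r / 2 ^ n" by blast
  \<comment> \<open>The subtracted term is kept so that the induction telescopes.\<close>
  have tail: "d (x m) (x (m + k)) \<le> 2 * r / 2 ^ m - 2 * r / 2 ^ (m + k)" for m k
  proof (induction k)
    case 0 show ?case by (simp add: dist_self)
  next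
    case (Suc k)
    have "d (x m) (x (m + Suc k)) \<le> d (x m) (x (m + k)) + d (x (m + k)) (x (Suc (m + k)))"
      using dist_triangle_ineq[of "x m" "x (Suc (m + k))" "x (m + k)"] by simp
    also have "\<dots> \<le> (2 * r / 2 ^ m - 2 * r / 2 ^ (m + k)) + r / 2 ^ (m + k)"
      by (intro add_mono Suc x(2))
    also have "\<dots> = 2 * r / 2 ^ m - 2 * r / 2 ^ (m + Suc k)" by (simp add: field_simps)
    finally show ?case .
  qed
  have small: "\<exists>N. \<forall>n\<ge>N. 2 * r / 2 ^ n < \<epsilon>" if "\<epsilon> > 0" for \<epsilon>
  proof -
    have "(\<lambda>n. 2 * r * (1/2) ^ n) \<longlonglongrightarrow> 2 * r * 0"
      by (intro tendsto_intros LIMSEQ_power_zero) simp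
    then have "\<forall>\<^sub>F n in sequentially. 2 * r * (1/2) ^ n < \<epsilon>"
      using order_tendstoD(2)[of _ "2 * r * 0" _ \<epsilon>] that by simp
    then obtain N where N: "\<And>n. n \<ge> N \<Longrightarrow> 2 * r * (1/2) ^ n < \<epsilon>"
      unfolding eventually_sequentially by blast
    have "2 * r / 2 ^ n < \<epsilon>" if "n \<ge> N" for n
      using N[OF that] by (simp add: power_one_over)
    then show ?thesis by blast
  qed
  have "forward_Cauchy A F x" unfolding forward_Cauchy_def
  proof (intro allI impI)
    fix \<epsilon> :: real assume "\<epsilon> > 0"
    then obtain N where N: "\<And>n. n \<ge> N \<Longrightarrow> 2 * r / 2 ^ n < \<epsilon>" using small by blast
    show "\<exists>N. \<forall>m n. m \<le> n \<and> N < m \<longrightarrow> d (x m) (x n) < \<epsilon>"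
    proof (intro exI[of _ N] allI impI)
      fix m n assume mn: "m \<le> n \<and> N < m"
      have "d (x m) (x n) \<le> 2 * r / 2 ^ m - 2 * r / 2 ^ n" using tail[of m "n - m"] mn by simp
      also have "\<dots> \<le> 2 * r / 2 ^ m" using r by simp
      also have "\<dots> < \<epsilon>" using N[of m] mn by simp
      finally show "d (x m) (x n) < \<epsilon>" .
    qed
  qed
  then obtain l where l: "x \<longlonglongrightarrow> l" using complete unfolding forward_complete_def by blast
  obtain U s where U: "open U" "l \<in> U" "s > 0" "\<And>u. u \<in> U \<Longrightarrow> rel_compact_ball u s"
    using rel_compact_ball_local by metis
  have "\<forall>\<^sub>F n in sequentially. x n \<in> U" using l U topological_tendstoD by blast
  moreover obtain N where N: "\<And>n. n \<ge> N \<Longrightarrow> 2 * r / 2 ^ n < s" using small[OF U(3)] by blast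
  then have "\<forall>\<^sub>F n in sequentially. 2 * r / 2 ^ n < s" unfolding eventually_sequentially by blast
  ultimately have "\<forall>\<^sub>F n in sequentially. x n \<in> U \<and> 2 * r / 2 ^ n < s" by (rule eventually_conj)
  then obtain n where n: "x n \<in> U" "2 * r / 2 ^ n < s"
    unfolding eventually_sequentially by blast
  have "r / 2 ^ n \<le> 2 * r / 2 ^ n" by (rule divide_right_mono) (use r in auto)
  then have "r / 2 ^ n \<le> s" using n(2) by linarith
  then show False using x(1)[of n] rel_compact_ball_mono[OF U(4)[OF n(1)]] by blast
qed

end

subsection \<open>Chords of differentiable curves\<close>

text \<open>Differentiability at the single point \<open>t\<close> controls increments over all
  short intervals that contain \<open>t\<close>. These are the intervals that a bisection argument
  produces.\<close>

lemma straddle: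
  fixes f :: "real \<Rightarrow> 'a::real_normed_vector"
  assumes f: "(f has_vector_derivative w) (at t within S)" and e: "e > 0"
  obtains \<delta> where "\<delta> > 0" "\<And>a b. a \<in> S \<Longrightarrow> b \<in> S \<Longrightarrow> a \<le> t \<Longrightarrow> t \<le> b \<Longrightarrow> b - a < \<delta> \<Longrightarrow>
      norm (f b - f a - (b - a) *\<^sub>R w) \<le> e * (b - a)"
proof -
  obtain \<delta> where \<delta>: "\<delta> > 0" "\<And>s. s \<in> S \<Longrightarrow> norm (s - t) < \<delta> \<Longrightarrow>
      norm (f s - f t - (s - t) *\<^sub>R w) \<le> e * norm (s - t)"
    using f e unfolding has_vector_derivative_def has_derivative_within_alt by blast
  show ?thesis
  proof (rule that[OF \<delta>(1)])
    fix a b assume ab: "a \<in> S" "b \<in> S" "a \<le> t" "t \<le> b" "b - a < \<delta>"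
    have 1: "norm (f b - f t - (b - t) *\<^sub>R w) \<le> e * (b - t)" using \<delta>(2)[OF ab(2)] ab by simp
    have 2: "norm (f a - f t - (a - t) *\<^sub>R w) \<le> e * (t - a)" using \<delta>(2)[OF ab(1)] ab by simp
    have "norm (f b - f a - (b - a) *\<^sub>R w) =
        norm ((f b - f t - (b - t) *\<^sub>R w) - (f a - f t - (a - t) *\<^sub>R w))"
      by (simp add: algebra_simps)
    also have "\<dots> \<le> e * (b - t) + e * (t - a)"
      by (rule order_trans[OF norm_triangle_ineq4 add_mono[OF 1 2]])
    finally show "norm (f b - f a - (b - a) *\<^sub>R w) \<le> e * (b - a)" by (simp add: algebra_simps)
  qed
qed

context finsler
begin

text \<open>The distance is bounded by the length of the chart segment between two curve points near
  \<open>t\<close>. Its base points are close to \<open>\<xi> t\<close> and its slope is close to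
  \<open>w\<close>, so continuity of \<open>F\<close> in both arguments makes its speed nearly
  \<open>F\<close> of the velocity.\<close>

lemma chord_dist:
  assumes c: "c \<in> A" "\<xi> t \<in> chart_dom c" and f: "((coord c \<circ> \<xi>) has_vector_derivative w) (at t within S)"
    and ct: "continuous (at t within S) \<xi>" "t \<in> S" and e: "e > 0"
  obtains \<delta> where "\<delta> > 0" "\<And>a b. a \<in> S \<Longrightarrow> b \<in> S \<Longrightarrow> a \<le> t \<Longrightarrow> t \<le> b \<Longrightarrow> b - a < \<delta> \<Longrightarrow>
      d (\<xi> a) (\<xi> b) \<le> (b - a) * (loc c (coord c (\<xi> t)) w + e)"
proof -
  define x where "x = coord c (\<xi> t)"
  have xi: "x \<in> chart_img c" using c x_def by blast
  have opn: "open (chart_img c \<times> (UNIV :: (real^'n) set))" by (intro open_Times open_chart_img c open_UNIV)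
  have "isCont (local_rep A F c) (x, w)"
    using loc_cont[OF c(1)] xi unfolding continuous_on_eq_continuous_at[OF opn] by blast
  then have "(local_rep A F c \<longlongrightarrow> loc c x w) (nhds (x, w))"
    by (simp add: isCont_def tendsto_at_iff_tendsto_nhds)
  then have "\<forall>\<^sub>F q in nhds (x, w). local_rep A F c q < loc c x w + e"
    by (rule order_tendstoD) (use e in simp)
  then obtain V where V: "open V" "(x, w) \<in> V" "\<And>q. q \<in> V \<Longrightarrow> local_rep A F c q < loc c x w + e"
    unfolding eventually_nhds by blast
  have oV: "open (V \<inter> (chart_img c \<times> UNIV))" "(x, w) \<in> V \<inter> (chart_img c \<times> UNIV)"
    using V opn xi by auto
  obtain V1 V2 where V12: "open V1" "x \<in> V1" "open V2" "w \<in> V2" "V1 \<times> V2 \<subseteq> V \<inter> (chart_img c \<times> UNIV)"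
    using open_prod_elim[OF oV] by (metis mem_Sigma_iff)
  obtain \<rho>1 where \<rho>1: "\<rho>1 > 0" "ball x \<rho>1 \<subseteq> V1" using V12 open_contains_ball by blast
  obtain \<rho>2 where \<rho>2: "\<rho>2 > 0" "cball w \<rho>2 \<subseteq> V2" using V12 open_contains_cball by blast
  obtain \<delta>1 where \<delta>1: "\<delta>1 > 0" "\<And>a b. a \<in> S \<Longrightarrow> b \<in> S \<Longrightarrow> a \<le> t \<Longrightarrow> t \<le> b \<Longrightarrow> b - a < \<delta>1 \<Longrightarrow>
      norm ((coord c \<circ> \<xi>) b - (coord c \<circ> \<xi>) a - (b - a) *\<^sub>R w) \<le> \<rho>2 * (b - a)"
    using straddle[OF f \<rho>2(1)] by metis
  have bsub: "ball x \<rho>1 \<subseteq> chart_img c" using \<rho>1 V12 by blast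
  define Q where "Q = param c ` ball x \<rho>1"
  have "open Q" unfolding Q_def by (rule open_param_image[OF c(1) open_ball bsub])
  moreover have "\<xi> t \<in> Q"
    unfolding Q_def using \<rho>1 param_coord[OF c] by (intro image_eqI[of _ _ x]) (auto simp: x_def)
  ultimately have "\<forall>\<^sub>F s in at t within S. \<xi> s \<in> Q"
    using ct(1) unfolding continuous_within by (rule topological_tendstoD[rotated])
  then obtain \<delta>2 where \<delta>2: "\<delta>2 > 0" "\<And>s. s \<in> S \<Longrightarrow> s \<noteq> t \<Longrightarrow> dist s t < \<delta>2 \<Longrightarrow> \<xi> s \<in> Q"
    unfolding eventually_at by blast
  have inQ: "\<xi> s \<in> Q" if "s \<in> S" "\<bar>s - t\<bar> < \<delta>2" for s
    using \<delta>2(2)[OF that(1)] that(2) \<open>\<xi> t \<in> Q\<close> by (cases "s = t") (auto simp: dist_real_def)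
  have Q: "coord c q \<in> ball x \<rho>1 \<and> param c (coord c q) = q" if q: "q \<in> Q" for q
  proof -
    obtain y where "y \<in> ball x \<rho>1" "q = param c y" using q unfolding Q_def by blast
    then show ?thesis using coord_param[OF c(1), of y] bsub by (simp add: subset_iff)
  qed
  show ?thesis
  proof (rule that[of "min \<delta>1 \<delta>2"])
    show "min \<delta>1 \<delta>2 > 0" using \<delta>1 \<delta>2 by simp
    fix a b assume ab: "a \<in> S" "b \<in> S" "a \<le> t" "t \<le> b" "b - a < min \<delta>1 \<delta>2"
    show "d (\<xi> a) (\<xi> b) \<le> (b - a) * (loc c (coord c (\<xi> t)) w + e)"
    proof (cases "a = b")
      case True
      then show ?thesis by (simp add: dist_self)
    next
      case False
      then have lt: "a < b" using ab by simp
      define u where "u = coord c (\<xi> a)"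
      define v where "v = coord c (\<xi> b)"
      have qa: "u \<in> ball x \<rho>1" "param c u = \<xi> a" using Q[OF inQ[OF ab(1)]] ab by (auto simp: u_def)
      have qb: "v \<in> ball x \<rho>1" "param c v = \<xi> b" using Q[OF inQ[OF ab(2)]] ab by (auto simp: v_def)
      have seg: "closed_segment u v \<subseteq> ball x \<rho>1" using qa qb by (intro closed_segment_subset) auto
      \<comment> \<open>Secant slope of the curve; \<open>straddle\<close> puts it within
        \<open>\<rho>2\<close> of \<open>w\<close>.\<close>
      define y where "y = (1 / (b - a)) *\<^sub>R (v - u)"
      have vy: "v - u = (b - a) *\<^sub>R y" using lt by (simp add: y_def)
      have "norm ((b - a) *\<^sub>R (y - w)) \<le> \<rho>2 * (b - a)"
        using \<delta>1(2)[OF ab(1-4)] ab(5) vy by (simp add: u_def v_def scaleR_diff_right)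
      then have "y \<in> cball w \<rho>2" using lt by (simp add: dist_norm norm_minus_commute mult.commute)
      then have yV: "y \<in> V2" using \<rho>2 by blast
      have chord: "loc c z (v - u) \<le> (b - a) * (loc c x w + e)" if z: "z \<in> closed_segment u v" for z
      proof -
        have zV: "z \<in> V1" and zi: "z \<in> chart_img c" using z seg \<rho>1 bsub by blast+
        have "loc c z y < loc c x w + e" using V(3)[of "(z, y)"] zV yV V12(5) by blast
        then show ?thesis
          using loc_scale[OF c(1) zi, of "b - a" y] lt unfolding vy by (simp add: mult_left_mono)
      qed
      obtain l where "l \<le> (b - a) * (loc c x w + e)" "joined (param c u) (param c v) l"
      proof (rule joined_segment[OF c(1), of u v "(b - a) * (loc c x w + e)"])
        show "closed_segment u v \<subseteq> chart_img c" using seg bsub by blast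
        show "loc c z (v - u) \<le> (b - a) * (loc c x w + e)" if "z \<in> closed_segment u v" for z
          by (rule chord[OF that])
      qed
      then show ?thesis using dist_le[of "\<xi> a" "\<xi> b" l] qa qb by (simp add: x_def)
    qed
  qed
qed

end

subsection \<open>Integral curves of the descent field\<close>

text \<open>The fundamental theorem tolerates one exceptional point, so \<open>f\<close> is an
  integral of the continuous \<open>W\<close> across \<open>t0\<close>. It supplies the derivative
  at the junction when integral curves are glued.\<close>

lemma has_vector_derivative_removable:
  fixes f :: "real \<Rightarrow> 'a::euclidean_space"
  assumes ab: "a < t0" "t0 < b" and cont: "continuous_on {a..b} f" "continuous_on {a..b} W"
    and d: "\<And>t. t \<in> {a<..<b} \<Longrightarrow> t \<noteq> t0 \<Longrightarrow> (f has_vector_derivative W t) (at t)"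
  shows "(f has_vector_derivative W t0) (at t0)"
proof -
  have ftc: "(W has_integral f s - f a) {a..s}" if s: "s \<in> {a..b}" for s
  proof (rule fundamental_theorem_of_calculus_interior_strong[of "{t0}"])
    show "continuous_on {a..s} f" by (rule continuous_on_subset[OF cont(1)]) (use s in auto)
    show "(f has_vector_derivative W x) (at x)" if "x \<in> {a<..<s} - {t0}" for x
      by (rule d) (use that s in auto)
  qed (use s in auto)
  have 1: "((\<lambda>s. f a + integral {a..s} W) has_vector_derivative W t0) (at t0 within {a..b})"
    using integral_has_vector_derivative[OF cont(2), of t0] ab by (auto intro!: derivative_eq_intros)
  have int: "t0 \<in> interior {a..b}" using ab by simp
  have "((\<lambda>s. f a + integral {a..s} W) has_derivative (\<lambda>h. h *\<^sub>R W t0)) (at t0)"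
    using 1 at_within_interior[OF int] by (simp add: has_vector_derivative_def)
  then have "(f has_derivative (\<lambda>h. h *\<^sub>R W t0)) (at t0)"
  proof (rule has_derivative_transform_within_open[of _ _ _ _ "{a<..<b}"])
    fix s assume "s \<in> {a<..<b}"
    then have "s \<in> {a..b}" by auto
    from integral_unique[OF ftc[OF this]] show "f a + integral {a..s} W = f s" by simp
  qed (use ab in auto)
  then show ?thesis by (simp add: has_vector_derivative_def)
qed

lemma time_interval_iff: "t \<in> time_interval T \<longleftrightarrow> 0 \<le> t \<and> ereal t < T"
  by (simp add: time_interval_def)

lemma open_ereal_less: "open {s. ereal s < T}"
  by (intro open_Collect_less continuous_intros)

text \<open>Replaces a filter that depends on \<open>T\<close> by a common one, so that curves on
  different intervals satisfy literally the same differential condition.\<close>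

lemma at_within_time_interval:
  assumes "t \<in> time_interval T" shows "at t within time_interval T = at t within {0..}"
proof (rule at_within_nhd[of _ "{s. ereal s < T}"])
  show "t \<in> {s. ereal s < T}" using assms by (simp add: time_interval_iff)
  show "open {s. ereal s < T}" by (rule open_ereal_less)
  show "time_interval T \<inter> {s. ereal s < T} - {t} = {0..} \<inter> {s. ereal s < T} - {t}"
    by (auto simp: time_interval_iff)
qed

lemma at_within_Ici_neq_bot:
  assumes "0 \<le> t" shows "at t within {0..} \<noteq> (bot :: real filter)"
proof -
  have "t islimpt {t..t+1}" using islimpt_Icc[of t "t+1" t] by simp
  then have "t islimpt {0..}" by (rule islimpt_subset) (use assms in auto)
  then show ?thesis by (simp add: trivial_limit_within)
qed

context gradient_flow
begin

lemma phi_curve_deriv: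
  assumes c: "c \<in> A" "\<xi> t \<in> chart_dom c" and f: "((coord c \<circ> \<xi>) has_vector_derivative w) (at t within S)"
    and ct: "continuous (at t within S) \<xi>" "t \<in> S"
  shows "((\<phi> \<circ> \<xi>) has_real_derivative - ddir c (coord c (\<xi> t)) w) (at t within S)"
proof -
  let ?x = "coord c (\<xi> t)"
  have xi: "?x \<in> chart_img c" using c by blast
  have 1: "((\<phi> \<circ> param c) \<circ> (coord c \<circ> \<xi>) has_derivative (\<lambda>v. - ddir c ?x v) \<circ> (\<lambda>h. h *\<^sub>R w)) (at t within S)"
  proof (rule diff_chain_within[OF f[unfolded has_vector_derivative_def]])
    show "((\<phi> \<circ> param c) has_derivative (\<lambda>v. - ddir c ?x v)) (at ((coord c \<circ> \<xi>) t) within (coord c \<circ> \<xi>) ` S)"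
      unfolding comp_def[of "coord c"] by (rule has_derivative_at_withinI[OF phi_deriv[OF c(1) xi]])
  qed
  have ev: "\<forall>\<^sub>F s in at t within S. ((\<phi> \<circ> param c) \<circ> (coord c \<circ> \<xi>)) s = (\<phi> \<circ> \<xi>) s"
  proof -
    have "\<forall>\<^sub>F s in at t within S. \<xi> s \<in> chart_dom c"
      by (rule topological_tendstoD[OF ct(1)[unfolded continuous_within] open_chart_dom[OF c(1)] c(2)])
    then show ?thesis by eventually_elim (simp add: param_coord[OF c(1)])
  qed
  have "((\<phi> \<circ> \<xi>) has_derivative (\<lambda>v. - ddir c ?x v) \<circ> (\<lambda>h. h *\<^sub>R w)) (at t within S)"
    by (rule has_derivative_transform_eventually[OF 1 ev]) (simp_all add: param_coord c ct)
  moreover have "(\<lambda>v. - ddir c ?x v) \<circ> (\<lambda>h. h *\<^sub>R w) = (*) (- ddir c ?x w)"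
    using linear_scale[OF ddir_linear[OF c(1) xi]] by auto
  ultimately show ?thesis by (simp add: has_field_derivative_def)
qed

text \<open>Within \<open>{0..}\<close> the derivative is one-sided at 0 and two-sided later,
  whatever the life span. Continuity is demanded separately because chart coordinates are arbitrary
  outside their domain.\<close>

definition integral_curve_at :: "(real \<Rightarrow> 'm) \<Rightarrow> real \<Rightarrow> bool" where
  "integral_curve_at \<xi> t \<longleftrightarrow> continuous (at t within {0..}) \<xi> \<and>
     (\<forall>c\<in>A. \<xi> t \<in> chart_dom c \<longrightarrow>
        ((coord c \<circ> \<xi>) has_vector_derivative descent_field (\<xi> t) c) (at t within {0..}))"

definition integral_curve :: "ereal \<Rightarrow> (real \<Rightarrow> 'm) \<Rightarrow> bool" where
  "integral_curve T \<xi> \<longleftrightarrow> (\<forall>t\<in>time_interval T. integral_curve_at \<xi> t)"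

lemma integral_curve_atD:
  assumes "integral_curve_at \<xi> t"
  shows "continuous (at t within {0..}) \<xi>"
    and "c \<in> A \<Longrightarrow> \<xi> t \<in> chart_dom c \<Longrightarrow>
      ((coord c \<circ> \<xi>) has_vector_derivative descent_field (\<xi> t) c) (at t within {0..})"
  using assms unfolding integral_curve_at_def by blast+

lemma integral_curve_atI:
  assumes ct: "continuous (at t within {0..}) \<xi>" "0 \<le> t" and c: "c \<in> A" "\<xi> t \<in> chart_dom c"
    and d: "((coord c \<circ> \<xi>) has_vector_derivative descent_field (\<xi> t) c) (at t within {0..})"
  shows "integral_curve_at \<xi> t"
  unfolding integral_curve_at_def
proof (intro conjI ballI impI)
  show "continuous (at t within {0..}) \<xi>" by fact
  fix c' assume c': "c' \<in> A" "\<xi> t \<in> chart_dom c'"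
  have "((coord c' \<circ> \<xi>) has_vector_derivative transD c c' (\<xi> t) (descent_field (\<xi> t) c)) (at t within {0..})"
    by (rule curve_deriv_change[OF c(1) c'(1) c(2) c'(2) d ct(1)]) (use ct in simp)
  then show "((coord c' \<circ> \<xi>) has_vector_derivative descent_field (\<xi> t) c') (at t within {0..})"
    using tangent_change[OF descent_field(1) c(1) c'(1) c(2) c'(2)] by simp
qed

lemma integral_curve_at_cong:
  assumes "integral_curve_at \<xi> t" "open I" "t \<in> I" "0 \<le> t"
    and eq: "\<And>s. s \<in> I \<Longrightarrow> 0 \<le> s \<Longrightarrow> \<xi>' s = \<xi> s"
  shows "integral_curve_at \<xi>' t"
proof -
  have ev: "\<forall>\<^sub>F s in at t within {0..}. \<xi> s = \<xi>' s"
    unfolding eventually_at_topological using assms by (intro exI[of _ I]) auto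
  have e: "\<xi>' t = \<xi> t" using eq assms by blast
  obtain c where c: "c \<in> A" "\<xi> t \<in> chart_dom c" using chart_exists by blast
  show ?thesis
  proof (rule integral_curve_atI[OF _ assms(4) c(1)])
    show "continuous (at t within {0..}) \<xi>'"
      using Lim_transform_eventually[OF integral_curve_atD(1)[OF assms(1), unfolded continuous_within] ev] e
      by (simp add: continuous_within)
    show "\<xi>' t \<in> chart_dom c" using c e by simp
    have ev2: "\<forall>\<^sub>F s in at t within {0..}. (coord c \<circ> \<xi>) s = (coord c \<circ> \<xi>') s"
      using ev by eventually_elim simp
    have "((coord c \<circ> \<xi>') has_vector_derivative descent_field (\<xi> t) c) (at t within {0..})"
      unfolding has_vector_derivative_def
      by (rule has_derivative_transform_eventually[OF
            integral_curve_atD(2)[OF assms(1) c, unfolded has_vector_derivative_def] ev2])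
         (use e assms(4) in auto)
    then show "((coord c \<circ> \<xi>') has_vector_derivative descent_field (\<xi>' t) c) (at t within {0..})"
      by (simp only: e)
  qed
qed

lemma integral_curve_velocity:
  assumes "integral_curve T \<xi>" "t \<in> time_interval T"
  shows "velocity A (time_interval T) \<xi> t = descent_field (\<xi> t)"
proof -
  obtain c where c: "c \<in> A" "\<xi> t \<in> chart_dom c" using chart_exists by blast
  have at: "integral_curve_at \<xi> t" using assms unfolding integral_curve_def by blast
  have t: "0 \<le> t" using assms(2) by (simp add: time_interval_iff)
  have "velocity A (time_interval T) \<xi> t = tvec_of A c (\<xi> t) (descent_field (\<xi> t) c)"
    by (rule velocity_eq_tvec_of[of c \<xi> t])
      (simp_all add: at_within_time_interval[OF assms(2)] c integral_curve_atD[OF at] assms at_within_Ici_neq_bot t)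
  then show ?thesis using tvec_of_tangent[OF descent_field(1) c] by simp
qed

lemma integral_curve_phi_deriv:
  assumes "integral_curve_at \<xi> t" "0 \<le> t"
  shows "((\<phi> \<circ> \<xi>) has_real_derivative
     - psi h (F (\<xi> t) (descent_field (\<xi> t))) - psi_star h (slope A F \<phi> (\<xi> t))) (at t within {0..})"
proof -
  obtain c where c: "c \<in> A" "\<xi> t \<in> chart_dom c" using chart_exists by blast
  have "((\<phi> \<circ> \<xi>) has_real_derivative - ddir c (coord c (\<xi> t)) (descent_field (\<xi> t) c)) (at t within {0..})"
    by (rule phi_curve_deriv[OF c integral_curve_atD(2)[OF assms(1) c] integral_curve_atD(1)[OF assms(1)]])
       (use assms in simp)
  moreover have "- ddir c (coord c (\<xi> t)) (descent_field (\<xi> t) c) =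
      - psi h (F (\<xi> t) (descent_field (\<xi> t))) - psi_star h (slope A F \<phi> (\<xi> t))"
    using desc_eq[OF c descent_field(1)] descent_field(2)[of "\<xi> t"] by simp
  ultimately show ?thesis by simp
qed

lemma integral_curve_continuous_on:
  assumes "integral_curve T \<xi>" "S \<subseteq> time_interval T" shows "continuous_on S \<xi>"
  unfolding continuous_on_eq_continuous_within
proof
  fix t assume t: "t \<in> S"
  have "continuous (at t within {0..}) \<xi>"
    using assms t integral_curve_atD(1) unfolding integral_curve_def by blast
  then show "continuous (at t within S) \<xi>"
    by (rule continuous_within_subset) (use assms(2) in \<open>auto simp: time_interval_iff\<close>)
qed

text \<open>\<open>C_curve\<close> asks for an extension across the closed end 0. The extension
  \<open>g\<close> runs straight on with the initial velocity, so its derivative \<open>W\<close> is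
  continuous.\<close>

lemma integral_curve_C_curve:
  assumes ic: "integral_curve T \<xi>"
  shows "C_curve 1 A (time_interval T) \<xi>"
  unfolding C_curve_def
proof (intro ballI impI)
  fix t c assume t: "t \<in> time_interval T" and c: "c \<in> A" "\<xi> t \<in> chart_dom c"
  have t0: "0 \<le> t" using t by (simp add: time_interval_iff)
  have at: "integral_curve_at \<xi> s" if "s \<in> time_interval T" for s
    using ic that unfolding integral_curve_def by blast
  have "\<forall>\<^sub>F s in at t within {0..}. \<xi> s \<in> chart_dom c"
    by (rule topological_tendstoD[OF integral_curve_atD(1)[OF at[OF t], unfolded continuous_within]
          open_chart_dom[OF c(1)] c(2)])
  then obtain V where V: "open V" "t \<in> V" "\<And>s. s \<in> V \<Longrightarrow> s \<noteq> t \<Longrightarrow> s \<in> {0..} \<Longrightarrow> \<xi> s \<in> chart_dom c"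
    unfolding eventually_at_topological by blast
  have "open (V \<inter> {s. ereal s < T})" "t \<in> V \<inter> {s. ereal s < T}"
    using V open_ereal_less t by (auto simp: time_interval_iff)
  then obtain e where e: "e > 0" "ball t e \<subseteq> V \<inter> {s. ereal s < T}"
    unfolding open_contains_ball by blast
  define I where "I = ball t e"
  have I: "open I" "t \<in> I" using e by (auto simp: I_def)
  have inI: "s \<in> time_interval T \<and> \<xi> s \<in> chart_dom c" if "s \<in> I" "0 \<le> s" for s
  proof -
    have "s \<in> V" "ereal s < T" using that e by (auto simp: I_def)
    then show ?thesis using V(3)[of s] that c by (cases "s = t") (auto simp: time_interval_iff)
  qed
  \<comment> \<open>A ball around \<open>t \<ge> 0\<close> that contains a negative number also
    contains 0.\<close>
  have pos: "max 0 s \<in> I" if "s \<in> I" for s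
    using that t0 unfolding I_def by (auto simp: dist_real_def max_def)
  define W where "W s = descent_field (\<xi> (max 0 s)) c" for s
  define g where "g s = (if 0 \<le> s then coord c (\<xi> s) else coord c (\<xi> 0) + s *\<^sub>R descent_field (\<xi> 0) c)" for s
  have gd: "(g has_vector_derivative W s) (at s)" if s: "s \<in> I" for s
  proof -
    have right: "(g has_vector_derivative W s) (at s within {0..})" if "0 \<le> s"
    proof -
      have "((coord c \<circ> \<xi>) has_vector_derivative descent_field (\<xi> s) c) (at s within {0..})"
        using integral_curve_atD(2)[OF at c(1), of s] inI[OF s that] by blast
      then have "(g has_vector_derivative descent_field (\<xi> s) c) (at s within {0..})"
        unfolding has_vector_derivative_def
        by (rule has_derivative_transform[rotated 2]) (use that in \<open>auto simp: g_def\<close>)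
      then show ?thesis using that by (simp add: W_def max_def)
    qed
    have left: "(g has_vector_derivative W s) (at s within {..0})" if "s \<le> 0"
    proof -
      have "((\<lambda>s. coord c (\<xi> 0) + s *\<^sub>R descent_field (\<xi> 0) c) has_vector_derivative descent_field (\<xi> 0) c) (at s within {..0})"
        unfolding has_vector_derivative_def by (auto intro!: derivative_eq_intros)
      then have "(g has_vector_derivative descent_field (\<xi> 0) c) (at s within {..0})"
        unfolding has_vector_derivative_def
        by (rule has_derivative_transform[rotated 2]) (use that in \<open>auto simp: g_def\<close>)
      then show ?thesis using that by (cases "s = 0") (simp_all add: W_def max_def)
    qed
    consider "s > 0" | "s < 0" | "s = 0" by linarith
    then show ?thesis
    proof cases
      case 1
      then have "s \<in> interior {0..}" by simp
      then show ?thesis using right 1 at_within_interior[of s "{0..}"] by simp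
    next
      case 2
      then have "s \<in> interior {..0}" by simp
      then show ?thesis using left 2 at_within_interior[of s "{..0}"] by simp
    next
      case 3
      then have "(g has_vector_derivative W s) (at s within {0..} \<union> {..0})"
        using left right unfolding has_vector_derivative_def has_derivative_within by (simp add: at_within_union filterlim_sup)
      moreover have "{0..} \<union> {..0::real} = UNIV" by auto
      ultimately show ?thesis by simp
    qed
  qed
  have contW: "continuous_on I W"
  proof -
    have sub: "(\<lambda>s. max 0 s) ` I \<subseteq> I \<inter> {0..}" using pos by auto
    have "continuous_on (I \<inter> {0..}) \<xi>"
      by (rule integral_curve_continuous_on[OF ic]) (use inI in auto)
    then have "continuous_on (I \<inter> {0..}) (\<lambda>s. descent_field (\<xi> s) c)"
      by (rule continuous_on_compose2[OF field_cont[OF c(1)]]) (use inI in auto)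
    then show ?thesis unfolding W_def
      by (rule continuous_on_compose2[OF _ _ sub]) (intro continuous_intros)
  qed
  show "\<exists>I g. open I \<and> t \<in> I \<and> C_on 1 I g \<and>
     (\<forall>s\<in>I \<inter> time_interval T. \<xi> s \<in> chart_dom c \<and> coord c (\<xi> s) = g s)"
  proof (intro exI conjI ballI)
    show "C_on 1 I g" by (rule C_on_1_vector_derivative[OF I(1) gd contW])
    fix s assume s: "s \<in> I \<inter> time_interval T"
    then show "\<xi> s \<in> chart_dom c" "coord c (\<xi> s) = g s"
      using inI[of s] by (auto simp: time_interval_iff g_def)
  qed (use I in auto)
qed

lemma integral_curve_solution:
  assumes ic: "integral_curve T \<xi>" and "0 < T" "\<xi> 0 = x0"
  shows "gradient_flow_solution A F \<phi> h x0 T \<xi>"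
  unfolding gradient_flow_solution_def
proof (intro conjI AE_I2 impI)
  fix t :: real assume t: "0 < t \<and> ereal t < T"
  then have tt: "t \<in> time_interval T" by (simp add: time_interval_iff)
  have at: "integral_curve_at \<xi> t" using ic tt unfolding integral_curve_def by blast
  have "t \<in> interior {0..}" using t by simp
  from at_within_interior[OF this] integral_curve_phi_deriv[OF at] t
  show "((\<phi> \<circ> \<xi>) has_real_derivative - psi h (speed A F T \<xi> t) - psi_star h (slope A F \<phi> (\<xi> t))) (at t)"
    by (simp add: integral_curve_velocity[OF ic tt])
qed (use assms integral_curve_C_curve in auto)

text \<open>Where the flow equation holds, the velocity attains equality in the dual inequality, and
  \<open>field_unique\<close> identifies it with the field. A discrepancy at \<open>t\<close> would
  by continuity persist on some \<open>{t<..<t+e}\<close>, a set of positive measure on which the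
  equation fails; an interval to the right works at \<open>t = 0\<close> too.\<close>

lemma solution_integral_curve:
  assumes sol: "gradient_flow_solution A F \<phi> h x0 T \<xi>"
  shows "integral_curve T \<xi>"
  unfolding integral_curve_def
proof
  fix t assume t: "t \<in> time_interval T"
  let ?S = "time_interval T"
  have cc: "C_curve 1 A ?S \<xi>" using sol unfolding gradient_flow_solution_def by blast
  have ae: "AE s in lborel. 0 < s \<and> ereal s < T \<longrightarrow> ((\<phi> \<circ> \<xi>) has_real_derivative
           - psi h (speed A F T \<xi> s) - psi_star h (slope A F \<phi> (\<xi> s))) (at s)"
    using sol unfolding gradient_flow_solution_def by blast
  have nt: "at s within ?S \<noteq> bot" if "s \<in> ?S" for s
    using at_within_time_interval[OF that] at_within_Ici_neq_bot[of s] that by (simp add: time_interval_iff)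
  obtain c where c: "c \<in> A" "\<xi> t \<in> chart_dom c" using chart_exists by blast
  obtain I w where I: "open I" "t \<in> I" "continuous_on (I \<inter> ?S) w"
    "\<And>s. s \<in> I \<Longrightarrow> s \<in> ?S \<Longrightarrow> \<xi> s \<in> chart_dom c"
    "\<And>s. s \<in> I \<Longrightarrow> s \<in> ?S \<Longrightarrow> ((coord c \<circ> \<xi>) has_vector_derivative w s) (at s within ?S)"
    "\<And>s. s \<in> I \<Longrightarrow> s \<in> ?S \<Longrightarrow> velocity A ?S \<xi> s = tvec_of A c (\<xi> s) (w s)"
    using C_curve_velocity[OF cc order_refl t c nt] by blast
  have ctS: "continuous (at s within ?S) \<xi>" if "s \<in> ?S" for s
    using C_curve_continuous[OF cc] that unfolding continuous_on_eq_continuous_within by blast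
  have key: "w s = descent_field (\<xi> s) c"
    if s: "s \<in> I" "0 < s" "ereal s < T" and
      d: "((\<phi> \<circ> \<xi>) has_real_derivative - psi h (speed A F T \<xi> s) - psi_star h (slope A F \<phi> (\<xi> s))) (at s)" for s
  proof -
    have sS: "s \<in> ?S" using s by (simp add: time_interval_iff)
    have cs: "\<xi> s \<in> chart_dom c" by (rule I(4)[OF s(1) sS])
    have "s \<in> interior {0..}" using s by simp
    then have at: "at s within ?S = at s"
      using at_within_time_interval[OF sS] at_within_interior by metis
    have "((\<phi> \<circ> \<xi>) has_real_derivative - ddir c (coord c (\<xi> s)) (w s)) (at s)"
      using phi_curve_deriv[OF c(1) cs I(5)[OF s(1) sS] ctS[OF sS] sS] at by simp
    from DERIV_unique[OF this d]
    have e: "ddir c (coord c (\<xi> s)) (w s) = psi h (speed A F T \<xi> s) + psi_star h (slope A F \<phi> (\<xi> s))" by simp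
    let ?X = "tvec_of A c (\<xi> s) (w s)"
    have X: "?X \<in> tangent_space A (\<xi> s)" by (rule tvec_of_in[OF c(1) cs])
    have "desc (\<xi> s) ?X - psi h (F (\<xi> s) ?X) = psi_star h (slope A F \<phi> (\<xi> s))"
      using e desc_eq[OF c(1) cs X] tvec_of_self[OF c(1) cs, of "w s"] I(6)[OF s(1) sS] by simp
    from field_unique[OF X this] show ?thesis using tvec_of_self[OF c(1) cs, of "w s"] by simp
  qed
  have wt: "w t = descent_field (\<xi> t) c"
  proof (rule ccontr)
    assume ne: "w t \<noteq> descent_field (\<xi> t) c"
    define D where "D s = w s - descent_field (\<xi> s) c" for s
    have sub: "I \<inter> ?S \<subseteq> ?S" by blast
    have "continuous_on (I \<inter> ?S) (\<lambda>s. descent_field (\<xi> s) c)"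
      by (rule continuous_on_compose2[OF field_cont[OF c(1)] continuous_on_subset[OF C_curve_continuous[OF cc] sub]])
         (use I(4) in auto)
    then have "continuous_on (I \<inter> ?S) D" unfolding D_def by (intro continuous_intros I(3))
    then have 1: "(D \<longlongrightarrow> D t) (at t within I \<inter> ?S)" using t I(2) unfolding continuous_on_def by blast
    have 2: "D t \<in> - {0}" using ne by (simp add: D_def)
    have "\<forall>\<^sub>F s in at t within I \<inter> ?S. D s \<in> - {0}"
      by (rule topological_tendstoD[OF 1 _ 2]) auto
    then obtain V where V: "open V" "t \<in> V" "\<And>s. s \<in> V \<Longrightarrow> s \<noteq> t \<Longrightarrow> s \<in> I \<inter> ?S \<Longrightarrow> D s \<noteq> 0"
      unfolding eventually_at_topological by auto
    have "open (V \<inter> I \<inter> {s. ereal s < T})" "t \<in> V \<inter> I \<inter> {s. ereal s < T}"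
      using V I t open_ereal_less by (auto simp: time_interval_iff)
    then obtain e where e: "e > 0" "ball t e \<subseteq> V \<inter> I \<inter> {s. ereal s < T}"
      unfolding open_contains_ball by blast
    have no: "\<not> (0 < s \<and> ereal s < T \<longrightarrow> ((\<phi> \<circ> \<xi>) has_real_derivative
           - psi h (speed A F T \<xi> s) - psi_star h (slope A F \<phi> (\<xi> s))) (at s))" if s: "s \<in> {t<..<t+e}" for s
    proof -
      have b: "s \<in> V" "s \<in> I" "ereal s < T" using s e(2) by (auto simp: dist_real_def subset_iff)
      have p: "0 < s" "s \<in> ?S" "s \<noteq> t" using s t b by (auto simp: time_interval_iff)
      then have "D s \<noteq> 0" using V(3) b by blast
      then show ?thesis using key[of s] b p by (auto simp: D_def)
    qed
    have "AE s in lborel. s \<notin> {t<..<t+e}" using ae by eventually_elim (use no in blast)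
    moreover have "{s. t < s \<and> s < t + e} = {t<..<t+e}" by auto
    ultimately have "emeasure lborel {t<..<t+e} = 0"
      using AE_iff_measurable[of "{t<..<t+e}" lborel "\<lambda>s. s \<notin> {t<..<t+e}"] by simp
    then show False using e(1) by simp
  qed
  show "integral_curve_at \<xi> t"
  proof (rule integral_curve_atI[of t \<xi> c])
    show "c \<in> A" "\<xi> t \<in> chart_dom c" by fact+
    show "continuous (at t within {0..}) \<xi>" using ctS[OF t] at_within_time_interval[OF t] by simp
    show "0 \<le> t" using t by (simp add: time_interval_iff)
    show "((coord c \<circ> \<xi>) has_vector_derivative descent_field (\<xi> t) c) (at t within {0..})"
      using I(5)[OF I(2) t] wt at_within_time_interval[OF t] by simp
  qed
qed

lemma integral_curve_exists:
  obtains \<delta> \<eta> where "\<delta> > 0" "integral_curve (ereal \<delta>) \<eta>" "\<eta> 0 = z"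
proof -
  obtain c where c: "c \<in> A" "z \<in> chart_dom c" using chart_exists by blast
  have x: "coord c z \<in> chart_img c" using c by blast
  obtain \<delta> y where y: "\<delta> > 0" "y 0 = coord c z" "\<And>t. t \<in> {0..\<delta>} \<Longrightarrow> y t \<in> chart_img c"
    "\<And>t. t \<in> {0..\<delta>} \<Longrightarrow> (y has_vector_derivative descent_field (param c (y t)) c) (at t within {0..\<delta>})"
    by (rule peano_local[OF open_chart_img[OF c(1)] field_cont_chart[OF c(1)] x]) blast
  define \<eta> where "\<eta> t = param c (y t)" for t
  have "integral_curve_at \<eta> t" if t: "t \<in> time_interval (ereal \<delta>)" for t
  proof -
    have tt: "0 \<le> t" "t < \<delta>" "t \<in> {0..\<delta>}" using t by (auto simp: time_interval_iff)
    have e: "at t within {0..\<delta>} = at t within {0..}"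
      by (rule at_within_nhd[of _ "{..<\<delta>}"]) (use tt in auto)
    have cy: "continuous_on {0..\<delta>} y"
      using y(4) has_vector_derivative_continuous unfolding continuous_on_eq_continuous_within by blast
    have "continuous_on {0..\<delta>} \<eta>" unfolding \<eta>_def
      by (rule continuous_on_compose2[OF continuous_param[OF c(1)] cy]) (use y(3) in auto)
    then have ct: "continuous (at t within {0..}) \<eta>"
      using tt(3) e unfolding continuous_on_eq_continuous_within by metis
    have dom: "\<eta> t \<in> chart_dom c" unfolding \<eta>_def by (rule param_in[OF c(1) y(3)[OF tt(3)]])
    have "((coord c \<circ> \<eta>) has_vector_derivative descent_field (\<eta> t) c) (at t within {0..\<delta>})"
      unfolding has_vector_derivative_def
    proof (rule has_derivative_transform[OF tt(3)])
      show "(coord c \<circ> \<eta>) s = y s" if "s \<in> {0..\<delta>}" for s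
        using coord_param[OF c(1) y(3)[OF that]] by (simp add: \<eta>_def)
      show "(y has_derivative (\<lambda>h. h *\<^sub>R descent_field (\<eta> t) c)) (at t within {0..\<delta>})"
        using y(4)[OF tt(3)] by (simp add: has_vector_derivative_def \<eta>_def)
    qed
    then show ?thesis using integral_curve_atI[OF ct tt(1) c(1) dom] e by simp
  qed
  then have "integral_curve (ereal \<delta>) \<eta>" unfolding integral_curve_def by blast
  moreover have "\<eta> 0 = z" using y(2) param_coord[OF c] by (simp add: \<eta>_def)
  ultimately show ?thesis using that y(1) by blast
qed

end

subsection \<open>Continuation of integral curves\<close>

context gradient_flow
begin

text \<open>An integral curve started at the limit \<open>z\<close> is appended. Only the time
  \<open>T\<close> is delicate: the limit from the left and continuity from the right match there,
  and \<open>has_vector_derivative_removable\<close> gives the derivative, since the field is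
  continuous along the glued curve.\<close>

lemma integral_curve_extend:
  assumes ic: "integral_curve (ereal T) \<xi>" and T: "T > 0" and lim: "(\<xi> \<longlongrightarrow> z) (at_left T)"
  obtains T' \<xi>' where "ereal T < T'" "integral_curve T' \<xi>'"
    "\<And>t. t \<in> time_interval (ereal T) \<Longrightarrow> \<xi>' t = \<xi> t"
proof -
  obtain \<delta> \<eta> where \<delta>: "\<delta> > 0" and \<eta>: "integral_curve (ereal \<delta>) \<eta>" "\<eta> 0 = z"
    using integral_curve_exists by blast
  define \<xi>' where "\<xi>' t = (if t < T then \<xi> t else \<eta> (t - T))" for t
  have \<eta>at: "integral_curve_at \<eta> s" if "0 \<le> s" "s < \<delta>" for s
    using \<eta>(1) that unfolding integral_curve_def by (simp add: time_interval_iff)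
  have before: "integral_curve_at \<xi>' t" if t: "0 \<le> t" "t < T" for t
  proof (rule integral_curve_at_cong[of \<xi> t "{..<T}"])
    show "integral_curve_at \<xi> t" using ic t unfolding integral_curve_def by (simp add: time_interval_iff)
  qed (use t in \<open>auto simp: \<xi>'_def\<close>)
  have shift: "((\<lambda>s. s - T) has_real_derivative 1) (at t)" for t
    by (auto intro!: derivative_eq_intros)
  have after: "integral_curve_at \<xi>' t" if t: "T < t" "t < T + \<delta>" for t
  proof (rule integral_curve_at_cong[of "\<lambda>s. \<eta> (s - T)" t "{T<..}"])
    have s: "0 \<le> t - T" "t - T < \<delta>" "t - T \<in> interior {0..}" and ti: "t \<in> interior {0..}" using t T by auto
    obtain c where c: "c \<in> A" "\<eta> (t - T) \<in> chart_dom c" using chart_exists by blast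
    have "continuous (at (t - T)) \<eta>"
      using integral_curve_atD(1)[OF \<eta>at[OF s(1,2)]] at_within_interior[OF s(3)] by simp
    then have ct: "continuous (at t) (\<lambda>s. \<eta> (s - T))"
      using isCont_o2[of t "\<lambda>s. s - T" \<eta>] by (simp add: continuous_intros)
    have "((coord c \<circ> \<eta>) has_vector_derivative descent_field (\<eta> (t - T)) c) (at (t - T))"
      using integral_curve_atD(2)[OF \<eta>at[OF s(1,2)] c] at_within_interior[OF s(3)] by simp
    from vector_diff_chain_at[OF shift[of t, unfolded has_real_derivative_iff_has_vector_derivative] this]
    have d: "((coord c \<circ> (\<lambda>s. \<eta> (s - T))) has_vector_derivative descent_field (\<eta> (t - T)) c) (at t)"
      by (simp add: o_def)
    show "integral_curve_at (\<lambda>s. \<eta> (s - T)) t"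
      by (rule integral_curve_atI[OF _ _ c(1)])
         (use ct d c t T at_within_interior[OF ti] in simp_all)
  qed (use t T in \<open>auto simp: \<xi>'_def\<close>)
  have \<xi>T: "\<xi>' T = z" by (simp add: \<xi>'_def \<eta>(2))
  have ctT: "continuous (at T) \<xi>'"
  proof -
    have "\<forall>\<^sub>F t in at_left T. \<xi> t = \<xi>' t"
      unfolding eventually_at_left_field by (intro exI[of _ "T - 1"]) (auto simp: \<xi>'_def)
    from Lim_transform_eventually[OF lim this] have L: "(\<xi>' \<longlongrightarrow> z) (at_left T)" .
    have "(\<eta> \<longlongrightarrow> \<eta> 0) (at 0 within {0..})"
      using integral_curve_atD(1)[OF \<eta>at[of 0]] \<delta> by (simp add: continuous_within)
    then have "(\<eta> \<longlongrightarrow> z) (at_right 0)"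
      using \<eta>(2) by (auto intro: filterlim_mono[OF _ order_refl at_le])
    moreover have "\<forall>\<^sub>F s in at_right 0. \<eta> s = \<xi>' (s + T)"
      unfolding eventually_at_right_field by (intro exI[of _ 1]) (auto simp: \<xi>'_def)
    ultimately have "((\<lambda>s. \<xi>' (s + T)) \<longlongrightarrow> z) (at_right 0)" by (rule Lim_transform_eventually)
    then have R: "(\<xi>' \<longlongrightarrow> z) (at_right T)" using filterlim_at_right_to_0[of \<xi>' "nhds z" T] by simp
    show ?thesis using filterlim_split_at[OF L R] \<xi>T by (simp add: isCont_def)
  qed
  have at: "integral_curve_at \<xi>' T"
  proof -
    obtain c where c: "c \<in> A" "\<xi>' T \<in> chart_dom c" using chart_exists by blast
    have "\<forall>\<^sub>F s in at T. \<xi>' s \<in> chart_dom c"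
      by (rule topological_tendstoD[OF ctT[unfolded isCont_def] open_chart_dom[OF c(1)] c(2)])
    then obtain e0 where e0: "e0 > 0" "\<And>s. s \<noteq> T \<Longrightarrow> dist s T < e0 \<Longrightarrow> \<xi>' s \<in> chart_dom c"
      unfolding eventually_at by auto
    \<comment> \<open>Small enough for the chart, for the life span of \<open>\<eta>\<close>, and
      for all times of the interval to be positive, so that derivatives within \<open>{0..}\<close>
      are two-sided.\<close>
    define e where "e = min (min e0 \<delta>) T / 2"
    have e: "e > 0" "e < e0" "e < \<delta>" "e < T" using e0 \<delta> T by (auto simp: e_def min_def)
    have dom: "\<xi>' s \<in> chart_dom c" if "s \<in> {T - e..T + e}" for s
      using e0(2)[of s] c(2) that e by (cases "s = T") (auto simp: dist_real_def)
    have ati: "at s within {0..} = at s" if "s \<in> {T - e..T + e}" for s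
    proof -
      have "s \<in> interior {0..}" using that e by simp
      then show ?thesis by (rule at_within_interior)
    qed
    have ic': "integral_curve_at \<xi>' s" if "s \<in> {T - e..T + e}" "s \<noteq> T" for s
      using before[of s] after[of s] that e by (cases "s < T") auto
    have "continuous_on {T - e..T + e} \<xi>'"
    proof (rule continuous_at_imp_continuous_on, rule ballI)
      fix s assume s: "s \<in> {T - e..T + e}"
      show "isCont \<xi>' s"
        using ctT integral_curve_atD(1)[OF ic'[OF s]] ati[OF s] by (cases "s = T") auto
    qed
    note cont = this
    have f: "continuous_on {T - e..T + e} (coord c \<circ> \<xi>')"
      unfolding o_def by (rule continuous_on_compose2[OF continuous_coord[OF c(1)] cont]) (use dom in auto)
    have W: "continuous_on {T - e..T + e} (\<lambda>s. descent_field (\<xi>' s) c)"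
      by (rule continuous_on_compose2[OF field_cont[OF c(1)] cont]) (use dom in auto)
    have "((coord c \<circ> \<xi>') has_vector_derivative descent_field (\<xi>' T) c) (at T)"
    proof (rule has_vector_derivative_removable[OF _ _ f W])
      fix s assume s: "s \<in> {T - e<..<T + e}" "s \<noteq> T"
      then have s': "s \<in> {T - e..T + e}" by auto
      show "((coord c \<circ> \<xi>') has_vector_derivative descent_field (\<xi>' s) c) (at s)"
        using integral_curve_atD(2)[OF ic'[OF s' s(2)] c(1) dom[OF s']] ati[OF s'] by simp
    qed (use e in auto)
    then have d: "((coord c \<circ> \<xi>') has_vector_derivative descent_field (\<xi>' T) c) (at T within {0..})"
      by (rule has_vector_derivative_at_within)
    show ?thesis
      by (rule integral_curve_atI[OF _ _ c d]) (use T ctT continuous_at_imp_continuous_at_within in auto)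
  qed
  show ?thesis
  proof (rule that[of "ereal (T + \<delta>)" \<xi>'])
    show "ereal T < ereal (T + \<delta>)" using \<delta> by simp
    show "\<xi>' t = \<xi> t" if "t \<in> time_interval (ereal T)" for t
      using that by (simp add: time_interval_iff \<xi>'_def)
    show "integral_curve (ereal (T + \<delta>)) \<xi>'" unfolding integral_curve_def
    proof
      fix t assume "t \<in> time_interval (ereal (T + \<delta>))"
      then have t: "0 \<le> t" "t < T + \<delta>" by (auto simp: time_interval_iff)
      consider "t < T" | "t = T" | "T < t" by linarith
      then show "integral_curve_at \<xi>' t" using before after at t by cases auto
    qed
  qed
qed

text \<open>In a coordinate ball around a cluster point the field is bounded, so a curve that is close to
  the cluster point shortly before \<open>T\<close> has no time left to leave the ball.\<close>

lemma integral_curve_limit: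
  assumes ic: "integral_curve (ereal T) \<xi>" and T: "T > 0" and K: "compact K"
    and freq: "\<exists>\<^sub>F t in at_left T. \<xi> t \<in> K"
  obtains z where "(\<xi> \<longlongrightarrow> z) (at_left T)"
proof -
  \<comment> \<open>The times spent in \<open>K\<close> accumulate at \<open>T\<close>, so
    restricting to them gives a proper filter that lives on \<open>K\<close>; compactness provides a
    cluster point.\<close>
  define G where "G = filtermap \<xi> (inf (at_left T) (principal {t. \<xi> t \<in> K}))"
  have "inf (at_left T) (principal {t. \<xi> t \<in> K}) \<noteq> bot"
  proof
    assume "inf (at_left T) (principal {t. \<xi> t \<in> K}) = bot"
    then have "eventually (\<lambda>_. False) (inf (at_left T) (principal {t. \<xi> t \<in> K}))" by simp
    then have "\<forall>\<^sub>F t in at_left T. \<not> \<xi> t \<in> K" by (simp add: eventually_inf_principal)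
    then show False using freq by (simp add: frequently_def)
  qed
  then have "G \<noteq> bot" by (simp add: G_def filtermap_bot_iff)
  moreover have "\<forall>\<^sub>F x in G. x \<in> K" by (simp add: G_def eventually_filtermap eventually_inf_principal)
  ultimately obtain z where z: "inf (nhds z) G \<noteq> bot"
    using K unfolding compact_filter by blast
  have near: "\<exists>\<^sub>F t in at_left T. \<xi> t \<in> U" if U: "open U" "z \<in> U" for U
  proof (rule ccontr)
    assume "\<not> (\<exists>\<^sub>F t in at_left T. \<xi> t \<in> U)"
    then have "\<forall>\<^sub>F t in at_left T. \<xi> t \<notin> U" by (simp add: frequently_def)
    then have "\<forall>\<^sub>F x in G. x \<notin> U"
      by (auto simp: G_def eventually_filtermap eventually_inf_principal elim: eventually_mono)
    then have "eventually (\<lambda>_. False) (inf (nhds z) G)"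
      unfolding eventually_inf
      by (intro exI[of _ "\<lambda>x. x \<in> U"] exI[of _ "\<lambda>x. x \<notin> U"]) (auto intro: eventually_nhds_in_open U)
    then show False using z by (simp add: eventually_False)
  qed
  have "(\<xi> \<longlongrightarrow> z) (at_left T)"
  proof (rule topological_tendstoI)
    fix V :: "'m set" assume V: "open V" "z \<in> V"
    obtain c where c: "c \<in> A" "z \<in> chart_dom c" using chart_exists by blast
    define x where "x = coord c z"
    have "open (chart_img c \<inter> param c -` V)"
      by (rule continuous_open_preimage[OF continuous_param[OF c(1)] open_chart_img[OF c(1)] V(1)])
    moreover have "x \<in> chart_img c \<inter> param c -` V"
      using c V(2) param_coord[OF c] by (simp add: x_def)
    ultimately obtain r where r: "r > 0" "cball x r \<subseteq> chart_img c \<inter> param c -` V"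
      unfolding open_contains_cball by blast
    then have rs: "cball x r \<subseteq> chart_img c" by blast
    obtain R where R: "\<And>y. y \<in> cball x r \<Longrightarrow> norm (descent_field (param c y) c) \<le> R"
      using field_bounded[OF c(1) compact_cball rs] by blast
    define R0 where "R0 = \<bar>R\<bar> + 1"
    have R0: "R0 > 0" "R \<le> R0" by (auto simp: R0_def)
    define U where "U = param c ` ball x (r/2)"
    have "ball x (r/2) \<subseteq> chart_img c" using rs r(1) by (auto simp: subset_iff)
    then have "open U" unfolding U_def by (rule open_param_image[OF c(1) open_ball])
    moreover have "z \<in> U"
      unfolding U_def using r param_coord[OF c] by (intro image_eqI[of _ _ x]) (auto simp: x_def)
    ultimately have fU: "\<exists>\<^sub>F t in at_left T. \<xi> t \<in> U" by (rule near)
    \<comment> \<open>After time \<open>b\<close> less than \<open>r / (2 * R0)\<close> remains,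
      during which a speed of at most \<open>R0\<close> cannot carry the curve farther than
      \<open>r / 2\<close>.\<close>
    define b where "b = max 0 (T - r / (2 * R0))"
    have b: "b < T" using T r R0 by (simp add: b_def)
    have "\<forall>\<^sub>F t in at_left T. t \<in> {b<..<T}" by (rule eventually_at_left_real[OF b])
    from frequently_ex[OF frequently_eventually_conj[OF fU this]]
    obtain t0 where t0: "\<xi> t0 \<in> U" "b < t0" "t0 < T" by auto
    have t0': "0 < t0" "R0 * (T - t0) \<le> r / 2"
    proof -
      show "0 < t0" using t0 by (simp add: b_def)
      have "T - t0 \<le> r / (2 * R0)" using t0 by (simp add: b_def)
      then have "R0 * (T - t0) \<le> R0 * (r / (2 * R0))" using R0 by (intro mult_left_mono) auto
      then show "R0 * (T - t0) \<le> r / 2" using R0 by simp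
    qed
    have stay: "\<xi> t \<in> V" if t: "t0 < t" "t < T" for t
    proof -
      have sub: "{t0..t} \<subseteq> time_interval (ereal T)" using t t0' by (auto simp: time_interval_iff)
      have "\<xi> t \<in> param c ` ball x r"
      proof (rule no_exit[OF c(1) rs integral_curve_continuous_on[OF ic sub]])
        show "\<xi> t0 \<in> param c ` ball x (r/2)" using t0 by (simp add: U_def)
        show "t \<in> {t0..t}" using t by simp
        fix s assume s: "s \<in> {t0..t}" and inb: "\<And>q. q \<in> {t0..s} \<Longrightarrow> \<xi> q \<in> param c ` ball x r"
        have "norm ((coord c \<circ> \<xi>) s - (coord c \<circ> \<xi>) t0 - (s - t0) *\<^sub>R 0) \<le> R0 * \<bar>s - t0\<bar>"
        proof (rule vector_derivative_bound[of "{t0..s}" "coord c \<circ> \<xi>" "\<lambda>q. descent_field (\<xi> q) c"])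
          fix q assume q: "q \<in> {t0..s}"
          obtain y where y: "y \<in> ball x r" "\<xi> q = param c y" using inb[OF q] by blast
          have yc: "y \<in> cball x r" using y(1) by simp
          then have dom: "\<xi> q \<in> chart_dom c" using param_in[OF c(1), of y] rs y(2) by auto
          have "q \<in> time_interval (ereal T)" using q s sub by auto
          then have "integral_curve_at \<xi> q" using ic unfolding integral_curve_def by blast
          then have "((coord c \<circ> \<xi>) has_vector_derivative descent_field (\<xi> q) c) (at q within {0..})"
            by (rule integral_curve_atD(2)) (rule c(1), rule dom)
          then show "((coord c \<circ> \<xi>) has_vector_derivative descent_field (\<xi> q) c) (at q within {t0..s})"
            by (rule has_vector_derivative_within_subset) (use t0' in auto)
          show "norm (descent_field (\<xi> q) c - 0) \<le> R0" using R[OF yc] y(2) R0 by simp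
        qed (use s in auto)
        also have "\<dots> \<le> R0 * (T - t0)" using s t R0 by (intro mult_left_mono) auto
        finally show "norm (coord c (\<xi> s) - coord c (\<xi> t0)) \<le> r / 2" using t0'(2) by simp
      qed
      then obtain y where "y \<in> ball x r" "\<xi> t = param c y" by blast
      then show ?thesis using r(2) by (auto simp: subset_iff)
    qed
    show "\<forall>\<^sub>F t in at_left T. \<xi> t \<in> V"
      unfolding eventually_at_left_field using t0(3) stay by blast
  qed
  then show ?thesis by (rule that)
qed

text \<open>Zorn's lemma is applied to graphs over the time intervals, which ignore the irrelevant
  values of a curve beyond its life span. The members of a chain agree where they overlap, and their
  union is the graph of an integral curve up to the supremum of the life spans.\<close>

lemma maximal_integral_curve:
  obtains T \<xi> where "0 < T" "integral_curve T \<xi>" "\<xi> 0 = x0"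
    "\<And>T' \<xi>'. T < T' \<Longrightarrow> integral_curve T' \<xi>' \<Longrightarrow> (\<And>t. t \<in> time_interval T \<Longrightarrow> \<xi>' t = \<xi> t) \<Longrightarrow> False"
proof -
  define graph where "graph T \<xi> = (\<lambda>t. (t, \<xi> t)) ` time_interval T" for T and \<xi> :: "real \<Rightarrow> 'm"
  define valid where "valid T \<xi> \<longleftrightarrow> 0 < T \<and> integral_curve T \<xi> \<and> \<xi> 0 = x0" for T \<xi>
  define \<G> where "\<G> = {g. \<exists>T \<xi>. valid T \<xi> \<and> g = graph T \<xi>}"
  have mem: "(t, y) \<in> graph T \<xi> \<longleftrightarrow> t \<in> time_interval T \<and> y = \<xi> t" for t y T \<xi>
    unfolding graph_def by auto
  have "\<exists>M\<in>\<G>. \<forall>X\<in>\<G>. M \<subseteq> X \<longrightarrow> X = M"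
  proof (rule subset_Zorn_nonempty)
    obtain \<delta> \<eta> where "\<delta> > 0" "integral_curve (ereal \<delta>) \<eta>" "\<eta> 0 = x0" using integral_curve_exists by blast
    then have "valid (ereal \<delta>) \<eta>" by (simp add: valid_def)
    then show "\<G> \<noteq> {}" unfolding \<G>_def by blast
    fix C assume C: "C \<noteq> {}" "subset.chain \<G> C"
    then have CG: "C \<subseteq> \<G>" and ch: "\<And>X Y. X \<in> C \<Longrightarrow> Y \<in> C \<Longrightarrow> X \<subseteq> Y \<or> Y \<subseteq> X"
      unfolding subset.chain_def by auto
    define P where "P = {(T, \<xi>). valid T \<xi> \<and> graph T \<xi> \<in> C}"
    have agree: "\<xi>1 t = \<xi>2 t" if "(T1, \<xi>1) \<in> P" "(T2, \<xi>2) \<in> P" "t \<in> time_interval T1" "t \<in> time_interval T2"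
      for T1 \<xi>1 T2 \<xi>2 t
    proof -
      have "graph T1 \<xi>1 \<subseteq> graph T2 \<xi>2 \<or> graph T2 \<xi>2 \<subseteq> graph T1 \<xi>1" using ch that unfolding P_def by blast
      then show ?thesis using mem[of t "\<xi>1 t" T1 \<xi>1] mem[of t "\<xi>2 t" T2 \<xi>2]
          mem[of t "\<xi>1 t" T2 \<xi>2] mem[of t "\<xi>2 t" T1 \<xi>1] that by auto
    qed
    define T where "T = (SUP q\<in>P. fst q)"
    define \<xi> where "\<xi> t = (SOME y. \<exists>q\<in>P. t \<in> time_interval (fst q) \<and> y = snd q t)" for t
    have \<xi>: "\<xi> t = \<xi>1 t" if q: "(T1, \<xi>1) \<in> P" "t \<in> time_interval T1" for T1 \<xi>1 t
    proof -
      have "\<exists>q\<in>P. t \<in> time_interval (fst q) \<and> \<xi> t = snd q t" unfolding \<xi>_def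
        by (rule someI[of _ "\<xi>1 t"], rule bexI[OF _ q(1)]) (use q(2) in simp)
      then obtain T2 \<xi>2 where "(T2, \<xi>2) \<in> P" "t \<in> time_interval T2" "\<xi> t = \<xi>2 t" by auto
      then show ?thesis using agree[of T2 \<xi>2 T1 \<xi>1 t] q by simp
    qed
    have le: "T1 \<le> T" if "(T1, \<xi>1) \<in> P" for T1 \<xi>1
      unfolding T_def using SUP_upper[OF that, of fst] by simp
    have ex: "\<exists>T1 \<xi>1. (T1, \<xi>1) \<in> P \<and> t \<in> time_interval T1" if "t \<in> time_interval T" for t
    proof -
      have "0 \<le> t" "ereal t < (SUP q\<in>P. fst q)" using that by (auto simp: time_interval_iff T_def)
      then obtain q where "q \<in> P" "ereal t < fst q" unfolding less_SUP_iff by blast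
      then show ?thesis using \<open>0 \<le> t\<close> by (intro exI[of _ "fst q"] exI[of _ "snd q"]) (simp add: time_interval_iff)
    qed
    obtain X where "X \<in> C" using C by blast
    then obtain T0 \<xi>0 where q0: "(T0, \<xi>0) \<in> P" "valid T0 \<xi>0" using CG unfolding P_def \<G>_def by blast
    have T0: "0 < T0" "0 \<in> time_interval T0" using q0(2) by (auto simp: valid_def time_interval_iff zero_ereal_def)
    have "integral_curve T \<xi>" unfolding integral_curve_def
    proof
      fix t assume t: "t \<in> time_interval T"
      obtain T1 \<xi>1 where q: "(T1, \<xi>1) \<in> P" "t \<in> time_interval T1" using ex[OF t] by blast
      show "integral_curve_at \<xi> t"
      proof (rule integral_curve_at_cong[of \<xi>1 t "{s. ereal s < T1}"])
        show "integral_curve_at \<xi>1 t" using q unfolding P_def valid_def integral_curve_def by blast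
        show "\<xi> s = \<xi>1 s" if "s \<in> {s. ereal s < T1}" "0 \<le> s" for s
          by (rule \<xi>[OF q(1)]) (use that in \<open>simp add: time_interval_iff\<close>)
      qed (use q(2) open_ereal_less in \<open>auto simp: time_interval_iff\<close>)
    qed
    moreover have "0 < T" using T0(1) le[OF q0(1)] by (rule less_le_trans)
    moreover have "\<xi> 0 = x0" using \<xi>[OF q0(1) T0(2)] q0(2) by (simp add: valid_def)
    ultimately have v: "valid T \<xi>" by (simp add: valid_def)
    have "\<Union>C = graph T \<xi>"
    proof (intro equalityI subsetI)
      fix a assume "a \<in> \<Union>C"
      then obtain X where X: "X \<in> C" "a \<in> X" by blast
      then obtain T1 \<xi>1 where q: "valid T1 \<xi>1" "X = graph T1 \<xi>1" using CG unfolding \<G>_def by blast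
      then have P1: "(T1, \<xi>1) \<in> P" using X unfolding P_def by blast
      obtain t where t: "t \<in> time_interval T1" "a = (t, \<xi>1 t)" using X q unfolding graph_def by blast
      have "t \<in> time_interval T" using t(1) le[OF P1] by (auto simp: time_interval_iff)
      then show "a \<in> graph T \<xi>" using t mem \<xi>[OF P1 t(1)] by simp
    next
      fix a assume "a \<in> graph T \<xi>"
      then obtain t where t: "t \<in> time_interval T" "a = (t, \<xi> t)" unfolding graph_def by blast
      obtain T1 \<xi>1 where q: "(T1, \<xi>1) \<in> P" "t \<in> time_interval T1" using ex[OF t(1)] by blast
      have "a \<in> graph T1 \<xi>1" using t q mem \<xi>[OF q] by simp
      then show "a \<in> \<Union>C" using q unfolding P_def by blast
    qed
    then show "\<Union>C \<in> \<G>" using v unfolding \<G>_def by blast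
  qed
  then obtain M where M: "M \<in> \<G>" "\<forall>X\<in>\<G>. M \<subseteq> X \<longrightarrow> X = M" by (elim bexE)
  from M(1) obtain T \<xi> where v: "valid T \<xi>" and MT: "M = graph T \<xi>" unfolding \<G>_def by blast
  have max: "X = graph T \<xi>" if "X \<in> \<G>" "graph T \<xi> \<subseteq> X" for X
    using M(2) that unfolding MT by blast
  show ?thesis
  proof (rule that[of T \<xi>])
    fix T' \<xi>' assume lt: "T < T'" and ic: "integral_curve T' \<xi>'"
      and eq: "\<And>t. t \<in> time_interval T \<Longrightarrow> \<xi>' t = \<xi> t"
    have z: "0 \<in> time_interval T" using v by (auto simp: valid_def time_interval_iff zero_ereal_def)
    have "valid T' \<xi>'" using v ic eq[OF z] lt unfolding valid_def by auto
    moreover have "graph T \<xi> \<subseteq> graph T' \<xi>'"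
    proof
      fix a assume "a \<in> graph T \<xi>"
      then obtain t where t: "t \<in> time_interval T" "a = (t, \<xi> t)" unfolding graph_def by blast
      then show "a \<in> graph T' \<xi>'" using eq[OF t(1)] lt mem by (auto simp: time_interval_iff)
    qed
    moreover from calculation(1) have "graph T' \<xi>' \<in> \<G>" unfolding \<G>_def by blast
    ultimately have ge: "graph T' \<xi>' = graph T \<xi>" by (intro max)
    \<comment> \<open>\<open>T\<close> is finite as it lies below \<open>T'\<close>. The time
      \<open>T\<close> itself belongs to the longer interval but not to the half-open shorter one,
      so the graphs differ.\<close>
    obtain t where t: "T = ereal t" "0 < t"
      using v lt unfolding valid_def by (cases T) auto
    have "(t, \<xi>' t) \<in> graph T' \<xi>'" using t lt mem by (simp add: time_interval_iff)
    then have "t \<in> time_interval T" using ge mem by simp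
    then show False using t by (simp add: time_interval_iff)
  qed (use v in \<open>auto simp: valid_def\<close>)
qed

subsection \<open>Energy\<close>

text \<open>Continuity of the slope cost is read off the equality case: it equals
  \<open>desc\<close> minus \<open>psi h\<close> at the field, and both terms are continuous because
  the field is.\<close>

lemma speed_field_cont: "continuous_on UNIV (\<lambda>p. F p (descent_field p))"
  and slope_cost_cont: "continuous_on UNIV (\<lambda>p. psi_star h (slope A F \<phi> p))"
proof -
  have "isCont (\<lambda>p. F p (descent_field p)) p \<and> isCont (\<lambda>p. psi_star h (slope A F \<phi> p)) p" for p
  proof -
    obtain c where c: "c \<in> A" "p \<in> chart_dom c" using chart_exists by blast
    have pair: "continuous_on (chart_dom c) (\<lambda>p. (coord c p, descent_field p c))"
      by (intro continuous_intros continuous_coord field_cont c)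
    have "continuous_on (chart_dom c) (\<lambda>p. loc c (coord c p) (descent_field p c))"
      by (rule continuous_on_compose2[OF loc_cont[OF c(1)] pair]) auto
    then have 1: "continuous_on (chart_dom c) (\<lambda>p. F p (descent_field p))"
      by (rule continuous_on_eq) (simp add: F_eq_loc[OF c(1) _ descent_field(1)])
    have 2: "continuous_on (chart_dom c) (\<lambda>p. ddir c (coord c p) (descent_field p c))"
      using continuous_on_compose2[OF ddir_cont[OF c(1)] pair] by fastforce
    have 3: "continuous_on (chart_dom c) (\<lambda>p. psi h (F p (descent_field p)))"
      by (rule continuous_on_compose2[OF psi_cont 1]) (use F_nonneg descent_field(1) in auto)
    have "continuous_on (chart_dom c) (\<lambda>p. ddir c (coord c p) (descent_field p c) - psi h (F p (descent_field p)))"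
      by (intro continuous_intros 2 3)
    then have "continuous_on (chart_dom c) (\<lambda>p. psi_star h (slope A F \<phi> p))"
      by (rule continuous_on_eq) (simp add: descent_field(2)[symmetric] desc_eq[OF c(1) _ descent_field(1)])
    with 1 show ?thesis using c open_chart_dom[OF c(1)] continuous_on_eq_continuous_at by blast
  qed
  then show "continuous_on UNIV (\<lambda>p. F p (descent_field p))" "continuous_on UNIV (\<lambda>p. psi_star h (slope A F \<phi> p))"
    by (simp_all add: continuous_at_imp_continuous_on)
qed

text \<open>The flow equation holds at every time with continuous right-hand side, so the
  fundamental theorem applies; the oriented integral covers \<open>s > t\<close>.\<close>

lemma integral_curve_energy_identity:
  assumes ic: "integral_curve T \<xi>"
  shows "energy_identity A F \<phi> h T \<xi>"
  unfolding energy_identity_def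
proof (intro ballI)
  fix s t assume st: "s \<in> time_interval T" "t \<in> time_interval T"
  let ?f = "\<lambda>r. psi h (speed A F T \<xi> r)" and ?g = "\<lambda>r. psi_star h (slope A F \<phi> (\<xi> r))"
  let ?J = "{min s t..max s t}"
  have sub: "?J \<subseteq> time_interval T"
  proof
    fix r assume r: "r \<in> ?J"
    have "max s t \<in> time_interval T" using st by (simp add: max_def)
    moreover have "0 \<le> r" "r \<le> max s t" using r st by (auto simp: time_interval_iff)
    ultimately show "r \<in> time_interval T"
      unfolding time_interval_iff using le_less_trans[of "ereal r" "ereal (max s t)" T] by (simp only: ereal_less_eq)
  qed
  have cx: "continuous_on ?J \<xi>" by (rule integral_curve_continuous_on[OF ic sub])
  have "continuous_on ?J (\<lambda>r. psi h (F (\<xi> r) (descent_field (\<xi> r))))"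
    by (rule continuous_on_compose2[OF psi_cont continuous_on_compose2[OF speed_field_cont cx]])
       (use F_nonneg descent_field(1) in auto)
  then have cf: "continuous_on ?J ?f"
    by (rule continuous_on_eq) (use sub integral_curve_velocity[OF ic] in \<open>simp add: subset_iff\<close>)
  have cg: "continuous_on ?J ?g"
    by (rule continuous_on_compose2[OF slope_cost_cont cx]) auto
  have int: "interval_lebesgue_integrable lborel (ereal s) (ereal t) u"
    if u: "continuous_on ?J u" for u :: "real \<Rightarrow> real"
  proof (cases "s \<le> t")
    case True
    then show ?thesis using interval_integrable_continuous_on[of s t u] u by (simp add: min_def max_def)
  next
    case False
    then have "interval_lebesgue_integrable lborel (ereal t) (ereal s) u"
      using interval_integrable_continuous_on[of t s u] u by (simp add: min_def max_def)
    then show ?thesis by (simp add: interval_integrable_endpoints_reverse)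
  qed
  have "(LBINT r=s..t. - ?f r - ?g r) = (\<phi> \<circ> \<xi>) t - (\<phi> \<circ> \<xi>) s"
  proof (rule interval_integral_FTC_finite)
    show "continuous_on ?J (\<lambda>r. - ?f r - ?g r)" by (intro continuous_intros cf cg)
    fix r assume r: "min s t \<le> r" "r \<le> max s t"
    then have rT: "r \<in> time_interval T" using sub by auto
    then have at: "integral_curve_at \<xi> r" "0 \<le> r" using ic unfolding integral_curve_def by (auto simp: time_interval_iff)
    have "((\<phi> \<circ> \<xi>) has_real_derivative - ?f r - ?g r) (at r within {0..})"
      using integral_curve_phi_deriv[OF at] integral_curve_velocity[OF ic rT] by simp
    then have "((\<phi> \<circ> \<xi>) has_real_derivative - ?f r - ?g r) (at r within ?J)"
      by (rule has_field_derivative_subset) (use sub in \<open>auto simp: time_interval_iff\<close>)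
    then show "((\<phi> \<circ> \<xi>) has_vector_derivative - ?f r - ?g r) (at r within ?J)"
      by (simp add: has_real_derivative_iff_has_vector_derivative)
  qed
  moreover have "(LBINT r=s..t. - ?f r - ?g r) = - (LBINT r=s..t. ?f r + ?g r)"
    by (simp flip: interval_lebesgue_integral_uminus)
  moreover have "(LBINT r=s..t. ?f r + ?g r) = (LBINT r=s..t. ?f r) + (LBINT r=s..t. ?g r)"
    by (rule interval_lebesgue_integral_add[OF int[OF cf] int[OF cg]])
  ultimately show "interval_lebesgue_integrable lborel (ereal s) (ereal t) ?f \<and>
      interval_lebesgue_integrable lborel (ereal s) (ereal t) ?g \<and>
      (\<phi> \<circ> \<xi>) s - (\<phi> \<circ> \<xi>) t = (LBINT r=s..t. ?f r) + (LBINT r=s..t. ?g r)"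
    using int[OF cf] int[OF cg] by simp
qed

text \<open>Since \<open>x \<le> \<psi> x + \<psi>\<^sup>* 1\<close>, the dissipated energy and the elapsed time control the distance.\<close>

lemma integral_curve_dist_le:
  assumes ic: "integral_curve T \<xi>" and t1: "t1 \<in> time_interval T"
  shows "d (\<xi> 0) (\<xi> t1) \<le> \<phi> (\<xi> 0) - \<phi> (\<xi> t1) + (psi_star h 1 + 1) * t1"
proof -
  define k where "k = psi_star h 1"
  \<comment> \<open>The estimate is additive over adjacent intervals by the triangle inequality, so
    by bisection it is enough to prove it on short intervals around each time. The extra 1 in
    \<open>k + 1\<close> absorbs two errors of \<open>1/2\<close> per unit of time, one from
    linearizing \<open>\<phi>\<close> and one from \<open>chord_dist\<close>.\<close>
  define P where "P a b \<longleftrightarrow> (a \<in> {0..t1} \<longrightarrow> b \<in> {0..t1} \<longrightarrow>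
      d (\<xi> a) (\<xi> b) \<le> \<phi> (\<xi> a) - \<phi> (\<xi> b) + (k + 1) * (b - a))" for a b
  have t10: "0 \<le> t1" using t1 by (simp add: time_interval_iff)
  from t10 have "P 0 t1"
  proof (induction rule: Bolzano)
    case (trans a b e)
    show ?case unfolding P_def
    proof (intro impI)
      assume ae: "a \<in> {0..t1}" "e \<in> {0..t1}"
      then have "b \<in> {0..t1}" using trans by auto
      then have "d (\<xi> a) (\<xi> b) \<le> \<phi> (\<xi> a) - \<phi> (\<xi> b) + (k + 1) * (b - a)"
        "d (\<xi> b) (\<xi> e) \<le> \<phi> (\<xi> b) - \<phi> (\<xi> e) + (k + 1) * (e - b)"
        using trans(1,2) ae unfolding P_def by blast+
      then show "d (\<xi> a) (\<xi> e) \<le> \<phi> (\<xi> a) - \<phi> (\<xi> e) + (k + 1) * (e - a)"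
        using dist_triangle_ineq[of "\<xi> a" "\<xi> e" "\<xi> b"] by (simp add: algebra_simps)
    qed
  next
    case (local x)
    have xT: "x \<in> time_interval T" using local t1 by (auto simp: time_interval_iff intro: le_less_trans[of _ "ereal t1"])
    have at: "integral_curve_at \<xi> x" using ic xT unfolding integral_curve_def by blast
    obtain c where c: "c \<in> A" "\<xi> x \<in> chart_dom c" using chart_exists by blast
    define q where "q = psi h (F (\<xi> x) (descent_field (\<xi> x))) + psi_star h (slope A F \<phi> (\<xi> x))"
    have Fq: "F (\<xi> x) (descent_field (\<xi> x)) \<le> q + k"
      using fenchel_young[of "F (\<xi> x) (descent_field (\<xi> x))" 1] F_nonneg[OF descent_field(1)]
        psi_star_nonneg[OF dual_tangent(3)[of "\<xi> x"]] by (simp add: q_def k_def)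
    have Fl: "loc c (coord c (\<xi> x)) (descent_field (\<xi> x) c) = F (\<xi> x) (descent_field (\<xi> x))"
      using F_eq_loc[OF c descent_field(1)] by simp
    have "((\<phi> \<circ> \<xi>) has_real_derivative - q) (at x within {0..})"
      using integral_curve_phi_deriv[OF at] local by (simp add: q_def)
    then have "((\<phi> \<circ> \<xi>) has_vector_derivative - q) (at x within {0..})"
      by (simp add: has_real_derivative_iff_has_vector_derivative)
    then obtain \<delta>1 where \<delta>1: "\<delta>1 > 0" "\<And>a b. a \<in> {0..} \<Longrightarrow> b \<in> {0..} \<Longrightarrow> a \<le> x \<Longrightarrow> x \<le> b \<Longrightarrow> b - a < \<delta>1 \<Longrightarrow>
      norm ((\<phi> \<circ> \<xi>) b - (\<phi> \<circ> \<xi>) a - (b - a) *\<^sub>R (- q)) \<le> 1/2 * (b - a)"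
      by (rule straddle[of _ _ _ _ "1/2"]) auto
    obtain \<delta>2 where \<delta>2: "\<delta>2 > 0" "\<And>a b. a \<in> {0..} \<Longrightarrow> b \<in> {0..} \<Longrightarrow> a \<le> x \<Longrightarrow> x \<le> b \<Longrightarrow> b - a < \<delta>2 \<Longrightarrow>
      d (\<xi> a) (\<xi> b) \<le> (b - a) * (loc c (coord c (\<xi> x)) (descent_field (\<xi> x) c) + 1/2)"
      by (rule chord_dist[OF c integral_curve_atD(2)[OF at c] integral_curve_atD(1)[OF at], of "1/2"])
         (use local in auto)
    show ?case
    proof (intro exI[of _ "min \<delta>1 \<delta>2"] conjI allI impI)
      show "min \<delta>1 \<delta>2 > 0" using \<delta>1 \<delta>2 by simp
      fix a b assume ab: "a \<le> x \<and> x \<le> b \<and> b - a < min \<delta>1 \<delta>2"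
      show "P a b" unfolding P_def
      proof (intro impI)
        assume "a \<in> {0..t1}" "b \<in> {0..t1}"
        then have ab0: "a \<in> {0..}" "b \<in> {0..}" by auto
        define X where "X = (b - a) * q"
        define Y where "Y = (b - a) * k"
        have "\<bar>\<phi> (\<xi> b) - \<phi> (\<xi> a) + X\<bar> \<le> 1/2 * (b - a)"
          using \<delta>1(2)[OF ab0] ab by (simp add: X_def)
        moreover have "d (\<xi> a) (\<xi> b) \<le> X + Y + 1/2 * (b - a)"
        proof -
          have "d (\<xi> a) (\<xi> b) \<le> (b - a) * (F (\<xi> x) (descent_field (\<xi> x)) + 1/2)"
            using \<delta>2(2)[OF ab0] ab Fl by simp
          also have "\<dots> \<le> (b - a) * (q + k + 1/2)"
            using Fq ab by (intro mult_left_mono) auto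
          also have "\<dots> = X + Y + 1/2 * (b - a)" by (simp add: X_def Y_def algebra_simps)
          finally show ?thesis .
        qed
        ultimately have "d (\<xi> a) (\<xi> b) \<le> \<phi> (\<xi> a) - \<phi> (\<xi> b) + (Y + (b - a))"
          by argo
        moreover have "Y + (b - a) = (k + 1) * (b - a)" by (simp add: Y_def algebra_simps)
        ultimately show "d (\<xi> a) (\<xi> b) \<le> \<phi> (\<xi> a) - \<phi> (\<xi> b) + (k + 1) * (b - a)"
          by simp
      qed
    qed
  qed
  then show ?thesis using t10 by (simp add: P_def k_def)
qed

lemma maximal_flow:
  assumes complete: "forward_complete A F"
  shows "\<exists>T \<xi>. maximal_gradient_flow_solution A F \<phi> h x0 T \<xi> \<and> energy_identity A F \<phi> h T \<xi> \<and>
           (T < \<infinity> \<longrightarrow> filterlim (\<lambda>t. d x0 (\<xi> t)) at_top (at_left (real_of_ereal T))) \<and>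
           (bounded (range \<phi>) \<longrightarrow> T = \<infinity>)"
proof -
  obtain T \<xi> where T: "0 < T" and ic: "integral_curve T \<xi>" and x0: "\<xi> 0 = x0"
    and max: "\<And>T' \<xi>'. T < T' \<Longrightarrow> integral_curve T' \<xi>' \<Longrightarrow> (\<And>t. t \<in> time_interval T \<Longrightarrow> \<xi>' t = \<xi> t) \<Longrightarrow> False"
    using maximal_integral_curve[of x0] by blast
  \<comment> \<open>A longer solution would be a longer integral curve by
    \<open>solution_integral_curve\<close>.\<close>
  have maxsol: "maximal_gradient_flow_solution A F \<phi> h x0 T \<xi>"
    unfolding maximal_gradient_flow_solution_def
    using integral_curve_solution[OF ic T x0] solution_integral_curve max by blast
  have blowup: "filterlim (\<lambda>t. d x0 (\<xi> t)) at_top (at_left \<tau>)" if \<tau>: "T = ereal \<tau>" for \<tau>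
  proof (rule ccontr)
    assume "\<not> filterlim (\<lambda>t. d x0 (\<xi> t)) at_top (at_left \<tau>)"
    \<comment> \<open>If the distance does not tend to infinity, then times at which it is below
      some fixed \<open>Z\<close> accumulate at \<open>\<tau>\<close>.\<close>
    then obtain Z where Z: "\<not> (\<forall>\<^sub>F t in at_left \<tau>. Z \<le> d x0 (\<xi> t))" unfolding filterlim_at_top by blast
    obtain K where K: "compact K" "{z. d x0 z < Z} \<subseteq> K"
      using forward_complete_rel_compact_ball[OF complete] unfolding rel_compact_ball_def by blast
    have "\<exists>\<^sub>F t in at_left \<tau>. \<xi> t \<in> K"
    proof (rule ccontr)
      assume "\<not> (\<exists>\<^sub>F t in at_left \<tau>. \<xi> t \<in> K)"
      then have "\<forall>\<^sub>F t in at_left \<tau>. \<xi> t \<notin> K" by (simp add: frequently_def)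
      then have "\<forall>\<^sub>F t in at_left \<tau>. Z \<le> d x0 (\<xi> t)"
        by (rule eventually_mono) (use K(2) in \<open>auto simp: not_less[symmetric]\<close>)
      then show False using Z by blast
    qed
    moreover have "\<tau> > 0" using T \<tau> by simp
    moreover have ic': "integral_curve (ereal \<tau>) \<xi>" using ic \<tau> by simp
    ultimately obtain z where z: "(\<xi> \<longlongrightarrow> z) (at_left \<tau>)"
      using integral_curve_limit[OF _ _ K(1)] by blast
    obtain T' \<xi>' where "ereal \<tau> < T'" "integral_curve T' \<xi>'"
      "\<And>t. t \<in> time_interval (ereal \<tau>) \<Longrightarrow> \<xi>' t = \<xi> t"
      using integral_curve_extend[OF ic' \<open>\<tau> > 0\<close> z] by blast
    then show False using max \<tau> by blast
  qed
  have inf: "T = \<infinity>" if bdd: "bounded (range \<phi>)"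
  proof (rule ccontr)
    assume "T \<noteq> \<infinity>"
    then obtain \<tau> where \<tau>: "T = ereal \<tau>" "\<tau> > 0" using T by (cases T) auto
    obtain B where B: "\<And>p. \<bar>\<phi> p\<bar> \<le> B" using bdd unfolding bounded_iff by auto
    \<comment> \<open>The oscillation of \<open>\<phi>\<close> plus the time term bounds the
      distance; adding 1 makes the contradiction strict.\<close>
    define Z where "Z = 2 * B + \<bar>psi_star h 1 + 1\<bar> * \<tau> + 1"
    have "\<forall>\<^sub>F t in at_left \<tau>. Z \<le> d x0 (\<xi> t)"
      using blowup[OF \<tau>(1)] unfolding filterlim_at_top by blast
    moreover have "\<forall>\<^sub>F t in at_left \<tau>. t \<in> {0<..<\<tau>}" by (rule eventually_at_left_real[OF \<tau>(2)])
    ultimately have "\<forall>\<^sub>F t in at_left \<tau>. Z \<le> d x0 (\<xi> t) \<and> t \<in> {0<..<\<tau>}" by (rule eventually_conj)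
    then obtain t where t: "Z \<le> d x0 (\<xi> t)" "0 < t" "t < \<tau>"
      using eventually_happens' [of "at_left \<tau>"] by fastforce
    have "t \<in> time_interval T" using t \<tau> by (simp add: time_interval_iff)
    from integral_curve_dist_le[OF ic this]
    have "d x0 (\<xi> t) \<le> \<phi> (\<xi> 0) - \<phi> (\<xi> t) + (psi_star h 1 + 1) * t" by (simp add: x0)
    moreover have "(psi_star h 1 + 1) * t \<le> \<bar>psi_star h 1 + 1\<bar> * \<tau>"
      using t by (intro mult_mono) auto
    moreover have "\<phi> (\<xi> 0) - \<phi> (\<xi> t) \<le> 2 * B" using B[of "\<xi> 0"] B[of "\<xi> t"] by linarith
    ultimately show False using t(1) by (simp add: Z_def)
  qed
  have "T < \<infinity> \<Longrightarrow> filterlim (\<lambda>t. d x0 (\<xi> t)) at_top (at_left (real_of_ereal T))"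
    using blowup T by (cases T) auto
  then show ?thesis using maxsol integral_curve_energy_identity[OF ic] inf by blast
qed

end

theorem theorem3p12:
  fixes A :: "('m::{t2_space, second_countable_topology}, 'n::finite) chart set"
    and F :: "'m \<Rightarrow> ('m, 'n) tvec \<Rightarrow> real"
    and \<phi> :: "'m \<Rightarrow> real"
    and h :: "real \<Rightarrow> real"
    and x\<^sub>0 :: 'm
  assumes "finsler_manifold A F"
    and "forward_complete A F"
    and "C_function 1 A \<phi>"
    and "continuous_on {0..} h"
    and "h ` {0..} = {0..}"
    and "strict_mono_on {0..} h"
  shows "\<exists>T \<xi>. maximal_gradient_flow_solution A F \<phi> h x\<^sub>0 T \<xi> \<and>
           energy_identity A F \<phi> h T \<xi> \<and>
           (T < \<infinity> \<longrightarrow>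
              filterlim (\<lambda>t. finsler_dist A F x\<^sub>0 (\<xi> t)) at_top (at_left (real_of_ereal T))) \<and>
           (bounded (range \<phi>) \<longrightarrow> T = \<infinity>)"
proof -
  interpret gradient_flow A F h \<phi>
    by unfold_locales (fact assms)+
  show ?thesis by (rule maximal_flow[OF assms(2)])
qed

end
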